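(* Assume: (1) for each $i=1,\ldots,M$ there exist a constant $\tau_i>0$ and a positive continuous function $\rho_i:\mathbb{R}^d\to\mathbb{R}_+$ with $k_i^0(x,x')=\tau_i^2\rho_i(x-x')$ such that (1a) $\rho_i(|\delta|)=\rho_i(\delta)$, where $|\cdot|$ is the component-wise absolute value; (1b) $\rho_i(\delta)$ is decreasing in $\delta$ component-wise for $\delta\ge 0$; (1c) $\rho_i(0)=1$ and $\rho_i(\delta)\to 0$ as $\|\delta\|\to\infty$ (Euclidean norm); (1d) there exist $0<C_i<\infty$ and $\varepsilon_i,u_i>0$ such that $1-\rho_i(\delta)\le C_i/|\log\|\delta\||^{1+\varepsilon_i}$ for all $\delta$ with $\|\delta\|<u_i$; (2) $\mathcal{X}\subset\mathbb{R}^d$ is compact with nonempty interior; (3) for each $i=1,\ldots,M$, the functions $\mu_i^0(\cdot)$, $\lambda_i(\cdot)>0$ and $c_i(\cdot)>0$ are continuous on $\mathcal{X}$, and $\gamma(\cdot)>0$ on $\mathcal{X}$. Let $\{\varepsilon_n\}$ be a sequence of non-negative real numbers with $\varepsilon_n\to 0$ as $n\to\infty$. Then the quasi-IKG policy, i.e. any policy whose sampling decisions $(\tilde a^n,\tilde v^n)$ satisfy $$\mathrm{IKG}^n(\tilde a^n,\tilde v^n)\ \ge\ \max_{1\le i\le M,\,x\in\mathcal{X}}\mathrm{IKG}^n(i,x)-\varepsilon_n\qquad\text{for all } n\ge 0,$$ is consistent: under it, for all $x\in\mathcal{X}$, $$\lim_{B\to\infty}\operatorname{argmax}_{1\le i\le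 M}\mu_i^{N(B)}(x)=\operatorname{argmax}_{1\le i\le M}\theta_i(x)\quad\text{almost surely}.$$
   Context: Setting. There are $M\ge 2$ alternatives; $\mathcal{X}\subset\mathbb{R}^d$; $\gamma$ is a probability density on $\mathcal{X}$. Under the prior, $\theta_1,\ldots,\theta_M$ are mutually independent Gaussian processes on $\mathcal{X}$, $\theta_i$ having mean function $\mu_i^0$ and covariance function $k_i^0$. The sampling variances $\lambda_i(x)$ and sampling costs $c_i(x)>0$ are known functions on $\mathcal{X}$. At each time $n=0,1,2,\ldots$ a sampling decision, generically written $(a^n,v^n)\in\{1,\ldots,M\}\times\mathcal{X}$, is made and a sample $y^{n+1}$ is observed (under the quasi-IKG policy the decision is $(\tilde a^n,\tilde v^n)$). $\mathscr{F}^n$ is the $\sigma$-algebra generated by $(a^0,v^0),y^1,\ldots,(a^{n-1},v^{n-1}),y^n$, and $(a^n,v^n)$ is $\mathscr{F}^n$-measurable. Given $\theta_{a^n}(v^n)$, $y^{n+1}$ is normal with mean $\theta_{a^n}(v^n)$ and variance $\lambda_{a^n}(v^n)$, with sampling noises independent across samples. Posterior. $\mu_i^n(x)=\mathbb{E}[\theta_i(x)\mid\mathscr{F}^n]$ and $k_i^n(x,x')=\mathrm{Cov}[\theta_i(x),\theta_i(x')\mid\mathscr{F}^n]$. Explicitly, with $V$ the list (with repetitions, in order of appearance) of the $v^\ell$ with $a^\ell=i$, $0\le\ell\le n-1$, and $y$ the vector of the corresponding $y^{\ell+1}$, $$\mu_i^n(x)=\mu_i^0(x)+k_i^0(x,V)[k_i^0(V,V)+\lambda_i(V)]^{-1}[y-\mu_i^0(V)],$$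 $$k_i^n(x,x')=k_i^0(x,x')-k_i^0(x,V)[k_i^0(V,V)+\lambda_i(V)]^{-1}k_i^0(V,x'),$$ where $\lambda_i(V)$ is the diagonal matrix with entries $\lambda_i(v)$, $v\in V$. Let $\tilde\sigma_i^n(x,v)=k_i^n(x,v)/\sqrt{k_i^n(v,v)+\lambda_i(v)}$. Conditionally on $\mathscr{F}^n$, $a^n=i$, $v^n=x$, one has $\mu_i^{n+1}(v)=\mu_i^n(v)+\tilde\sigma_i^n(v,x)Z^{n+1}$ and $\mu_a^{n+1}(v)=\mu_a^n(v)$ for $a\ne i$, with $Z^{n+1}$ standard normal independent of $\mathscr{F}^n$. IKG factor. $$\mathrm{IKG}^n(i,x)=\frac{1}{c_i(x)}\int_{\mathcal{X}}\Big\{\mathbb{E}\big[\max_{1\le a\le M}\mu_a^{n+1}(v)\,\big|\,\mathscr{F}^n,a^n=i,v^n=x\big]-\max_{1\le a\le M}\mu_a^n(v)\Big\}\gamma(v)\,dv.$$ Budget. For a budget $B>0$, $N(B)=\min\{N:\sum_{n=0}^N c_{a^n}(v^n)>B\}$, where $(a^n,v^n)$ are the decisions actually taken. Convergence of argmax (a subset of the finite set $\{1,\ldots,M\}$) means eventual equality; "almost surely for all $x$" means: for each fixed $x$, almost surely.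
   Formalization: Adds that every ball around each x in X has positive γ-mass in X (automatic if X is the closure of its interior; without it the claim fails, e.g. X=[0,1]∪{5} with ρ=exp(-|δ|)), and fixes versions of θ_i with almost surely continuous paths on X, which exist by (1d). *)

theory Defs
  imports
    "HOL-Probability.Probability"
    "Jordan_Normal_Form.Gauss_Jordan_Elimination"
begin

subsection \<open>Gaussian processes\<close>

(* Normal law with mean m and variance s2; the degenerate case s2 = 0 is the point mass at m. *)
definition normal_law :: "real \<Rightarrow> real \<Rightarrow> real measure" where
  "normal_law m s2 =
     (if s2 = 0 then return borel m else density lborel (normal_density m (sqrt s2)))"

(* Joint normality of the finite-dimensional distributions, stated as normality of all finite
   linear combinations. *)
definition gaussian_process ::
  "'w measure \<Rightarrow> 'x set \<Rightarrow> ('x \<Rightarrow> real) \<Rightarrow> ('x \<Rightarrow> 'x \<Rightarrow> real) \<Rightarrow> ('x \<Rightarrow> 'w \<Rightarrow> real) \<Rightarrow> bool" where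
  "gaussian_process P X m k f \<longleftrightarrow>
     (\<forall>x\<in>X. f x \<in> borel_measurable P) \<and>
     (\<forall>S b. finite S \<and> S \<subseteq> X \<longrightarrow>
        distr P borel (\<lambda>\<omega>. \<Sum>x\<in>S. b x * f x \<omega>) =
          normal_law (\<Sum>x\<in>S. b x * m x) (\<Sum>x\<in>S. \<Sum>x'\<in>S. b x * b x' * k x x'))"


subsection \<open>Posterior of a Gaussian process\<close>

(* A history is the list of all samples taken so far, in order: entries (a, v, y) mean that
   alternative a was sampled at the point v with outcome y. *)
type_synonym 'x history = "(nat \<times> 'x \<times> real) list"

definition samples :: "nat \<Rightarrow> 'x history \<Rightarrow> ('x \<times> real) list" where
  "samples i h = map snd (filter (\<lambda>s. fst s = i) h)"

definition cov_matrix :: "('x \<Rightarrow> 'x \<Rightarrow> real) \<Rightarrow> ('x \<Rightarrow> real) \<Rightarrow> 'x list \<Rightarrow> real mat" where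
  "cov_matrix k lam V =
     Matrix.mat (length V) (length V)
       (\<lambda>(p, q). k (V ! p) (V ! q) + (if p = q then lam (V ! p) else 0))"

(* k(x,V) [k(V,V) + lam(V)]^(-1) z.  The matrix inverted is positive definite whenever k is a
   covariance function and lam > 0, so mat_inverse does not return None then. *)
definition kriging ::
  "('x \<Rightarrow> 'x \<Rightarrow> real) \<Rightarrow> ('x \<Rightarrow> real) \<Rightarrow> 'x list \<Rightarrow> 'x \<Rightarrow> real Matrix.vec \<Rightarrow> real" where
  "kriging k lam V x z =
     scalar_prod (Matrix.vec (length V) (\<lambda>p. k x (V ! p)))
       (the (mat_inverse (cov_matrix k lam V)) *\<^sub>v z)"

definition post_mean ::
  "(nat \<Rightarrow> 'x \<Rightarrow> real) \<Rightarrow> (nat \<Rightarrow> 'x \<Rightarrow> 'x \<Rightarrow> real) \<Rightarrow> (nat \<Rightarrow> 'x \<Rightarrow> real) \<Rightarrow>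
   'x history \<Rightarrow> nat \<Rightarrow> 'x \<Rightarrow> real" where
  "post_mean \<mu>0 k0 lam h i x =
     (let V = map fst (samples i h); y = map snd (samples i h)
      in \<mu>0 i x +
         kriging (k0 i) (lam i) V x (Matrix.vec (length V) (\<lambda>p. y ! p - \<mu>0 i (V ! p))))"

definition post_cov ::
  "(nat \<Rightarrow> 'x \<Rightarrow> 'x \<Rightarrow> real) \<Rightarrow> (nat \<Rightarrow> 'x \<Rightarrow> real) \<Rightarrow> 'x history \<Rightarrow> nat \<Rightarrow> 'x \<Rightarrow> 'x \<Rightarrow> real" where
  "post_cov k0 lam h i x x' =
     (let V = map fst (samples i h)
      in k0 i x x' -
         kriging (k0 i) (lam i) V x (Matrix.vec (length V) (\<lambda>p. k0 i (V ! p) x')))"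

definition sigma_tilde ::
  "(nat \<Rightarrow> 'x \<Rightarrow> 'x \<Rightarrow> real) \<Rightarrow> (nat \<Rightarrow> 'x \<Rightarrow> real) \<Rightarrow> 'x history \<Rightarrow> nat \<Rightarrow> 'x \<Rightarrow> 'x \<Rightarrow> real" where
  "sigma_tilde k0 lam h i x v =
     post_cov k0 lam h i x v / sqrt (post_cov k0 lam h i v v + lam i v)"


subsection \<open>The integrated knowledge gradient\<close>

(* Conditional expectation of the next maximal posterior mean at v, given the history h and the
   decision to sample alternative i at x.  The decision is a hypothetical one, so this is the
   integral against the one-step predictive law: the posterior mean of i at v moves by
   sigma_tilde(v,x) times a standard normal variable, the other posterior means do not move. *)
definition expected_next_max ::
  "nat \<Rightarrow> (nat \<Rightarrow> 'x \<Rightarrow> real) \<Rightarrow> (nat \<Rightarrow> 'x \<Rightarrow> 'x \<Rightarrow> real) \<Rightarrow> (nat \<Rightarrow> 'x \<Rightarrow> real) \<Rightarrow>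
   'x history \<Rightarrow> nat \<Rightarrow> 'x \<Rightarrow> 'x \<Rightarrow> real" where
  "expected_next_max M \<mu>0 k0 lam h i x v =
     (\<integral>z. (MAX a\<in>{1..M}. post_mean \<mu>0 k0 lam h a v +
                (if a = i then sigma_tilde k0 lam h i v x * z else 0)) \<partial>normal_law 0 1)"

definition IKG ::
  "nat \<Rightarrow> (real ^ 'd) set \<Rightarrow> (real ^ 'd \<Rightarrow> real) \<Rightarrow>
   (nat \<Rightarrow> real ^ 'd \<Rightarrow> real) \<Rightarrow> (nat \<Rightarrow> real ^ 'd \<Rightarrow> real ^ 'd \<Rightarrow> real) \<Rightarrow>
   (nat \<Rightarrow> real ^ 'd \<Rightarrow> real) \<Rightarrow> (nat \<Rightarrow> real ^ 'd \<Rightarrow> real) \<Rightarrow>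
   (real ^ 'd) history \<Rightarrow> nat \<Rightarrow> real ^ 'd \<Rightarrow> real" where
  "IKG M X \<gamma> \<mu>0 k0 lam c h i x =
     1 / c i x *
     (LINT v:X|lborel.
        (expected_next_max M \<mu>0 k0 lam h i x v - (MAX a\<in>{1..M}. post_mean \<mu>0 k0 lam h a v)) * \<gamma> v)"

(* A Lebesgue density on X whose value is positive at every point of X and whose law has every
   point of X in its support.  The support clause matters only for sets X having relatively open
   parts of Lebesgue measure zero (e.g. isolated points): there the pointwise values of a density
   say nothing about the law, and consistency at such points fails.  See
   positive_density_onI for the usual domains, where the clause is automatic. *)
definition positive_density_on :: "(real ^ 'd) set \<Rightarrow> (real ^ 'd \<Rightarrow> real) \<Rightarrow> bool" where
  "positive_density_on X \<gamma> \<longleftrightarrow>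
     set_integrable lborel X \<gamma> \<and> (LINT v:X|lborel. \<gamma> v) = 1 \<and> (\<forall>x\<in>X. 0 < \<gamma> x) \<and>
     (\<forall>x\<in>X. \<forall>r>0. 0 < (LINT v:X \<inter> ball x r|lborel. \<gamma> v))"

lemma positive_density_onI:
  fixes X :: "(real ^ 'd) set"
  assumes X: "compact X" "X \<subseteq> closure (interior X)"
    and int: "set_integrable lborel X \<gamma>" "(LINT v:X|lborel. \<gamma> v) = 1"
    and pos: "\<And>x. x \<in> X \<Longrightarrow> 0 < \<gamma> x"
  shows "positive_density_on X \<gamma>"
proof -
  have "0 < (LINT v:X \<inter> ball x r|lborel. \<gamma> v)" if x: "x \<in> X" and r: "r > 0" for x r
  proof -
    let ?A = "X \<inter> ball x r" and ?U = "interior X \<inter> ball x r"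
    have A: "?A \<in> sets lborel"
      using compact_imp_closed[OF X(1)] by (simp add: borel_closed)
    have "?U \<noteq> {}"
    proof -
      have "x \<in> closure (interior X)" using x X(2) by blast
      then obtain z where "z \<in> interior X" "dist z x < r"
        using r unfolding closure_approachable by blast
      then have "z \<in> ?U" by (simp add: dist_commute)
      then show ?thesis by blast
    qed
    then have U: "open ?U" "?U \<noteq> {}" by auto
    have i: "set_integrable lborel ?A \<gamma>"
      by (rule set_integrable_subset[OF int(1) A]) auto
    show ?thesis
    proof (rule ccontr)
      assume "\<not> ?thesis"
      moreover have "0 \<le> (LINT v:?A|lborel. \<gamma> v)"
        unfolding set_lebesgue_integral_def
        by (rule integral_nonneg_AE) (auto simp: indicator_def intro!: AE_I2 less_imp_le pos)
      ultimately have "(LINT v:?A|lborel. \<gamma> v) = 0" by simp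
      then have "AE v in lborel. indicat_real ?A v *\<^sub>R \<gamma> v = 0"
        using i unfolding set_lebesgue_integral_def set_integrable_def
        by (subst integral_nonneg_eq_0_iff_AE[symmetric])
          (auto simp: indicator_def intro!: AE_I2 less_imp_le pos)
      then have "AE v in lborel. v \<notin> ?U"
      proof eventually_elim
        case (elim v)
        show ?case
        proof
          assume "v \<in> ?U"
          then have "v \<in> ?A" using interior_subset[of X] by blast
          then show False using elim pos[of v] by simp
        qed
      qed
      then have "?U \<in> null_sets lborel"
        using U(1) AE_iff_null_sets[of ?U lborel] by (simp add: borel_open)
      then have "negligible ?U"
        by (simp add: negligible_iff_null_sets null_sets_completionI)
      then show False
        using U open_not_negligible by blast
    qed
  qed
  then show ?thesis
    using int pos by (auto simp: positive_density_on_def)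
qed


subsection \<open>Sequential sampling\<close>

(* y (Suc n) is the outcome of the sample taken by the decision (a n, v n); y 0 is not used. *)
definition history ::
  "(nat \<Rightarrow> 'w \<Rightarrow> nat) \<Rightarrow> (nat \<Rightarrow> 'w \<Rightarrow> 'x) \<Rightarrow> (nat \<Rightarrow> 'w \<Rightarrow> real) \<Rightarrow> nat \<Rightarrow> 'w \<Rightarrow> 'x history" where
  "history a v y n \<omega> = map (\<lambda>l. (a l \<omega>, v l \<omega>, y (Suc l) \<omega>)) [0..<n]"

definition filtration ::
  "'w measure \<Rightarrow> (nat \<Rightarrow> 'w \<Rightarrow> nat) \<Rightarrow> (nat \<Rightarrow> 'w \<Rightarrow> real ^ 'd) \<Rightarrow> (nat \<Rightarrow> 'w \<Rightarrow> real) \<Rightarrow>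
   nat \<Rightarrow> 'w measure" where
  "filtration P a v y n =
     vimage_algebra (space P) (\<lambda>\<omega>. \<lambda>l\<in>{..<n}. (a l \<omega>, v l \<omega>, y (Suc l) \<omega>))
       (\<Pi>\<^sub>M l\<in>{..<n}. count_space UNIV \<Otimes>\<^sub>M borel \<Otimes>\<^sub>M borel)"

definition budget_stop ::
  "(nat \<Rightarrow> 'x \<Rightarrow> real) \<Rightarrow> (nat \<Rightarrow> 'w \<Rightarrow> nat) \<Rightarrow> (nat \<Rightarrow> 'w \<Rightarrow> 'x) \<Rightarrow> real \<Rightarrow> 'w \<Rightarrow> nat" where
  "budget_stop c a v B \<omega> = (LEAST N. (\<Sum>n\<le>N. c (a n \<omega>) (v n \<omega>)) > B)"

(* The prior processes \<theta>, the adaptive decisions (a, v), the outcomes y and the standardised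
   sampling noises \<xi> (\<xi> (Suc n) belongs to y (Suc n); \<xi> 0 is not used).

   Almost surely continuous paths are part of the model: decisions are random points, and a law
   given only through its finite-dimensional distributions does not determine the law of
   \<theta> (a n) (v n). *)
locale sampling_model = prob_space P
  for P :: "'w measure" +
  fixes M :: nat
    and X :: "(real ^ 'd) set"
    and \<mu>0 :: "nat \<Rightarrow> real ^ 'd \<Rightarrow> real"
    and k0 :: "nat \<Rightarrow> real ^ 'd \<Rightarrow> real ^ 'd \<Rightarrow> real"
    and lam :: "nat \<Rightarrow> real ^ 'd \<Rightarrow> real"
    and \<theta> :: "nat \<Rightarrow> real ^ 'd \<Rightarrow> 'w \<Rightarrow> real"
    and \<xi> :: "nat \<Rightarrow> 'w \<Rightarrow> real"
    and a :: "nat \<Rightarrow> 'w \<Rightarrow> nat"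
    and v :: "nat \<Rightarrow> 'w \<Rightarrow> real ^ 'd"
    and y :: "nat \<Rightarrow> 'w \<Rightarrow> real"
  assumes prior: "i \<in> {1..M} \<Longrightarrow> gaussian_process P X (\<mu>0 i) (k0 i) (\<theta> i)"
    and prior_indep:
      "indep_vars (\<lambda>_. \<Pi>\<^sub>M x\<in>X. borel) (\<lambda>i \<omega>. \<lambda>x\<in>X. \<theta> i x \<omega>) {1..M}"
    and prior_paths: "i \<in> {1..M} \<Longrightarrow> AE \<omega> in P. continuous_on X (\<lambda>x. \<theta> i x \<omega>)"
    and noise_normal: "n \<ge> 1 \<Longrightarrow> distr P borel (\<xi> n) = normal_law 0 1"
    and noise_indep: "indep_vars (\<lambda>_. borel) \<xi> {1..}"
    and noise_indep_prior:
      "indep_set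
         (sets (vimage_algebra (space P) (\<lambda>\<omega>. \<lambda>p\<in>{1..M} \<times> X. \<theta> (fst p) (snd p) \<omega>)
            (\<Pi>\<^sub>M p\<in>{1..M} \<times> X. borel)))
         (sets (vimage_algebra (space P) (\<lambda>\<omega>. \<lambda>n\<in>{1..}. \<xi> n \<omega>) (\<Pi>\<^sub>M n\<in>{1..}. borel)))"
    and decision_range: "\<omega> \<in> space P \<Longrightarrow> a n \<omega> \<in> {1..M} \<and> v n \<omega> \<in> X"
    and decision_a: "a n \<in> filtration P a v y n \<rightarrow>\<^sub>M count_space UNIV"
    and decision_v: "v n \<in> filtration P a v y n \<rightarrow>\<^sub>M borel"
    and outcome_measurable: "y (Suc n) \<in> borel_measurable P"
    and outcome: "\<omega> \<in> space P \<Longrightarrow>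
      y (Suc n) \<omega> = \<theta> (a n \<omega>) (v n \<omega>) \<omega> + sqrt (lam (a n \<omega>) (v n \<omega>)) * \<xi> (Suc n) \<omega>"


subsection \<open>Stationary prior covariances\<close>

(* The absolute value and the order on vectors are the component-wise ones.  In the last clause
   the bound is infinite, i.e. void, for norm \<delta> = 1 (where HOL would have C / 0 = 0); at
   \<delta> = 0 it is 0 in both readings. *)
definition correlation_function :: "(real ^ 'd \<Rightarrow> real) \<Rightarrow> bool" where
  "correlation_function \<rho> \<longleftrightarrow>
     continuous_on UNIV \<rho> \<and> (\<forall>\<delta>. 0 < \<rho> \<delta>) \<and>
     (\<forall>\<delta>. \<rho> \<bar>\<delta>\<bar> = \<rho> \<delta>) \<and>
     (\<forall>\<delta> \<delta>'. 0 \<le> \<delta> \<longrightarrow> \<delta> \<le> \<delta>' \<longrightarrow> \<rho> \<delta>' \<le> \<rho> \<delta>) \<and>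
     \<rho> 0 = 1 \<and> (\<rho> \<longlongrightarrow> 0) at_infinity \<and>
     (\<exists>C>0. \<exists>\<epsilon>>0. \<exists>u>0. \<forall>\<delta>. norm \<delta> < u \<longrightarrow> norm \<delta> \<noteq> 1 \<longrightarrow>
        1 - \<rho> \<delta> \<le> C / \<bar>ln (norm \<delta>)\<bar> powr (1 + \<epsilon>))"

end

theory Submission
  imports Defs "Jordan_Normal_Form.Determinant"
begin

text \<open>Every sample lowers the posterior variance at nearby points by an amount controlled by the
  variance at the sampled point. By compactness the variances at the sampled points tend to 0, so
  the IKG of the chosen decisions, and with it the supremum of the IKG, tends to 0. The IKG at
  \<open>(i, x)\<close> averages a gain which, as long as the posterior means stay bounded near \<open>x\<close>, can only
  vanish if the posterior variance of \<open>\<theta> i x\<close> does; hence all posterior variances tend to 0.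

  The probabilistic input is that, in spite of the adaptive design, the deviations of \<open>\<theta>\<close> from the
  posterior means are, given \<open>F n\<close>, normal with the posterior covariances. This is proved for
  characteristic functions by induction on \<open>n\<close>; random sampling points are reached from countably
  valued ones by continuity of the paths. Conditional symmetry then gives Levy's maximal
  inequality for the posterior means. It shows that they stay bounded, and that they converge to
  \<open>\<theta> i x\<close> when the variances vanish, without any martingale convergence theorem.\<close>

subsection \<open>Positive semidefinite kernels and kriging\<close>

text \<open>The posterior is used only through its one-sample update: the covariance loses a
  rank-one kernel and the mean moves affinely. Conditional normality cannot be read off the
  finite-dimensional laws of the prior, because the next sampling point depends on earlier outcomes
  and \<open>\<theta>\<close> is evaluated at a random argument. The induction therefore carries
  integrals over all sets of \<open>F n\<close> and for all finite linear combinations at once. An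
  outcome is then just one more combination, and an exponential in it merges with the exponential of
  a deviation. Uniqueness of characteristic functions leads from exponentials of the outcome back to
  its events. Estimates for posterior covariances near a point are uniform in time because the
  posterior variance of an increment never exceeds its prior variance. Boundedness of the posterior
  means is obtained for each point separately, with a null set depending on the point. Fubini turns
  this into almost every point of \<open>X\<close> on almost every path, which suffices because the
  IKG is an integral over \<open>X\<close>.\<close>

definition lc :: "(real \<times> 'p) list \<Rightarrow> ('p \<Rightarrow> real) \<Rightarrow> real" where
  "lc L f = (\<Sum>(b, p)\<leftarrow>L. b * f p)"

text \<open>Variance of the combination \<open>L\<close> under the kernel \<open>K\<close>.
  Combinations are lists because a point may then occur twice: a sampled point can be adjoined
  without asking whether it is already present.\<close>

definition qf :: "('p \<Rightarrow> 'p \<Rightarrow> real) \<Rightarrow> (real \<times> 'p) list \<Rightarrow> real" where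
  "qf K L = lc L (\<lambda>p. lc L (K p))"

definition psd_on :: "'p set \<Rightarrow> ('p \<Rightarrow> 'p \<Rightarrow> real) \<Rightarrow> bool" where
  "psd_on X K \<longleftrightarrow> (\<forall>x\<in>X. \<forall>x'\<in>X. K x x' = K x' x) \<and> (\<forall>L. snd ` set L \<subseteq> X \<longrightarrow> 0 \<le> qf K L)"

text \<open>Schur complement: the covariance kernel left after the value at \<open>w\<close> is
  observed with independent noise of variance \<open>s\<close>.\<close>

definition cond_kernel :: "('p \<Rightarrow> 'p \<Rightarrow> real) \<Rightarrow> 'p \<Rightarrow> real \<Rightarrow> 'p \<Rightarrow> 'p \<Rightarrow> real" where
  "cond_kernel K w s = (\<lambda>p p'. K p p' - K p w * K w p' / (K w w + s))"

lemma lc_Nil [simp]: "lc [] f = 0"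
  by (simp add: lc_def)

lemma lc_Cons [simp]: "lc ((b, p) # L) f = b * f p + lc L f"
  by (simp add: lc_def)

lemma lc_add: "lc L (\<lambda>p. f p + g p) = lc L f + lc L g"
  by (induction L) (auto simp: algebra_simps)

lemma lc_diff: "lc L (\<lambda>p. f p - g p) = lc L f - lc L g"
  by (induction L) (auto simp: algebra_simps)

lemma lc_cmult: "lc L (\<lambda>p. c * f p) = c * lc L f"
  by (induction L) (auto simp: algebra_simps)

lemma lc_cong: "(\<And>p. p \<in> snd ` set L \<Longrightarrow> f p = g p) \<Longrightarrow> lc L f = lc L g"
  by (induction L) auto

lemma qf_cong:
  assumes "\<And>p p'. p \<in> snd ` set L \<Longrightarrow> p' \<in> snd ` set L \<Longrightarrow> K p p' = K' p p'"
  shows "qf K L = qf K' L"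
  unfolding qf_def by (intro lc_cong assms)

lemma psd_on_sym: "psd_on X K \<Longrightarrow> x \<in> X \<Longrightarrow> x' \<in> X \<Longrightarrow> K x x' = K x' x"
  by (auto simp: psd_on_def)

lemma psd_on_nonneg: "psd_on X K \<Longrightarrow> snd ` set L \<subseteq> X \<Longrightarrow> 0 \<le> qf K L"
  by (auto simp: psd_on_def)

lemma psd_on_diag: "psd_on X K \<Longrightarrow> x \<in> X \<Longrightarrow> 0 \<le> K x x"
  using psd_on_nonneg[of X K "[(1, x)]"] by (simp add: qf_def)

lemma qf_Cons:
  assumes "psd_on X K" "w \<in> X" "snd ` set L \<subseteq> X"
  shows "qf K ((t, w) # L) = t\<^sup>2 * K w w + 2 * t * lc L (K w) + qf K L"
proof -
  have "lc L (\<lambda>p. K p w) = lc L (K w)"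
    using assms by (intro lc_cong psd_on_sym[OF assms(1)]) auto
  then show ?thesis
    by (simp add: qf_def lc_add lc_cmult power2_eq_square algebra_simps)
qed

text \<open>Adjoining \<open>w\<close> with weight \<open>t\<close> gives a quadratic polynomial in
  \<open>t\<close> that is nonnegative everywhere; the inequality is its value at the minimiser
  \<open>t = - ?l / K w w\<close>.\<close>

lemma psd_on_cauchy_schwarz:
  assumes K: "psd_on X K" "w \<in> X" "snd ` set L \<subseteq> X"
  shows "(lc L (K w))\<^sup>2 \<le> qf K L * K w w"
proof -
  let ?l = "lc L (K w)"
  have nn: "0 \<le> t\<^sup>2 * K w w + 2 * t * ?l + qf K L" for t
    using psd_on_nonneg[of X K "(t, w) # L"] assms by (simp add: qf_Cons[OF assms])
  show ?thesis
  proof (cases "K w w = 0")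
    case True
    \<comment> \<open>Without a quadratic term a nonzero slope would let the polynomial take the
      value -1, at the \<open>t\<close> used below.\<close>
    have "?l = 0"
    proof (rule ccontr)
      assume "?l \<noteq> 0"
      then have "2 * (- (qf K L + 1) / (2 * ?l)) * ?l = - (qf K L + 1)"
        by (simp add: field_simps)
      then show False using nn[of "- (qf K L + 1) / (2 * ?l)"] unfolding True by linarith
    qed
    then show ?thesis using True by simp
  next
    case False
    then have "0 < K w w" using psd_on_diag[OF K(1,2)] by simp
    moreover have "0 \<le> (?l / K w w)\<^sup>2 * K w w - 2 * (?l / K w w) * ?l + qf K L"
      using nn[of "- (?l / K w w)"] by simp
    ultimately show ?thesis
      by (simp add: power2_eq_square field_simps)
  qed
qed

lemma psd_on_cauchy_schwarz2:
  assumes "psd_on X K" "x \<in> X" "w \<in> X"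
  shows "(K x w)\<^sup>2 \<le> K x x * K w w"
  using psd_on_cauchy_schwarz[OF assms(1,3), of "[(1, x)]"] assms psd_on_sym[OF assms]
  by (simp add: qf_def)

text \<open>Only a rank-one kernel is subtracted, so a combination loses exactly its squared
  covariance with \<open>w\<close> over the predictive variance. All later monotonicity of posterior
  variances rests on this identity.\<close>

lemma qf_cond_kernel:
  assumes "psd_on X K" "w \<in> X" "snd ` set L \<subseteq> X"
  shows "qf (cond_kernel K w s) L = qf K L - (lc L (K w))\<^sup>2 / (K w w + s)"
proof -
  have eq: "lc L (\<lambda>p. K p w) = lc L (K w)"
    using assms by (intro lc_cong psd_on_sym[OF assms(1)]) auto
  have "lc L (cond_kernel K w s p) = lc L (K p) - (lc L (K w) / (K w w + s)) * K p w" for p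
    using lc_cmult[of L "K p w / (K w w + s)" "K w"]
    by (simp add: cond_kernel_def lc_diff field_simps)
  then show ?thesis
    using lc_cmult[of L "lc L (K w) / (K w w + s)" "\<lambda>p. K p w"]
    by (simp add: qf_def lc_diff eq power2_eq_square)
qed

lemma psd_on_cond_kernel:
  assumes K: "psd_on X K" "w \<in> X" and s: "s > 0"
  shows "psd_on X (cond_kernel K w s)"
  unfolding psd_on_def
proof safe
  fix x x' assume "x \<in> X" "x' \<in> X"
  then show "cond_kernel K w s x x' = cond_kernel K w s x' x"
    using K psd_on_sym[OF K(1), of x x'] psd_on_sym[OF K(1), of x w] psd_on_sym[OF K(1), of x' w]
    by (simp add: cond_kernel_def)
next
  fix L :: "(real \<times> 'a) list" assume L: "snd ` set L \<subseteq> X"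
  have pos: "0 < K w w + s" using psd_on_diag[OF K] s by linarith
  have "(lc L (K w))\<^sup>2 \<le> qf K L * (K w w + s)"
    using psd_on_cauchy_schwarz[OF K L] psd_on_nonneg[OF K(1) L] s
    by (simp add: distrib_left add_increasing2)
  then show "0 \<le> qf (cond_kernel K w s) L"
    using pos by (simp add: qf_cond_kernel[OF K L] field_simps)
qed

lemma cov_matrix_carrier [simp]: "cov_matrix k l V \<in> carrier_mat (length V) (length V)"
  by (simp add: cov_matrix_def)

lemma sum_list_map_upt: "(\<Sum>p\<leftarrow>[0..<n]. f p) = (\<Sum>p<n. f p)" for f :: "nat \<Rightarrow> real"
  by (simp add: sum_list_distinct_conv_sum_set atLeast0LessThan)

lemma cov_matrix_mult_vec:
  assumes "z \<in> carrier_vec (length V)" "p < length V"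
  shows "vec_index (cov_matrix k l V *\<^sub>v z) p
    = (\<Sum>q<length V. k (V ! p) (V ! q) * vec_index z q) + l (V ! p) * vec_index z p"
proof -
  have "vec_index (cov_matrix k l V *\<^sub>v z) p
      = (\<Sum>q<length V. (k (V ! p) (V ! q) + (if p = q then l (V ! p) else 0)) * vec_index z q)"
    using assms by (simp add: cov_matrix_def scalar_prod_def atLeast0LessThan)
  also have "\<dots> = (\<Sum>q<length V. k (V ! p) (V ! q) * vec_index z q
       + (if p = q then l (V ! p) * vec_index z q else 0))"
    by (intro sum.cong) (auto simp: algebra_simps)
  also have "\<dots> = (\<Sum>q<length V. k (V ! p) (V ! q) * vec_index z q) + l (V ! p) * vec_index z p"
    using assms by (simp add: sum.distrib)
  finally show ?thesis .
qed

text \<open>For a null vector \<open>z\<close> the quadratic form of the matrix is 0. It is the sum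
  of a nonnegative form in \<open>k\<close> and a sum of squares with weights \<open>l > 0\<close>,
  so every entry of \<open>z\<close> vanishes.\<close>

lemma det_cov_matrix_nonzero:
  assumes K: "psd_on X k" and V: "set V \<subseteq> X" and l: "\<forall>x\<in>X. 0 < l x"
  shows "det (cov_matrix k l V) \<noteq> 0"
proof
  let ?n = "length V"
  assume "det (cov_matrix k l V) = 0"
  then obtain z where z: "z \<in> carrier_vec ?n" "z \<noteq> 0\<^sub>v ?n"
    and 0: "cov_matrix k l V *\<^sub>v z = 0\<^sub>v ?n"
    using det_0_iff_vec_prod_zero_field[OF cov_matrix_carrier, of k l V] by blast
  define L where "L = map (\<lambda>p. (vec_index z p, V ! p)) [0..<?n]"
  have L: "snd ` set L \<subseteq> X" using V by (force simp: L_def)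
  have lc: "lc L f = (\<Sum>p<?n. vec_index z p * f (V ! p))" for f
    by (simp add: L_def lc_def o_def sum_list_map_upt del: map_upt_eqI)
  have "qf k L + (\<Sum>p<?n. l (V ! p) * (vec_index z p)\<^sup>2)
      = (\<Sum>p<?n. vec_index z p * ((\<Sum>q<?n. k (V ! p) (V ! q) * vec_index z q) + l (V ! p) * vec_index z p))"
    by (simp add: qf_def lc distrib_left sum.distrib power2_eq_square mult_ac)
  also have "\<dots> = (\<Sum>p<?n. vec_index z p * vec_index (cov_matrix k l V *\<^sub>v z) p)"
    using z by (simp add: cov_matrix_mult_vec)
  also have "\<dots> = 0" using 0 by simp
  finally have "(\<Sum>p<?n. l (V ! p) * (vec_index z p)\<^sup>2) \<le> 0"
    using psd_on_nonneg[OF K L] by simp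
  moreover have nn: "0 \<le> l (V ! p) * (vec_index z p)\<^sup>2" if "p < ?n" for p
    using less_imp_le[OF bspec[OF l subsetD[OF V nth_mem[OF that]]]] by simp
  ultimately have "(\<Sum>p<?n. l (V ! p) * (vec_index z p)\<^sup>2) = 0"
    by (meson antisym lessThan_iff sum_nonneg)
  then have "\<forall>p<?n. l (V ! p) * (vec_index z p)\<^sup>2 = 0"
    using nn by (subst (asm) sum_nonneg_eq_0_iff) auto
  then have "\<forall>p<?n. vec_index z p = 0"
    using bspec[OF l subsetD[OF V nth_mem]] by fastforce
  then have "z = 0\<^sub>v ?n" using z(1) by (intro eq_vecI) auto
  then show False using z(2) by simp
qed

lemma mat_inverse_cov_matrix:
  assumes "psd_on X k" "set V \<subseteq> X" "\<forall>x\<in>X. 0 < l x"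
  obtains B where "mat_inverse (cov_matrix k l V) = Some B" "B \<in> carrier_mat (length V) (length V)"
    "cov_matrix k l V * B = 1\<^sub>m (length V)" "B * cov_matrix k l V = 1\<^sub>m (length V)"
proof -
  let ?A = "cov_matrix k l V" and ?n = "length V"
  have "?A \<in> Units (ring_mat TYPE(real) ?n ())"
    by (rule det_non_zero_imp_unit[OF cov_matrix_carrier det_cov_matrix_nonzero[OF assms]])
  then obtain B where "mat_inverse ?A = Some B"
    using mat_inverse(1)[OF cov_matrix_carrier, of k l V "()"] by (cases "mat_inverse ?A") auto
  then show ?thesis
    using mat_inverse(2)[OF cov_matrix_carrier, of k l V B] by (intro that[of B]) auto
qed

text \<open>From here on, kriging weights are handled only through the linear system that they solve.\<close>

lemma kriging_eqI:
  assumes K: "psd_on X k" and V: "set V \<subseteq> X" and l: "\<forall>x\<in>X. 0 < l x"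
    and al: "\<alpha> \<in> carrier_vec (length V)" and z: "cov_matrix k l V *\<^sub>v \<alpha> = z"
  shows "kriging k l V x z = (\<Sum>p<length V. k x (V ! p) * vec_index \<alpha> p)"
proof -
  obtain B where B: "mat_inverse (cov_matrix k l V) = Some B" "B \<in> carrier_mat (length V) (length V)"
    "B * cov_matrix k l V = 1\<^sub>m (length V)"
    using mat_inverse_cov_matrix[OF K V l] by blast
  have "B *\<^sub>v z = (B * cov_matrix k l V) *\<^sub>v \<alpha>"
    unfolding z[symmetric] by (rule assoc_mult_mat_vec[OF B(2) cov_matrix_carrier al, symmetric])
  also have "\<dots> = \<alpha>" using al B by simp
  finally show ?thesis
    using al by (simp add: kriging_def B scalar_prod_def atLeast0LessThan)
qed

lemma kriging_solution:
  assumes K: "psd_on X k" and V: "set V \<subseteq> X" and l: "\<forall>x\<in>X. 0 < l x"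
    and z: "z \<in> carrier_vec (length V)"
  shows "\<exists>\<alpha>\<in>carrier_vec (length V). cov_matrix k l V *\<^sub>v \<alpha> = z \<and>
    (\<forall>x. kriging k l V x z = (\<Sum>p<length V. k x (V ! p) * vec_index \<alpha> p))"
proof -
  obtain B where B: "B \<in> carrier_mat (length V) (length V)" "cov_matrix k l V * B = 1\<^sub>m (length V)"
    using mat_inverse_cov_matrix[OF K V l] by blast
  have c: "B *\<^sub>v z \<in> carrier_vec (length V)" using B z by simp
  have "cov_matrix k l V *\<^sub>v (B *\<^sub>v z) = (cov_matrix k l V * B) *\<^sub>v z"
    by (rule assoc_mult_mat_vec[OF cov_matrix_carrier B(1) z, symmetric])
  also have "\<dots> = z" using z B by simp
  finally have s: "cov_matrix k l V *\<^sub>v (B *\<^sub>v z) = z" .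
  show ?thesis
    using c s kriging_eqI[OF K V l c s] by blast
qed

text \<open>Block elimination. The weights of the enlarged system are assembled from two solutions
  of the old one, for the data \<open>z\<close> and for the covariances with \<open>w\<close>.
  Leaving the data arbitrary lets one statement give both updates: centred outcomes yield the
  posterior mean, prior covariances with a point yield the posterior covariance.\<close>

lemma kriging_snoc:
  assumes K: "psd_on X k" and V: "set V \<subseteq> X" and l: "\<forall>x\<in>X. 0 < l x"
    and w: "w \<in> X" and x: "x \<in> X"
    and z: "z \<in> carrier_vec (length V)"
    and z': "z' \<in> carrier_vec (Suc (length V))"
      "\<And>p. p < length V \<Longrightarrow> vec_index z' p = vec_index z p" "vec_index z' (length V) = \<zeta>"
    and pc_def: "\<And>u u'. pc u u' = k u u' - kriging k l V u (Matrix.vec (length V) (\<lambda>p. k (V ! p) u'))"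
    and pos: "pc w w + l w \<noteq> 0"
  shows "kriging k l (V @ [w]) x z'
    = kriging k l V x z + pc x w * (\<zeta> - kriging k l V w z) / (pc w w + l w)"
proof -
  let ?n = "length V"
  let ?A = "cov_matrix k l V" and ?A' = "cov_matrix k l (V @ [w])"
  obtain \<alpha> where \<alpha>: "\<alpha> \<in> carrier_vec ?n" "?A *\<^sub>v \<alpha> = z"
    "\<And>x. kriging k l V x z = (\<Sum>p<?n. k x (V ! p) * vec_index \<alpha> p)"
    using kriging_solution[OF K V l z] by blast
  let ?b = "Matrix.vec ?n (\<lambda>p. k (V ! p) w)"
  obtain \<beta> where \<beta>: "\<beta> \<in> carrier_vec ?n" "?A *\<^sub>v \<beta> = ?b"
    "\<And>x. kriging k l V x ?b = (\<Sum>p<?n. k x (V ! p) * vec_index \<beta> p)"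
    using kriging_solution[OF K V l, of ?b] vec_carrier by blast
  \<comment> \<open>Weight of the new point: after elimination the last row reads
    \<open>t * (pc w w + l w) = \<zeta> - kriging k l V w z\<close>.\<close>
  define t where "t = (\<zeta> - kriging k l V w z) / (pc w w + l w)"
  \<comment> \<open>The new weight adds \<open>t\<close> times the column of covariances with
    \<open>w\<close> to the old rows; subtracting \<open>t\<close> times \<open>\<beta>\<close>
    cancels precisely that column.\<close>
  define \<alpha>' where "\<alpha>' = Matrix.vec (Suc ?n)
    (\<lambda>p. if p < ?n then vec_index \<alpha> p - t * vec_index \<beta> p else t)"
  have c: "\<alpha>' \<in> carrier_vec (length (V @ [w]))" by (simp add: \<alpha>'_def)
  have sum': "(\<Sum>q<length (V @ [w]). k u ((V @ [w]) ! q) * vec_index \<alpha>' q)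
      = (\<Sum>q<?n. k u (V ! q) * vec_index \<alpha> q) - t * (\<Sum>q<?n. k u (V ! q) * vec_index \<beta> q) + k u w * t" for u
    by (simp add: \<alpha>'_def nth_append sum_distrib_left algebra_simps sum_subtractf)
  have "?A' *\<^sub>v \<alpha>' = z'"
  proof (rule eq_vecI)
    show "dim_vec (?A' *\<^sub>v \<alpha>') = dim_vec z'" using z' by (simp add: cov_matrix_def)
    fix p assume "p < dim_vec z'"
    then have p: "p < length (V @ [w])" using z' by simp
    show "vec_index (?A' *\<^sub>v \<alpha>') p = vec_index z' p"
    proof (cases "p < ?n")
      case True
      have "vec_index (?A *\<^sub>v \<alpha>) p = vec_index z p" "vec_index (?A *\<^sub>v \<beta>) p = k (V ! p) w"
        using \<alpha>(2) \<beta>(2) True by auto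
      then have e: "(\<Sum>q<?n. k (V ! p) (V ! q) * vec_index \<alpha> q) = vec_index z p - l (V ! p) * vec_index \<alpha> p"
        "(\<Sum>q<?n. k (V ! p) (V ! q) * vec_index \<beta> q) = k (V ! p) w - l (V ! p) * vec_index \<beta> p"
        using cov_matrix_mult_vec[OF \<alpha>(1) True, of k l] cov_matrix_mult_vec[OF \<beta>(1) True, of k l] by auto
      have a: "vec_index \<alpha>' p = vec_index \<alpha> p - t * vec_index \<beta> p" "(V @ [w]) ! p = V ! p"
        using True by (auto simp: \<alpha>'_def nth_append)
      show ?thesis
        unfolding cov_matrix_mult_vec[OF c p] sum' a e z'(2)[OF True]
        by (simp add: algebra_simps)
    next
      case False
      then have pn: "p = ?n" using p by simp
      have pcw: "(\<Sum>q<?n. k w (V ! q) * vec_index \<beta> q) = k w w - pc w w"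
        by (simp add: pc_def \<beta>(3))
      have "t * (pc w w + l w) = \<zeta> - kriging k l V w z"
        using pos by (simp add: t_def)
      moreover have a: "vec_index \<alpha>' p = t" "(V @ [w]) ! p = w" by (simp_all add: \<alpha>'_def pn)
      moreover have "vec_index z' p = \<zeta>" by (simp add: pn z'(3))
      ultimately show ?thesis
        unfolding cov_matrix_mult_vec[OF c p] sum' a pcw
        by (simp add: \<alpha>(3) algebra_simps)
    qed
  qed
  from kriging_eqI[OF K _ l c this, of x] V w
  have "kriging k l (V @ [w]) x z' = (\<Sum>q<?n. k x (V ! q) * vec_index \<alpha> q)
     - t * (\<Sum>q<?n. k x (V ! q) * vec_index \<beta> q) + k x w * t"
    by (simp only: sum') simp
  also have "\<dots> = kriging k l V x z + t * pc x w"
    by (simp add: \<alpha>(3) pc_def \<beta>(3) algebra_simps)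
  finally show ?thesis by (simp add: t_def)
qed

section \<open>Recursion of the posterior under one further sample\<close>

definition valid_history :: "nat \<Rightarrow> 'x set \<Rightarrow> 'x history \<Rightarrow> bool" where
  "valid_history M X h \<longleftrightarrow> (\<forall>(j, w, y)\<in>set h. j \<in> {1..M} \<and> w \<in> X)"

lemma valid_history_snoc [simp]:
  "valid_history M X (h @ [(j, w, y)]) \<longleftrightarrow> valid_history M X h \<and> j \<in> {1..M} \<and> w \<in> X"
  by (auto simp: valid_history_def)

lemma valid_history_Nil [simp]: "valid_history M X []"
  by (simp add: valid_history_def)

lemma samples_snoc: "samples i (h @ [(j, w, y)]) = samples i h @ (if j = i then [(w, y)] else [])"
  by (simp add: samples_def)

lemma samples_valid: "valid_history M X h \<Longrightarrow> set (map fst (samples i h)) \<subseteq> X"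
  by (auto simp: valid_history_def samples_def)

lemma post_mean_Nil: "post_mean \<mu>0 k0 lam [] i x = \<mu>0 i x"
  by (simp add: post_mean_def samples_def kriging_def scalar_prod_def)

lemma post_cov_Nil: "post_cov k0 lam [] i x x' = k0 i x x'"
  by (simp add: post_cov_def samples_def kriging_def scalar_prod_def)

lemma post_mean_snoc_other:
  "j \<noteq> i \<Longrightarrow> post_mean \<mu>0 k0 lam (h @ [(j, w, y)]) i x = post_mean \<mu>0 k0 lam h i x"
  by (simp add: post_mean_def samples_snoc)

lemma post_cov_snoc_other:
  "j \<noteq> i \<Longrightarrow> post_cov k0 lam (h @ [(j, w, y)]) i x x' = post_cov k0 lam h i x x'"
  by (simp add: post_cov_def samples_snoc)

context
  fixes M :: nat and X :: "'x set" and \<mu>0 :: "nat \<Rightarrow> 'x \<Rightarrow> real"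
    and k0 :: "nat \<Rightarrow> 'x \<Rightarrow> 'x \<Rightarrow> real" and lam :: "nat \<Rightarrow> 'x \<Rightarrow> real"
  assumes K: "\<forall>i\<in>{1..M}. psd_on X (k0 i)"
    and l: "\<forall>i\<in>{1..M}. \<forall>x\<in>X. 0 < lam i x"
begin

text \<open>Nonvanishing of the predictive variance is still a hypothesis here: it comes from
  semidefiniteness of the posterior kernel, whose inductive proof goes through this very
  update.\<close>

lemma post_cov_snoc_aux:
  assumes h: "valid_history M X h" and i: "i \<in> {1..M}" and x: "x \<in> X" "x' \<in> X" "w \<in> X"
    and pos: "post_cov k0 lam h i w w + lam i w \<noteq> 0"
  shows "post_cov k0 lam (h @ [(i, w, y)]) i x x'
    = cond_kernel (post_cov k0 lam h i) w (lam i w) x x'"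
proof -
  let ?V = "map fst (samples i h)"
  have pc: "post_cov k0 lam h i u u' = k0 i u u' -
      kriging (k0 i) (lam i) ?V u (Matrix.vec (length ?V) (\<lambda>p. k0 i (?V ! p) u'))" for u u'
    by (simp add: post_cov_def Let_def)
  have "kriging (k0 i) (lam i) (?V @ [w]) x (Matrix.vec (Suc (length ?V)) (\<lambda>p. k0 i ((?V @ [w]) ! p) x'))
     = kriging (k0 i) (lam i) ?V x (Matrix.vec (length ?V) (\<lambda>p. k0 i (?V ! p) x'))
     + post_cov k0 lam h i x w *
        (k0 i w x' - kriging (k0 i) (lam i) ?V w (Matrix.vec (length ?V) (\<lambda>p. k0 i (?V ! p) x')))
        / (post_cov k0 lam h i w w + lam i w)"
    by (rule kriging_snoc[OF bspec[OF K i] samples_valid[OF h] bspec[OF l i] x(3,1)])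
      (use pos in \<open>auto simp: pc nth_append\<close>)
  then show ?thesis
    by (simp add: post_cov_def samples_snoc cond_kernel_def Let_def)
qed

lemma psd_on_post_cov:
  assumes "valid_history M X h" and i: "i \<in> {1..M}"
  shows "psd_on X (post_cov k0 lam h i)"
  using assms(1)
proof (induction h rule: rev_induct)
  case Nil
  then show ?case using bspec[OF K i] by (simp add: ext[OF ext, OF post_cov_Nil])
next
  case (snoc s h)
  obtain j w y where s: "s = (j, w, y)" by (cases s) auto
  have h: "valid_history M X h" and jw: "j \<in> {1..M}" "w \<in> X" using snoc.prems s by auto
  note IH = snoc.IH[OF h]
  show ?case
  proof (cases "j = i")
    case False
    then show ?thesis using IH by (simp add: s ext[OF ext, OF post_cov_snoc_other])
  next
    case True
    have pos: "post_cov k0 lam h i w w + lam i w \<noteq> 0"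
      using psd_on_diag[OF IH jw(2)] bspec[OF bspec[OF l i] jw(2)] by simp
    have P: "psd_on X (cond_kernel (post_cov k0 lam h i) w (lam i w))"
      by (rule psd_on_cond_kernel[OF IH jw(2) bspec[OF bspec[OF l i] jw(2)]])
    have eq: "post_cov k0 lam (h @ [s]) i x x' = cond_kernel (post_cov k0 lam h i) w (lam i w) x x'"
      if "x \<in> X" "x' \<in> X" for x x'
      unfolding s True by (rule post_cov_snoc_aux[OF h i that jw(2) pos])
    have "qf (post_cov k0 lam (h @ [s]) i) L = qf (cond_kernel (post_cov k0 lam h i) w (lam i w)) L"
      if "snd ` set L \<subseteq> X" for L
      using that by (intro qf_cong eq) auto
    then show ?thesis
      using P unfolding psd_on_def by (simp add: eq)
  qed
qed

lemma post_var_pos: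
  assumes "valid_history M X h" "i \<in> {1..M}" "w \<in> X"
  shows "0 < post_cov k0 lam h i w w + lam i w"
  using psd_on_diag[OF psd_on_post_cov] assms l by (simp add: add_nonneg_pos)

lemma post_cov_snoc:
  assumes "valid_history M X h" "i \<in> {1..M}" "x \<in> X" "x' \<in> X" "w \<in> X"
  shows "post_cov k0 lam (h @ [(i, w, y)]) i x x'
    = cond_kernel (post_cov k0 lam h i) w (lam i w) x x'"
  using post_cov_snoc_aux[OF assms] post_var_pos[OF assms(1,2,5)] by simp

lemma post_mean_snoc:
  assumes h: "valid_history M X h" and i: "i \<in> {1..M}" and x: "x \<in> X" "w \<in> X"
  shows "post_mean \<mu>0 k0 lam (h @ [(i, w, y)]) i x = post_mean \<mu>0 k0 lam h i x
    + post_cov k0 lam h i x w * (y - post_mean \<mu>0 k0 lam h i w) / (post_cov k0 lam h i w w + lam i w)"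
proof -
  let ?V = "map fst (samples i h)" and ?Y = "map snd (samples i h)"
  let ?z = "Matrix.vec (length ?V) (\<lambda>p. ?Y ! p - \<mu>0 i (?V ! p))"
  have pc: "post_cov k0 lam h i u u' = k0 i u u' -
      kriging (k0 i) (lam i) ?V u (Matrix.vec (length ?V) (\<lambda>p. k0 i (?V ! p) u'))" for u u'
    by (simp add: post_cov_def Let_def)
  have "kriging (k0 i) (lam i) (?V @ [w]) x
       (Matrix.vec (Suc (length ?V)) (\<lambda>p. (?Y @ [y]) ! p - \<mu>0 i ((?V @ [w]) ! p)))
     = kriging (k0 i) (lam i) ?V x ?z
     + post_cov k0 lam h i x w *
        ((y - \<mu>0 i w) - kriging (k0 i) (lam i) ?V w ?z)
        / (post_cov k0 lam h i w w + lam i w)"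
    by (rule kriging_snoc[OF bspec[OF K i] samples_valid[OF h] bspec[OF l i] x(2,1)])
      (use post_var_pos[OF h i x(2)] in \<open>auto simp: pc nth_append\<close>)
  then show ?thesis
    by (simp add: post_mean_def samples_snoc Let_def algebra_simps)
qed

end

subsection \<open>Variances at the sampled points\<close>

text \<open>Cauchy-Schwarz for the value at \<open>x\<close> against the increment from
  \<open>w\<close> to \<open>z\<close>; the last factor is the variance of that increment.\<close>

lemma psd_on_diff_le:
  assumes K: "psd_on X K" and x: "x \<in> X" "z \<in> X" "w \<in> X"
  shows "(K x z - K x w)\<^sup>2 \<le> K x x * qf K [(1, z), (-1, w)]"
  using psd_on_cauchy_schwarz[OF K x(1), of "[(1, z), (-1, w)]"] x by (simp add: mult.commute)

text \<open>One alternative along one fixed path, with \<open>S\<close> the times at which it is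
  sampled. No probability is left, so the results apply path by path.\<close>

locale kernel_sequence =
  fixes X :: "'x::metric_space set" and K :: "nat \<Rightarrow> 'x \<Rightarrow> 'x \<Rightarrow> real"
    and l :: "'x \<Rightarrow> real" and w :: "nat \<Rightarrow> 'x" and S :: "nat set"
  assumes psd: "psd_on X (K n)"
    and l_pos: "x \<in> X \<Longrightarrow> 0 < l x"
    and w_in: "n \<in> S \<Longrightarrow> w n \<in> X"
    and K_sampled: "n \<in> S \<Longrightarrow> x \<in> X \<Longrightarrow> x' \<in> X \<Longrightarrow>
      K (Suc n) x x' = cond_kernel (K n) (w n) (l (w n)) x x'"
    and K_idle: "n \<notin> S \<Longrightarrow> x \<in> X \<Longrightarrow> x' \<in> X \<Longrightarrow> K (Suc n) x x' = K n x x'"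
begin

lemma qf_step: "snd ` set L \<subseteq> X \<Longrightarrow> qf (K (Suc n)) L \<le> qf (K n) L"
proof (cases "n \<in> S")
  case True
  assume L: "snd ` set L \<subseteq> X"
  have "qf (K (Suc n)) L = qf (cond_kernel (K n) (w n) (l (w n))) L"
    using L by (intro qf_cong K_sampled True) auto
  also have "\<dots> \<le> qf (K n) L"
    using psd_on_diag[OF psd w_in[OF True], of n] l_pos[OF w_in[OF True]]
    by (simp add: qf_cond_kernel[OF psd w_in[OF True] L])
  finally show ?thesis .
next
  case False
  assume L: "snd ` set L \<subseteq> X"
  have "qf (K (Suc n)) L = qf (K n) L"
    using L by (intro qf_cong K_idle False) auto
  then show ?thesis by simp
qed

lemma qf_antimono: "snd ` set L \<subseteq> X \<Longrightarrow> m \<le> n \<Longrightarrow> qf (K n) L \<le> qf (K m) L"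
  by (rule lift_Suc_antimono_le[where f = "\<lambda>n. qf (K n) L"]) (rule qf_step)

lemma var_antimono: "x \<in> X \<Longrightarrow> m \<le> n \<Longrightarrow> K n x x \<le> K m x x"
  using qf_antimono[of "[(1, x)]" m n] by (simp add: qf_def)

text \<open>The right-hand side involves only the kernel at time 0, so the posterior covariances are
  equicontinuous uniformly in \<open>n\<close>.\<close>

lemma cov_diff_le:
  assumes "x \<in> X" "z \<in> X" "w' \<in> X"
  shows "(K n x z - K n x w')\<^sup>2 \<le> K 0 x x * qf (K 0) [(1, z), (-1, w')]"
proof -
  have "(K n x z - K n x w')\<^sup>2 \<le> K n x x * qf (K n) [(1, z), (-1, w')]"
    by (rule psd_on_diff_le[OF psd assms])
  also have "\<dots> \<le> K 0 x x * qf (K 0) [(1, z), (-1, w')]"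
    using assms psd_on_diag[OF psd assms(1)] psd_on_nonneg[OF psd, of "[(1, z), (-1, w')]"]
    by (intro mult_mono var_antimono qf_antimono) auto
  finally show ?thesis .
qed

text \<open>Infinitely many samples of variance at least \<open>\<eta>\<close> would accumulate at some point of \<open>X\<close>,
  whose own variance each of them lowers by a fixed amount.\<close>

lemma sampled_variance_eventually_less:
  assumes X: "compact X" and l_le: "\<And>x. x \<in> X \<Longrightarrow> l x \<le> \<Lambda>"
    and B: "\<And>x. x \<in> X \<Longrightarrow> K 0 x x \<le> B"
    and cont: "\<And>x. x \<in> X \<Longrightarrow> continuous_on X (\<lambda>x'. qf (K 0) [(1, x'), (-1, x)])"
    and \<eta>: "\<eta> > 0"
  shows "\<forall>\<^sub>F n in sequentially. n \<in> S \<longrightarrow> K n (w n) (w n) < \<eta>"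
proof (rule ccontr)
  assume neg: "\<not> ?thesis"
  define T where "T = {n. n \<in> S \<and> \<not> K n (w n) (w n) < \<eta>}"
  have "infinite T"
    using neg by (simp add: T_def eventually_sequentially infinite_nat_iff_unbounded_le)
  define f where "f = enumerate T"
  have f: "strict_mono f" "f k \<in> T" for k
    using \<open>infinite T\<close> by (auto simp: f_def strict_mono_enumerate enumerate_in_set)
  have "\<forall>k. (w \<circ> f) k \<in> X" using f(2) w_in by (auto simp: T_def)
  then obtain x r where x: "x \<in> X" and r: "strict_mono r" "((w \<circ> f) \<circ> r) \<longlonglongrightarrow> x"
    using X unfolding compact_def by meson
  define g where "g = f \<circ> r"
  have g: "strict_mono g" "g k \<in> T" for k
    using f r by (auto simp: g_def strict_mono_o)
  have gX: "w (g k) \<in> X" "g k \<in> S" "\<eta> \<le> K (g k) (w (g k)) (w (g k))" for k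
    using g(2)[of k] w_in by (auto simp: T_def)
  have lim: "(\<lambda>k. w (g k)) \<longlonglongrightarrow> x" using r(2) by (simp add: g_def o_def)
  have "(\<lambda>k. qf (K 0) [(1, w (g k)), (-1, x)]) \<longlonglongrightarrow> qf (K 0) [(1, x), (-1, x)]"
    by (rule continuous_on_tendsto_compose[OF cont[OF x] lim x]) (use gX in auto)
  then have "(\<lambda>k. B * qf (K 0) [(1, w (g k)), (-1, x)]) \<longlonglongrightarrow> B * 0"
    by (intro tendsto_mult_left) (simp add: qf_def)
  then have "\<forall>\<^sub>F k in sequentially. B * qf (K 0) [(1, w (g k)), (-1, x)] < (\<eta>/2)\<^sup>2"
    by (rule order_tendstoD(2)) (use \<eta> in simp)
  moreover
  have pos: "0 \<le> B" using B[OF x] psd_on_diag[OF psd x, of 0] by simp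
  have \<Lambda>: "0 < \<Lambda>" using l_le[OF x] l_pos[OF x] by simp
  \<comment> \<open>Once the sampled point is close to \<open>x\<close>, its covariance with
    \<open>x\<close> is at least \<open>\<eta>/2\<close>, while the predictive variance is at most
    \<open>B + \<Lambda>\<close>. The rank-one update then removes at least \<open>c\<close> from
    the variance at \<open>x\<close>.\<close>
  define c where "c = (\<eta>/2)\<^sup>2 / (B + \<Lambda>)"
  have c: "c > 0" using \<eta> pos \<Lambda> by (simp add: c_def)
  have drop: "K (Suc (g k)) x x \<le> K (g k) x x - c"
    if small: "B * qf (K 0) [(1, w (g k)), (-1, x)] < (\<eta>/2)\<^sup>2" for k
  proof -
    let ?n = "g k" and ?w = "w (g k)"
    have "(K ?n ?w ?w - K ?n ?w x)\<^sup>2 \<le> K 0 ?w ?w * qf (K 0) [(1, ?w), (-1, x)]"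
      by (rule cov_diff_le[OF gX(1) gX(1) x])
    also have "\<dots> \<le> B * qf (K 0) [(1, ?w), (-1, x)]"
      using gX x by (intro mult_right_mono B psd_on_nonneg[OF psd]) auto
    finally have "\<bar>K ?n ?w ?w - K ?n ?w x\<bar>\<^sup>2 < (\<eta>/2)\<^sup>2" using small by simp
    then have "\<bar>K ?n ?w ?w - K ?n ?w x\<bar> < \<eta>/2"
      by (rule power2_less_imp_less) (use \<eta> in simp)
    then have big: "\<eta>/2 \<le> K ?n ?w x" using gX(3)[of k] by linarith
    then have "(\<eta>/2)\<^sup>2 \<le> (K ?n ?w x)\<^sup>2" using \<eta> by (intro power_mono) auto
    moreover have "K ?n ?w ?w + l ?w \<le> B + \<Lambda>"
      using var_antimono[OF gX(1)[of k], of 0 ?n] B[OF gX(1)[of k]] l_le[OF gX(1)[of k]] by linarith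
    moreover have "0 < K ?n ?w ?w + l ?w"
      using psd_on_diag[OF psd gX(1)[of k], of ?n] l_pos[OF gX(1)[of k]] by linarith
    ultimately have "c \<le> (K ?n ?w x)\<^sup>2 / (K ?n ?w ?w + l ?w)"
      unfolding c_def by (intro frac_le) auto
    also have "\<dots> = K ?n x x - K (Suc ?n) x x"
      using psd_on_sym[OF psd x gX(1)[of k], of ?n]
      by (simp add: K_sampled[OF gX(2) x x] cond_kernel_def power2_eq_square)
    finally show ?thesis by simp
  qed
  ultimately have ev1: "\<forall>\<^sub>F k in sequentially. K (Suc (g k)) x x \<le> K (g k) x x - c"
    by (auto elim: eventually_mono)
  \<comment> \<open>The variances at \<open>x\<close> decrease to a limit, so their successive
    differences tend to 0. This is incompatible with drops of size \<open>c\<close> along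
    \<open>g\<close>.\<close>
  have "decseq (\<lambda>n. K n x x)" using var_antimono[OF x] by (simp add: decseq_def)
  then obtain L where L: "(\<lambda>n. K n x x) \<longlonglongrightarrow> L"
    using decseq_convergent[of "\<lambda>n. K n x x" 0] psd_on_diag[OF psd x] by metis
  have "(\<lambda>n. K n x x - K (Suc n) x x) \<longlonglongrightarrow> L - L"
    by (intro tendsto_diff L LIMSEQ_Suc)
  then have "(\<lambda>k. K (g k) x x - K (Suc (g k)) x x) \<longlonglongrightarrow> 0"
    using LIMSEQ_subseq_LIMSEQ[OF _ g(1)] by (fastforce simp: o_def)
  then have "\<forall>\<^sub>F k in sequentially. K (g k) x x - K (Suc (g k)) x x < c"
    using c by (rule order_tendstoD(2))
  with ev1 have "\<forall>\<^sub>F k in sequentially. False"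
    by eventually_elim linarith
  then show False by simp
qed

end

subsection \<open>Integral identities over a sub-sigma-algebra\<close>

context prob_space
begin

text \<open>Dynkin's argument: with the whole space included, the sets over which \<open>h\<close>
  integrates to 0 are closed under complements and countable disjoint unions, so an
  intersection-stable generator is enough.\<close>

lemma set_integral_zero_generated:
  fixes h :: "'a \<Rightarrow> complex"
  assumes h: "integrable M h" and E: "Int_stable E" "E \<subseteq> sets M"
    and 0: "\<And>A. A \<in> E \<Longrightarrow> (LINT \<omega>:A|M. h \<omega>) = 0" "(LINT \<omega>:space M|M. h \<omega>) = 0"
    and A: "A \<in> sigma_sets (space M) E"
  shows "(LINT \<omega>:A|M. h \<omega>) = 0"
proof -
  have EP: "E \<subseteq> Pow (space M)" using E(2) sets.sets_into_space by blast
  have S: "sigma_sets (space M) E \<subseteq> sets M" using E(2) by (rule sets.sigma_sets_subset)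
  have int: "set_integrable M B h" if "B \<in> sets M" for B
    using h that unfolding set_integrable_def by (intro integrable_mult_indicator)
  show ?thesis
    using E(1) EP A
  proof (induction rule: sigma_sets_induct_disjoint)
    case (compl A)
    have A: "A \<in> sets M" using compl.hyps S by auto
    have "(LINT \<omega>:A \<union> (space M - A)|M. h \<omega>) = (LINT \<omega>:A|M. h \<omega>) + (LINT \<omega>:space M - A|M. h \<omega>)"
      using A by (intro set_integral_Un int) auto
    moreover have "A \<union> (space M - A) = space M" using A sets.sets_into_space by blast
    ultimately show ?case using compl 0(2) by simp
  next
    case (union A)
    have "(LINT \<omega>:(\<Union>i. A i)|M. h \<omega>) = (\<Sum>i. (LINT \<omega>:A i|M. h \<omega>))"
      by (rule lebesgue_integral_countable_add)
        (use union.hyps subset_trans[OF union.hyps(2) S] in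
          \<open>auto simp: disjoint_family_on_def intro!: int sets.countable_UN\<close>)
    then show ?case using union.IH by simp
  qed (use 0 in \<open>auto simp: set_lebesgue_integral_def\<close>)
qed

text \<open>Countable additivity over the level sets of \<open>N\<close>. It serves twice: for the
  discretised sampling point and for the index of the sampled alternative.\<close>

lemma set_integral_zero_split:
  fixes h :: "'a \<Rightarrow> complex" and N :: "'a \<Rightarrow> nat"
  assumes F: "subalgebra M F" and N: "N \<in> F \<rightarrow>\<^sub>M count_space UNIV" and A: "A \<in> sets F"
    and h: "set_integrable M A h"
    and 0: "\<And>k. (LINT \<omega>:A \<inter> {\<omega> \<in> space M. N \<omega> = k}|M. h \<omega>) = 0"
  shows "(LINT \<omega>:A|M. h \<omega>) = 0"
proof -
  have FM: "sets F \<subseteq> sets M" "space F = space M" using F by (auto simp: subalgebra_def)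
  define A' where "A' k = A \<inter> {\<omega> \<in> space M. N \<omega> = k}" for k
  have "{\<omega> \<in> space F. N \<omega> = k} \<in> sets F" for k using N by measurable
  then have A': "A' k \<in> sets M" for k
    using A FM unfolding A'_def by (metis sets.Int subsetD)
  have eq: "A = (\<Union>k. A' k)" using sets.sets_into_space[OF A] FM by (auto simp: A'_def)
  have "(LINT \<omega>:A|M. h \<omega>) = (\<Sum>k. (LINT \<omega>:A' k|M. h \<omega>))"
  proof (subst eq, rule lebesgue_integral_countable_add)
    show "set_integrable M (\<Union>k. A' k) h" using h unfolding eq[symmetric] .
    show "A' i \<inter> A' j = {}" if "i \<noteq> j" for i j using that by (auto simp: A'_def)
  qed (rule A')
  then show ?thesis using 0 by (simp add: A'_def)
qed

text \<open>The random parameter \<open>Z\<close> is approximated through a countable dense subset of \<open>S\<close>; for a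
  countably valued parameter the integral splits into instances of the hypothesis.\<close>

lemma set_integral_zero_substitute:
  fixes h :: "'z::euclidean_space \<Rightarrow> 'a \<Rightarrow> complex"
  assumes F: "subalgebra M F" and Z: "Z \<in> F \<rightarrow>\<^sub>M borel"
    and ZS: "\<And>\<omega>. \<omega> \<in> space M \<Longrightarrow> Z \<omega> \<in> S"
    and h: "\<And>z. z \<in> S \<Longrightarrow> h z \<in> borel_measurable M"
    and bound: "\<And>z \<omega>. z \<in> S \<Longrightarrow> \<omega> \<in> space M \<Longrightarrow> norm (h z \<omega>) \<le> B"
    and cont: "AE \<omega> in M. continuous_on S (\<lambda>z. h z \<omega>)"
    and 0: "\<And>z A. z \<in> S \<Longrightarrow> A \<in> sets F \<Longrightarrow> (LINT \<omega>:A|M. h z \<omega>) = 0"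
    and hZ: "(\<lambda>\<omega>. indicat_real A \<omega> *\<^sub>R h (Z \<omega>) \<omega>) \<in> borel_measurable M"
    and A: "A \<in> sets F"
  shows "(LINT \<omega>:A|M. h (Z \<omega>) \<omega>) = 0"
proof -
  have FM: "sets F \<subseteq> sets M" "space F = space M" using F by (auto simp: subalgebra_def)
  obtain T where T: "countable T" "T \<subseteq> S" "S \<subseteq> closure T"
    using separable by blast
  obtain \<omega>0 where "\<omega>0 \<in> space M" using not_empty by blast
  then have "T \<noteq> {}" using ZS T by force
  define d where "d = from_nat_into T"
  have dT: "d k \<in> S" for k using from_nat_into[OF \<open>T \<noteq> {}\<close>] T(2) by (auto simp: d_def)
  \<comment> \<open>First member of the dense sequence within \<open>1 / Suc m\<close> of
    \<open>Z\<close>. This index is integer-valued and \<open>F\<close>-measurable, so on each of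
    its level sets the parameter is a fixed point and the set remains in \<open>F\<close>.\<close>
  define N where "N m \<omega> = (LEAST k. dist (d k) (Z \<omega>) < 1 / real (Suc m))" for m \<omega>
  have N: "dist (d (N m \<omega>)) (Z \<omega>) < 1 / real (Suc m)" if "\<omega> \<in> space M" for m \<omega>
  proof -
    have "Z \<omega> \<in> closure T" using ZS[OF that] T(3) by auto
    moreover have "(0::real) < 1 / real (Suc m)" by simp
    ultimately obtain t where "t \<in> T" "dist t (Z \<omega>) < 1 / real (Suc m)"
      unfolding closure_approachable by blast
    moreover then obtain k where "t = d k"
      using from_nat_into_surj[OF T(1)] by (metis d_def)
    ultimately show ?thesis unfolding N_def by (metis (mono_tags, lifting) LeastI)
  qed
  have NF [measurable]: "N m \<in> F \<rightarrow>\<^sub>M count_space UNIV" for m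
    unfolding N_def using Z by measurable
  have NM [measurable]: "N m \<in> M \<rightarrow>\<^sub>M count_space UNIV" for m
    by (rule measurable_from_subalg[OF F NF])
  note [measurable] = h[OF dT]
  have uM [measurable]: "(\<lambda>\<omega>. h (d (N m \<omega>)) \<omega>) \<in> borel_measurable M" for m
    by (rule measurable_compose_countable) auto
  have bnd: "norm (h (d (N m \<omega>)) \<omega>) \<le> B" if "\<omega> \<in> space M" for m \<omega>
    using bound[OF dT that] .
  have AM [measurable]: "A \<in> sets M" using A FM by auto
  have "(LINT \<omega>:A|M. h (d (N m \<omega>)) \<omega>) = 0" for m
  proof (rule set_integral_zero_split[OF F NF A])
    show "set_integrable M A (\<lambda>\<omega>. h (d (N m \<omega>)) \<omega>)"
      unfolding set_integrable_def
      by (rule integrable_const_bound[where B = B])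
        (use bnd order_trans[OF norm_ge_zero bnd] in \<open>auto simp: indicator_def\<close>)
    fix k
    let ?A = "A \<inter> {\<omega> \<in> space M. N m \<omega> = k}"
    have "{\<omega> \<in> space F. N m \<omega> = k} \<in> sets F" by measurable
    then have A': "?A \<in> sets F" using A FM by auto
    have "(LINT \<omega>:?A|M. h (d (N m \<omega>)) \<omega>) = (LINT \<omega>:?A|M. h (d k) \<omega>)"
      unfolding set_lebesgue_integral_def
      by (intro Bochner_Integration.integral_cong) (auto simp: indicator_def)
    then show "(LINT \<omega>:?A|M. h (d (N m \<omega>)) \<omega>) = 0" using 0[OF dT A'] by simp
  qed
  moreover have "(\<lambda>m. LINT \<omega>:A|M. h (d (N m \<omega>)) \<omega>) \<longlonglongrightarrow> (LINT \<omega>:A|M. h (Z \<omega>) \<omega>)"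
    unfolding set_lebesgue_integral_def
  proof (rule integral_dominated_convergence[where w = "\<lambda>_. B"])
    show "AE \<omega> in M. (\<lambda>m. indicat_real A \<omega> *\<^sub>R h (d (N m \<omega>)) \<omega>) \<longlonglongrightarrow> indicat_real A \<omega> *\<^sub>R h (Z \<omega>) \<omega>"
      using cont AE_space
    proof eventually_elim
      case (elim \<omega>)
      have "(\<lambda>m. d (N m \<omega>)) \<longlonglongrightarrow> Z \<omega>"
      proof (rule metric_tendsto_imp_tendsto[where a = "0::real"])
        show "(\<lambda>m. 1 / real (Suc m)) \<longlonglongrightarrow> 0"
          using LIMSEQ_Suc[OF lim_inverse_n'] by simp
        show "\<forall>\<^sub>F m in sequentially. dist (d (N m \<omega>)) (Z \<omega>) \<le> dist (1 / real (Suc m)) 0"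
          using N[OF elim(2)] by (intro always_eventually allI) (simp add: less_imp_le)
      qed
      then show ?case
        by (intro tendsto_scaleR tendsto_const continuous_on_tendsto_compose[OF elim(1)])
          (use ZS[OF elim(2)] dT in auto)
    qed
    show "AE \<omega> in M. norm (indicat_real A \<omega> *\<^sub>R h (d (N m \<omega>)) \<omega>) \<le> B" for m
      using AE_space
      by eventually_elim (use bnd order_trans[OF norm_ge_zero bnd] in \<open>auto simp: indicator_def\<close>)
  qed (use hZ in \<open>auto\<close>)
  ultimately show ?thesis by (simp add: LIMSEQ_const_iff)
qed

text \<open>Uniqueness of characteristic functions needs probability measures, whereas
  \<open>f1\<close> and \<open>f2\<close> may change sign. Adding \<open>B + 1\<close> makes both at
  least 1 and preserves their difference; after division by the common mass they are densities, and
  the laws of \<open>Y\<close> under them have equal characteristic functions.\<close>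

lemma fourier_unique_real:
  fixes f1 f2 Y :: "'a \<Rightarrow> real"
  assumes f [measurable]: "f1 \<in> borel_measurable M" "f2 \<in> borel_measurable M"
    and Y [measurable]: "Y \<in> borel_measurable M"
    and bound: "\<And>\<omega>. \<omega> \<in> space M \<Longrightarrow> \<bar>f1 \<omega>\<bar> \<le> B" "\<And>\<omega>. \<omega> \<in> space M \<Longrightarrow> \<bar>f2 \<omega>\<bar> \<le> B"
    and eq: "\<And>r. (CLINT \<omega>|M. iexp (r * Y \<omega>) * f1 \<omega>) = (CLINT \<omega>|M. iexp (r * Y \<omega>) * f2 \<omega>)"
    and D [measurable]: "D \<in> sets borel"
  shows "(LINT \<omega>|M. indicator D (Y \<omega>) * f1 \<omega>) = (LINT \<omega>|M. indicator D (Y \<omega>) * f2 \<omega>)"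
proof -
  have int: "integrable M f1" "integrable M f2"
    using bound by (auto intro!: integrable_const_bound[where B = B])
  define c where "c = (LINT \<omega>|M. f1 \<omega> + (B + 1))"
  \<comment> \<open>The hypothesis at \<open>r = 0\<close> says that the masses agree, so a single
    \<open>c\<close> normalises both densities.\<close>
  have "complex_of_real (LINT \<omega>|M. f1 \<omega>) = complex_of_real (LINT \<omega>|M. f2 \<omega>)"
    using eq[of 0] by (simp flip: integral_complex_of_real)
  then have c2: "c = (LINT \<omega>|M. f2 \<omega> + (B + 1))"
    using int by (simp add: c_def prob_space)
  have "1 = (LINT \<omega>|M. (1::real))" by (simp add: prob_space)
  also have "\<dots> \<le> c" unfolding c_def
    using int by (intro integral_mono) (use bound in \<open>force simp: abs_le_iff\<close>)+
  finally have c: "c \<ge> 1" .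
  define \<nu> where "\<nu> f = distr (density M (\<lambda>\<omega>. ennreal ((f \<omega> + (B + 1)) / c))) borel Y" for f :: "'a \<Rightarrow> real"
  have nn: "0 \<le> (f \<omega> + (B + 1)) / c" if "\<omega> \<in> space M" "f = f1 \<or> f = f2" for f \<omega>
    using bound(1)[OF that(1)] bound(2)[OF that(1)] c that(2) by auto
  have fm: "f \<in> borel_measurable M" "integrable M f" "c = (LINT \<omega>|M. f \<omega> + (B + 1))"
    if "f = f1 \<or> f = f2" for f
    using f int that c2 c_def by auto
  have prob: "prob_space (density M (\<lambda>\<omega>. ennreal ((f \<omega> + (B + 1)) / c)))" if f: "f = f1 \<or> f = f2" for f
  proof
    note [measurable] = fm(1)[OF f]
    have "(\<integral>\<^sup>+ \<omega>. ennreal ((f \<omega> + (B + 1)) / c) \<partial>M) = ennreal (LINT \<omega>|M. (f \<omega> + (B + 1)) / c)"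
      using fm(2)[OF f] by (intro nn_integral_eq_integral) (auto intro!: AE_I2 nn[OF _ f])
    also have "(LINT \<omega>|M. (f \<omega> + (B + 1)) / c) = 1"
      using fm(3)[OF f] c by simp
    finally show "emeasure (density M (\<lambda>\<omega>. ennreal ((f \<omega> + (B + 1)) / c)))
        (space (density M (\<lambda>\<omega>. ennreal ((f \<omega> + (B + 1)) / c)))) = 1"
      by (simp add: emeasure_density cong: nn_integral_cong)
  qed
  have rd: "real_distribution (\<nu> f)" if f: "f = f1 \<or> f = f2" for f
  proof -
    interpret D: prob_space "density M (\<lambda>\<omega>. ennreal ((f \<omega> + (B + 1)) / c))" by (rule prob[OF f])
    show ?thesis unfolding \<nu>_def by (rule D.real_distribution_distr) simp
  qed
  have int_\<nu>: "(LINT x|\<nu> f. g x) = (LINT \<omega>|M. ((f \<omega> + (B + 1)) / c) *\<^sub>R g (Y \<omega>))"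
    if f: "f = f1 \<or> f = f2" and g: "g \<in> borel_measurable borel"
    for f and g :: "real \<Rightarrow> 'b::{banach, second_countable_topology}"
  proof -
    note [measurable] = fm(1)[OF f] g
    show ?thesis unfolding \<nu>_def
      by (subst integral_distr, simp, simp, subst integral_density) (auto intro!: AE_I2 nn[OF _ f])
  qed
  have "char (\<nu> f1) = char (\<nu> f2)"
  proof
    fix r
    have "char (\<nu> f) r = ((CLINT \<omega>|M. iexp (r * Y \<omega>) * f \<omega>) + (B + 1) * (CLINT \<omega>|M. iexp (r * Y \<omega>))) / c"
      if f: "f = f1 \<or> f = f2" for f
    proof -
      note [measurable] = fm(1)[OF f]
      have i: "integrable M (\<lambda>\<omega>. iexp (r * Y \<omega>) * complex_of_real (f \<omega>))"
        using bound f by (intro integrable_const_bound[where B = B]) (auto simp: norm_mult)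
      have i': "integrable M (\<lambda>\<omega>. iexp (r * Y \<omega>))"
        by (intro integrable_const_bound[where B = 1]) auto
      have "char (\<nu> f) r = (CLINT \<omega>|M. ((f \<omega> + (B + 1)) / c) *\<^sub>R iexp (r * Y \<omega>))"
        unfolding char_def by (rule int_\<nu>[OF f]) simp
      also have "\<dots> = (CLINT \<omega>|M. (iexp (r * Y \<omega>) * f \<omega> + (B + 1) * iexp (r * Y \<omega>)) / c)"
        by (intro Bochner_Integration.integral_cong) (auto simp: scaleR_conv_of_real field_simps)
      also have "\<dots> = ((CLINT \<omega>|M. iexp (r * Y \<omega>) * f \<omega>) + (B + 1) * (CLINT \<omega>|M. iexp (r * Y \<omega>))) / c"
        using i i' by (subst integral_divide_zero, subst Bochner_Integration.integral_add) auto
      finally show ?thesis .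
    qed
    then show "char (\<nu> f1) r = char (\<nu> f2) r" using eq[of r] by simp
  qed
  then have "\<nu> f1 = \<nu> f2" by (intro Levy_uniqueness rd) auto
  then have "(LINT \<omega>|M. ((f1 \<omega> + (B + 1)) / c) *\<^sub>R indicat_real D (Y \<omega>))
      = (LINT \<omega>|M. ((f2 \<omega> + (B + 1)) / c) *\<^sub>R indicat_real D (Y \<omega>))"
    using int_\<nu>[of f1 "indicat_real D"] int_\<nu>[of f2 "indicat_real D"] by simp
  moreover have "(LINT \<omega>|M. ((f \<omega> + (B + 1)) / c) *\<^sub>R indicat_real D (Y \<omega>))
     = ((LINT \<omega>|M. indicator D (Y \<omega>) * f \<omega>) + (B + 1) * (LINT \<omega>|M. indicator D (Y \<omega>))) / c"
    if f: "f = f1 \<or> f = f2" for f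
  proof -
    note [measurable] = fm(1)[OF f]
    have i: "integrable M (\<lambda>\<omega>. indicat_real D (Y \<omega>) * f \<omega>)"
      using bound f order_trans[OF abs_ge_zero bound(1)]
      by (intro integrable_const_bound[where B = B]) (auto simp: indicator_def)
    have i': "integrable M (\<lambda>\<omega>. indicat_real D (Y \<omega>))"
      by (intro integrable_const_bound[where B = 1]) auto
    have "(LINT \<omega>|M. ((f \<omega> + (B + 1)) / c) *\<^sub>R indicat_real D (Y \<omega>))
      = (LINT \<omega>|M. (indicator D (Y \<omega>) * f \<omega> + (B + 1) * indicator D (Y \<omega>)) / c)"
      by (intro Bochner_Integration.integral_cong) (auto simp: field_simps)
    also have "\<dots> = ((LINT \<omega>|M. indicator D (Y \<omega>) * f \<omega>) + (B + 1) * (LINT \<omega>|M. indicator D (Y \<omega>))) / c"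
      using i i' by (subst integral_divide_zero, subst Bochner_Integration.integral_add) auto
    finally show ?thesis .
  qed
  ultimately show ?thesis using c by (simp add: divide_cancel_right)
qed

text \<open>Conjugating the hypothesis at \<open>- r\<close> shows that the conjugate of
  \<open>h\<close> satisfies it too. Hence so do the real and imaginary parts, to which the real
  version applies with 0 as second function.\<close>

lemma fourier_zero_imp_set_integral_zero:
  fixes h :: "'a \<Rightarrow> complex" and Y :: "'a \<Rightarrow> real"
  assumes h [measurable]: "h \<in> borel_measurable M" and Y [measurable]: "Y \<in> borel_measurable M"
    and bound: "\<And>\<omega>. \<omega> \<in> space M \<Longrightarrow> norm (h \<omega>) \<le> B"
    and eq: "\<And>r. (CLINT \<omega>|M. iexp (r * Y \<omega>) * h \<omega>) = 0"
    and D [measurable]: "D \<in> sets borel"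
  shows "(LINT \<omega>|M. indicat_real D (Y \<omega>) *\<^sub>R h \<omega>) = 0"
proof -
  have [measurable]: "(\<lambda>\<omega>. cnj (h \<omega>)) \<in> borel_measurable M"
    by (rule measurable_compose[OF h]) (intro borel_measurable_continuous_onI continuous_intros)
  have i: "integrable M (\<lambda>\<omega>. iexp (r * Y \<omega>) * h \<omega>)" "integrable M (\<lambda>\<omega>. iexp (r * Y \<omega>) * cnj (h \<omega>))" for r
    using bound by (auto intro!: integrable_const_bound[where B = B] simp: norm_mult)
  have conj: "(CLINT \<omega>|M. iexp (r * Y \<omega>) * cnj (h \<omega>)) = 0" for r
  proof -
    have "(CLINT \<omega>|M. iexp (r * Y \<omega>) * cnj (h \<omega>)) = (CLINT \<omega>|M. cnj (iexp (- r * Y \<omega>) * h \<omega>))"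
      by (intro Bochner_Integration.integral_cong) (auto simp: exp_cnj)
    also have "\<dots> = cnj (CLINT \<omega>|M. iexp (- r * Y \<omega>) * h \<omega>)"
      by (rule integral_bounded_linear[OF bounded_linear_cnj i(1)])
    finally show ?thesis using eq[of "- r"] by simp
  qed
  have re: "(CLINT \<omega>|M. iexp (r * Y \<omega>) * Re (h \<omega>)) = 0" for r
  proof -
    have "(CLINT \<omega>|M. iexp (r * Y \<omega>) * Re (h \<omega>))
      = (CLINT \<omega>|M. (iexp (r * Y \<omega>) * h \<omega> + iexp (r * Y \<omega>) * cnj (h \<omega>)) / 2)"
      by (intro Bochner_Integration.integral_cong) (auto simp: complex_add_cnj simp flip: distrib_left)
    then show ?thesis
      using i[of r] eq[of r] conj[of r] by (simp only: integral_divide_zero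
        Bochner_Integration.integral_add) simp
  qed
  have im: "(CLINT \<omega>|M. iexp (r * Y \<omega>) * Im (h \<omega>)) = 0" for r
  proof -
    have "(CLINT \<omega>|M. iexp (r * Y \<omega>) * Im (h \<omega>))
      = (CLINT \<omega>|M. (iexp (r * Y \<omega>) * h \<omega> - iexp (r * Y \<omega>) * cnj (h \<omega>)) / (2 * \<i>))"
    proof (intro Bochner_Integration.integral_cong refl)
      fix \<omega>
      have "complex_of_real (Im (h \<omega>)) = (h \<omega> - cnj (h \<omega>)) / (2 * \<i>)"
        by (simp add: complex_eq_iff)
      then show "iexp (r * Y \<omega>) * Im (h \<omega>)
          = (iexp (r * Y \<omega>) * h \<omega> - iexp (r * Y \<omega>) * cnj (h \<omega>)) / (2 * \<i>)"
        by (simp only: right_diff_distrib times_divide_eq_right)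
    qed
    then show ?thesis
      using i[of r] eq[of r] conj[of r] by (simp only: integral_divide_zero
        Bochner_Integration.integral_diff) simp
  qed
  have Re_b: "\<bar>Re (h \<omega>)\<bar> \<le> B" and Im_b: "\<bar>Im (h \<omega>)\<bar> \<le> B" and B0: "0 \<le> B" if "\<omega> \<in> space M" for \<omega>
    using bound[OF that] abs_Re_le_cmod[of "h \<omega>"] abs_Im_le_cmod[of "h \<omega>"] norm_ge_zero[of "h \<omega>"]
      by linarith+
  have r0: "(LINT \<omega>|M. indicator D (Y \<omega>) * Re (h \<omega>)) = (LINT \<omega>|M. indicator D (Y \<omega>) * (0::real))"
    by (rule fourier_unique_real[where B = B]) (use re Re_b B0 in auto)
  have i0: "(LINT \<omega>|M. indicator D (Y \<omega>) * Im (h \<omega>)) = (LINT \<omega>|M. indicator D (Y \<omega>) * (0::real))"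
    by (rule fourier_unique_real[where B = B]) (use im Im_b B0 in auto)
  have int: "integrable M (\<lambda>\<omega>. indicat_real D (Y \<omega>) *\<^sub>R h \<omega>)"
    using bound B0 by (auto intro!: integrable_const_bound[where B = B] simp: indicator_def)
  show ?thesis
    by (rule complex_eqI) (use r0 i0 in \<open>simp_all flip: integral_Re[OF int] integral_Im[OF int]\<close>)
qed

end

subsection \<open>Gaussian processes\<close>

lemma borel_measurable_lc [measurable]:
  "(\<And>p. p \<in> snd ` set L \<Longrightarrow> f p \<in> borel_measurable N) \<Longrightarrow> (\<lambda>\<omega>. lc L (\<lambda>p. f p \<omega>)) \<in> borel_measurable N"
  by (induction L) auto

lemma continuous_on_lc:
  "(\<And>p. p \<in> snd ` set L \<Longrightarrow> continuous_on S (\<lambda>z. f z p)) \<Longrightarrow> continuous_on S (\<lambda>z. lc L (f z))"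
  by (induction L) (auto intro!: continuous_intros)

text \<open>Bridge to \<open>gaussian_process\<close>, which is stated with coefficient functions on
  finite sets: repeated points are merged by adding their weights.\<close>

lemma lc_eq_sum:
  assumes "finite S" "snd ` set L \<subseteq> S"
  obtains b where "\<And>f. lc L f = (\<Sum>x\<in>S. b x * f x)"
proof -
  have "\<exists>b. \<forall>f. lc L f = (\<Sum>x\<in>S. b x * f x)"
    using assms(2)
  proof (induction L)
    case Nil
    then show ?case by (intro exI[of _ "\<lambda>_. 0"]) simp
  next
    case (Cons s L)
    obtain c p where s: "s = (c, p)" by (cases s)
    obtain b where b: "\<And>f. lc L f = (\<Sum>x\<in>S. b x * f x)" using Cons by auto
    have eq: "lc (s # L) f = (\<Sum>x\<in>S. (b x + (if x = p then c else 0)) * f x)" for f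
    proof -
      have "(\<Sum>x\<in>S. (b x + (if x = p then c else 0)) * f x)
        = (\<Sum>x\<in>S. b x * f x) + (\<Sum>x\<in>S. if x = p then c * f x else 0)"
        by (subst sum.distrib[symmetric]) (auto intro!: sum.cong simp: algebra_simps)
      also have "(\<Sum>x\<in>S. if x = p then c * f x else 0) = c * f p"
        using assms(1) Cons.prems s by simp
      finally show ?thesis by (simp add: s b)
    qed
    show ?case
      by (rule exI[of _ "\<lambda>x. b x + (if x = p then c else 0)"]) (simp only: eq simp_thms)
  qed
  then show ?thesis using that by blast
qed

section \<open>Several independent processes on one joint index set\<close>

definition sel :: "nat \<Rightarrow> (real \<times> nat \<times> 'x) list \<Rightarrow> (real \<times> 'x) list" where
  "sel j L = map (\<lambda>(b, p). (b, snd p)) (filter (\<lambda>(b, p). fst p = j) L)"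

lemma lc_sel: "snd ` set L \<subseteq> {1..M} \<times> X \<Longrightarrow> lc L f = (\<Sum>j\<in>{1..M}. lc (sel j L) (\<lambda>x. f (j, x)))"
proof (induction L)
  case (Cons s L)
  obtain b j x where s: "s = (b, j, x)" by (cases s)
  have "(\<Sum>i\<in>{1..M}. lc (sel i (s # L)) (\<lambda>x. f (i, x)))
    = (\<Sum>i\<in>{1..M}. (if j = i then b * f (j, x) else 0) + lc (sel i L) (\<lambda>x. f (i, x)))"
    by (intro sum.cong) (auto simp: s sel_def)
  then show ?case using Cons by (simp add: s sum.distrib)
qed (simp add: sel_def)

lemma sel_subset: "snd ` set L \<subseteq> {1..M} \<times> X \<Longrightarrow> snd ` set (sel j L) \<subseteq> X"
  by (force simp: sel_def)

lemma lc_sel_diag: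
  "lc L (\<lambda>p. if j = fst p then f (snd p) else 0) = lc (sel j L) f"
  by (induction L) (auto simp: sel_def)

text \<open>Covariance of all alternatives together, indexed by pairs of alternative and point. It
  vanishes across alternatives, at time 0 by independence of the priors and later because a sample
  of one alternative leaves the others untouched.\<close>

definition block_kernel :: "(nat \<Rightarrow> 'x \<Rightarrow> 'x \<Rightarrow> real) \<Rightarrow> nat \<times> 'x \<Rightarrow> nat \<times> 'x \<Rightarrow> real" where
  "block_kernel K p p' = (if fst p = fst p' then K (fst p) (snd p) (snd p') else 0)"

lemma qf_block_kernel:
  assumes "snd ` set L \<subseteq> {1..M} \<times> X"
  shows "qf (block_kernel K) L = (\<Sum>j\<in>{1..M}. qf (K j) (sel j L))"
proof -
  have "lc L (block_kernel K p) = lc (sel (fst p) L) (K (fst p) (snd p))" for p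
    unfolding block_kernel_def lc_sel_diag[symmetric] by simp
  then show ?thesis by (simp add: qf_def lc_sel[OF assms])
qed

lemma psd_on_block_kernel:
  assumes "\<And>j. j \<in> {1..M} \<Longrightarrow> psd_on X (K j)"
  shows "psd_on ({1..M} \<times> X) (block_kernel K)"
  unfolding psd_on_def
proof (intro conjI ballI allI impI)
  fix p p' assume "p \<in> {1..M} \<times> X" "p' \<in> {1..M} \<times> X"
  then show "block_kernel K p p' = block_kernel K p' p"
    using psd_on_sym[OF assms] by (auto simp: block_kernel_def)
next
  fix L :: "(real \<times> nat \<times> 'a) list" assume L: "snd ` set L \<subseteq> {1..M} \<times> X"
  show "0 \<le> qf (block_kernel K) L"
    unfolding qf_block_kernel[OF L]
    by (intro sum_nonneg psd_on_nonneg[OF assms sel_subset[OF L]])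
qed

text \<open>An affine map reduces the law to the standard normal one; the point mass at
  \<open>s = 0\<close> obeys the same formula.\<close>

lemma char_normal_law:
  assumes "0 \<le> s"
  shows "char (normal_law m s) t = iexp (t * m) * exp (- s * t\<^sup>2 / 2)"
proof (cases "s = 0")
  case True
  then show ?thesis by (simp add: normal_law_def char_def integral_return)
next
  case False
  then have s: "s > 0" using assms by simp
  interpret N: prob_space std_normal_distribution by (rule prob_space_normal_density) simp
  have "distributed std_normal_distribution lborel (\<lambda>x. x) (normal_density 0 1)"
    by (auto simp: distributed_def intro!: distr_id2)
  from N.normal_density_affine[OF this, of "sqrt s" m] s
  have "distributed std_normal_distribution lborel (\<lambda>x. m + sqrt s * x) (normal_density m (sqrt s))"
    by simp
  then have "distr std_normal_distribution lborel (\<lambda>x. m + sqrt s * x)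
    = density lborel (normal_density m (sqrt s))"
    by (simp add: distributed_def)
  moreover have "distr std_normal_distribution lborel (\<lambda>x. m + sqrt s * x)
      = distr std_normal_distribution borel (\<lambda>x. m + sqrt s * x)"
    by (rule distr_cong) auto
  ultimately have eq: "normal_law m s = distr std_normal_distribution borel (\<lambda>x. m + sqrt s * x)"
    using s by (simp add: normal_law_def)
  have "char (normal_law m s) t = (CLINT x|std_normal_distribution. iexp (t * m) * iexp ((t * sqrt s) * x))"
    unfolding eq char_def
    by (subst integral_distr) (auto intro!: Bochner_Integration.integral_cong simp: distrib_left exp_add
      mult_ac)
  also have "\<dots> = iexp (t * m) * char std_normal_distribution (t * sqrt s)"
    by (simp add: char_def)
  finally show ?thesis using s
    by (simp add: char_std_normal_distribution power_mult_distrib mult.commute)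
qed

context prob_space
begin

lemma normal_law_square_moment:
  assumes Y [measurable]: "Y \<in> borel_measurable M" and d: "distr M borel Y = normal_law m s" and s: "s > 0"
  shows "integrable M (\<lambda>\<omega>. (Y \<omega> - m)\<^sup>2)" "expectation (\<lambda>\<omega>. (Y \<omega> - m)\<^sup>2) = s"
proof -
  have s': "sqrt s > 0" using s by simp
  have eq: "normal_law m s = density lborel (normal_density m (sqrt s))" using s
    by (simp add: normal_law_def)
  have "integrable (distr M borel Y) (\<lambda>x. (x - m)\<^sup>2)"
    unfolding d eq using integrable_normal_moment[OF s', of m 2]
    by (subst integrable_density) auto
  then show "integrable M (\<lambda>\<omega>. (Y \<omega> - m)\<^sup>2)"
    by (subst (asm) integrable_distr_eq) auto
  have "expectation (\<lambda>\<omega>. (Y \<omega> - m)\<^sup>2) = (LINT x|distr M borel Y. (x - m)\<^sup>2)"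
    by (subst integral_distr) auto
  also have "\<dots> = (LINT x|lborel. normal_density m (sqrt s) x * (x - m)\<^sup>2)"
    unfolding d eq by (subst integral_density) auto
  also have "\<dots> = s"
    using integral_normal_moment_even[OF s', of m 1] s by (simp add: fact_numeral)
  finally show "expectation (\<lambda>\<omega>. (Y \<omega> - m)\<^sup>2) = s" .
qed

text \<open>With positive covariances the two-point law determines \<open>K x x'\<close> as the covariance
  of the values, although \<open>normal_law\<close> accepts a negative variance parameter.\<close>

lemma psd_on_gaussian_process:
  assumes g: "gaussian_process M X m K f"
    and sym: "\<And>x x'. x \<in> X \<Longrightarrow> x' \<in> X \<Longrightarrow> K x x' = K x' x"
    and pos: "\<And>x x'. x \<in> X \<Longrightarrow> x' \<in> X \<Longrightarrow> 0 < K x x'"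
  shows "psd_on X K"
proof -
  have f [measurable]: "f x \<in> borel_measurable M" if "x \<in> X" for x
    using g that by (auto simp: gaussian_process_def)
  have law: "distr M borel (\<lambda>\<omega>. \<Sum>x\<in>S. b x * f x \<omega>) =
      normal_law (\<Sum>x\<in>S. b x * m x) (\<Sum>x\<in>S. \<Sum>x'\<in>S. b x * b x' * K x x')"
    if "finite S" "S \<subseteq> X" for S b
    using g that by (auto simp: gaussian_process_def)
  define \<phi> where "\<phi> x \<omega> = f x \<omega> - m x" for x \<omega>
  have \<phi> [measurable]: "\<phi> x \<in> borel_measurable M" if "x \<in> X" for x
    unfolding \<phi>_def using f[OF that] by measurable
  have sq: "integrable M (\<lambda>\<omega>. (\<phi> x \<omega>)\<^sup>2)" "expectation (\<lambda>\<omega>. (\<phi> x \<omega>)\<^sup>2) = K x x" if x: "x \<in> X" for x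
    using normal_law_square_moment[OF f[OF x], of "m x" "K x x"] law[of "{x}" "\<lambda>_. 1"] x pos[OF x x]
    by (auto simp: \<phi>_def)
  have sq2: "integrable M (\<lambda>\<omega>. (\<phi> x \<omega> + \<phi> x' \<omega>)\<^sup>2)"
    "expectation (\<lambda>\<omega>. (\<phi> x \<omega> + \<phi> x' \<omega>)\<^sup>2) = K x x + 2 * K x x' + K x' x'"
    if x: "x \<in> X" "x' \<in> X" "x \<noteq> x'" for x x'
  proof -
    have "distr M borel (\<lambda>\<omega>. f x \<omega> + f x' \<omega>) = normal_law (m x + m x') (K x x + 2 * K x x' + K x' x')"
      using law[of "{x, x'}" "\<lambda>_. 1"] x sym[OF x(1,2)] by (simp add: ac_simps)
    from normal_law_square_moment[OF _ this] f[OF x(1)] f[OF x(2)]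
      pos[OF x(1,1)] pos[OF x(1,2)] pos[OF x(2,2)]
    have "integrable M (\<lambda>\<omega>. (f x \<omega> + f x' \<omega> - (m x + m x'))\<^sup>2)"
      "expectation (\<lambda>\<omega>. (f x \<omega> + f x' \<omega> - (m x + m x'))\<^sup>2) = K x x + 2 * K x x' + K x' x'"
      by auto
    moreover have "f x \<omega> + f x' \<omega> - (m x + m x') = \<phi> x \<omega> + \<phi> x' \<omega>" for \<omega>
      by (simp add: \<phi>_def)
    ultimately show "integrable M (\<lambda>\<omega>. (\<phi> x \<omega> + \<phi> x' \<omega>)\<^sup>2)"
      "expectation (\<lambda>\<omega>. (\<phi> x \<omega> + \<phi> x' \<omega>)\<^sup>2) = K x x + 2 * K x x' + K x' x'" by simp_all
  qed
  have cov: "integrable M (\<lambda>\<omega>. \<phi> x \<omega> * \<phi> x' \<omega>)" "expectation (\<lambda>\<omega>. \<phi> x \<omega> * \<phi> x' \<omega>) = K x x'"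
    if x: "x \<in> X" "x' \<in> X" for x x'
  proof -
    have "integrable M (\<lambda>\<omega>. \<phi> x \<omega> * \<phi> x' \<omega>) \<and> expectation (\<lambda>\<omega>. \<phi> x \<omega> * \<phi> x' \<omega>) = K x x'"
    proof (cases "x = x'")
      case True
      then show ?thesis using sq[OF x(1)] by (simp add: power2_eq_square)
    next
      case False
      \<comment> \<open>Polarisation: mixed moments follow from second moments of single values and
        of sums, so one-dimensional laws suffice.\<close>
      have e: "\<phi> x \<omega> * \<phi> x' \<omega> = ((\<phi> x \<omega> + \<phi> x' \<omega>)\<^sup>2 - (\<phi> x \<omega>)\<^sup>2 - (\<phi> x' \<omega>)\<^sup>2) / 2" for \<omega>
        by (simp add: power2_eq_square algebra_simps)
      show ?thesis unfolding e
        using sq[OF x(1)] sq[OF x(2)] sq2[OF x False] by simp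
    qed
    then show "integrable M (\<lambda>\<omega>. \<phi> x \<omega> * \<phi> x' \<omega>)" "expectation (\<lambda>\<omega>. \<phi> x \<omega> * \<phi> x' \<omega>) = K x x'" by auto
  qed
  have lin: "integrable M (\<lambda>\<omega>. \<phi> x \<omega> * lc L (\<lambda>p. \<phi> p \<omega>)) \<and>
      expectation (\<lambda>\<omega>. \<phi> x \<omega> * lc L (\<lambda>p. \<phi> p \<omega>)) = lc L (K x)"
    if "snd ` set L \<subseteq> X" "x \<in> X" for L x
    using that
  proof (induction L)
    case (Cons s L)
    obtain b p where s: "s = (b, p)" by (cases s)
    have p: "p \<in> X" using Cons.prems s by auto
    have "\<phi> x \<omega> * lc (s # L) (\<lambda>p. \<phi> p \<omega>) = b * (\<phi> x \<omega> * \<phi> p \<omega>) + \<phi> x \<omega> * lc L (\<lambda>p. \<phi> p \<omega>)" for \<omega>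
      by (simp add: s algebra_simps)
    then show ?case using Cons cov[OF Cons.prems(2) p] by (simp add: s)
  qed simp
  have quad: "integrable M (\<lambda>\<omega>. lc L' (\<lambda>p. \<phi> p \<omega>) * lc L (\<lambda>p. \<phi> p \<omega>)) \<and>
      expectation (\<lambda>\<omega>. lc L' (\<lambda>p. \<phi> p \<omega>) * lc L (\<lambda>p. \<phi> p \<omega>)) = lc L' (\<lambda>x. lc L (K x))"
    if "snd ` set L \<subseteq> X" "snd ` set L' \<subseteq> X" for L L'
    using that(2)
  proof (induction L')
    case (Cons s L')
    obtain b p where s: "s = (b, p)" by (cases s)
    have p: "p \<in> X" using Cons.prems s by auto
    have "lc (s # L') (\<lambda>p. \<phi> p \<omega>) * lc L (\<lambda>p. \<phi> p \<omega>)
      = b * (\<phi> p \<omega> * lc L (\<lambda>p. \<phi> p \<omega>)) + lc L' (\<lambda>p. \<phi> p \<omega>) * lc L (\<lambda>p. \<phi> p \<omega>)" for \<omega>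
      by (simp add: s algebra_simps)
    then show ?case using Cons lin[OF that(1) p] by (simp add: s)
  qed simp
  have "0 \<le> qf K L" if L: "snd ` set L \<subseteq> X" for L
  proof -
    have "qf K L = expectation (\<lambda>\<omega>. lc L (\<lambda>p. \<phi> p \<omega>) * lc L (\<lambda>p. \<phi> p \<omega>))"
      using quad[OF L L] by (simp add: qf_def)
    also have "\<dots> \<ge> 0" by (intro Bochner_Integration.integral_nonneg) simp
    finally show ?thesis .
  qed
  then show ?thesis using sym by (auto simp: psd_on_def)
qed

lemma char_gaussian_process:
  assumes g: "gaussian_process M X m K f" and K: "psd_on X K" and L: "snd ` set L \<subseteq> X"
  shows "char (distr M borel (\<lambda>\<omega>. lc L (\<lambda>x. f x \<omega>))) t = iexp (t * lc L m) * exp (- qf K L * t\<^sup>2 / 2)"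
proof -
  obtain b where b: "\<And>f. lc L f = (\<Sum>x\<in>snd ` set L. b x * f x)"
    using lc_eq_sum[of "snd ` set L" L] by blast
  have "qf K L = (\<Sum>x\<in>snd ` set L. \<Sum>x'\<in>snd ` set L. b x * b x' * K x x')"
    by (simp add: qf_def b sum_distrib_left mult_ac)
  then have "distr M borel (\<lambda>\<omega>. lc L (\<lambda>x. f x \<omega>)) = normal_law (lc L m) (qf K L)"
    using g L by (auto simp: gaussian_process_def b)
  then show ?thesis using char_normal_law[OF psd_on_nonneg[OF K L]] by simp
qed

end

subsection \<open>The posterior along a sampling path\<close>

text \<open>The setting of an arbitrary adaptive design. The policy, the costs and the density come
  in only with \<open>ikg_policy\<close>.\<close>

locale gp_sampling = sampling_model P M X \<mu>0 k0 lam \<theta> \<xi> a v y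
  for P :: "'w measure" and M and X :: "(real ^ 'd) set" and \<mu>0 k0 lam \<theta> \<xi> a v y +
  assumes kernel: "i \<in> {1..M} \<Longrightarrow> \<exists>\<tau> \<rho>. \<tau> > 0 \<and> correlation_function \<rho> \<and>
      (\<forall>x\<in>X. \<forall>x'\<in>X. k0 i x x' = \<tau>\<^sup>2 * \<rho> (x - x'))"
    and mu0_cont: "i \<in> {1..M} \<Longrightarrow> continuous_on X (\<mu>0 i)"
    and lam_cont: "i \<in> {1..M} \<Longrightarrow> continuous_on X (lam i)"
    and lam_pos: "i \<in> {1..M} \<Longrightarrow> \<forall>x\<in>X. 0 < lam i x"
begin

definition "\<I> = {1..M} \<times> X"
definition H :: "nat \<Rightarrow> 'w \<Rightarrow> (real ^ 'd) history" where "H n \<omega> = history a v y n \<omega>"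
definition pmean where "pmean n \<omega> i x = post_mean \<mu>0 k0 lam (H n \<omega>) i x"
definition pcov where "pcov n \<omega> i x x' = post_cov k0 lam (H n \<omega>) i x x'"
abbreviation "RX \<equiv> restrict_space (borel :: (real ^ 'd) measure) X"

lemma H_0: "H 0 \<omega> = []" by (simp add: H_def history_def)

lemma H_Suc: "H (Suc n) \<omega> = H n \<omega> @ [(a n \<omega>, v n \<omega>, y (Suc n) \<omega>)]"
  by (simp add: H_def history_def)

lemma valid_H: "\<omega> \<in> space P \<Longrightarrow> valid_history M X (H n \<omega>)"
  using decision_range by (induction n) (auto simp: H_0 H_Suc)

lemma k0_pos: "i \<in> {1..M} \<Longrightarrow> x \<in> X \<Longrightarrow> x' \<in> X \<Longrightarrow> 0 < k0 i x x'"
  using kernel[of i] by (smt (verit) correlation_function_def mult_pos_pos zero_less_power)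

lemma k0_sym: "i \<in> {1..M} \<Longrightarrow> x \<in> X \<Longrightarrow> x' \<in> X \<Longrightarrow> k0 i x x' = k0 i x' x"
proof -
  assume i: "i \<in> {1..M}" and x: "x \<in> X" "x' \<in> X"
  obtain \<tau> \<rho> where \<rho>: "correlation_function \<rho>" "\<forall>x\<in>X. \<forall>x'\<in>X. k0 i x x' = \<tau>\<^sup>2 * \<rho> (x - x')"
    using kernel[OF i] by blast
  have abs: "\<rho> \<bar>\<delta>\<bar> = \<rho> \<delta>" for \<delta> using \<rho>(1) by (auto simp: correlation_function_def)
  have "\<rho> (x - x') = \<rho> (x' - x)"
    using abs[of "x - x'"] abs[of "x' - x"] by (simp add: abs_minus_commute)
  then show ?thesis using \<rho>(2) x by simp
qed

lemma k0_cont: "i \<in> {1..M} \<Longrightarrow> continuous_on (X \<times> X) (\<lambda>(x, x'). k0 i x x')"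
proof -
  assume i: "i \<in> {1..M}"
  obtain \<tau> \<rho> where \<rho>: "correlation_function \<rho>" "\<forall>x\<in>X. \<forall>x'\<in>X. k0 i x x' = \<tau>\<^sup>2 * \<rho> (x - x')"
    using kernel[OF i] by blast
  have "continuous_on UNIV \<rho>" using \<rho>(1) by (simp add: correlation_function_def)
  then have "continuous_on (X \<times> X) (\<lambda>p. \<tau>\<^sup>2 * \<rho> (fst p - snd p))"
    by (intro continuous_intros continuous_on_compose2[where f = "\<lambda>p. fst p - snd p" and g = \<rho>]) auto
  then show ?thesis
    by (rule continuous_on_eq) (use \<rho>(2) in auto)
qed

lemma psd_k0: "i \<in> {1..M} \<Longrightarrow> psd_on X (k0 i)"
  by (rule psd_on_gaussian_process[OF prior k0_sym k0_pos])

lemma psd_k0_all: "\<forall>i\<in>{1..M}. psd_on X (k0 i)" and lam_pos_all: "\<forall>i\<in>{1..M}. \<forall>x\<in>X. 0 < lam i x"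
  using psd_k0 lam_pos by blast+

lemmas post_rules = psd_k0_all lam_pos_all

lemma psd_c: "\<omega> \<in> space P \<Longrightarrow> i \<in> {1..M} \<Longrightarrow> psd_on X (pcov n \<omega> i)"
  using psd_on_post_cov[OF post_rules valid_H] by (simp add: pcov_def[abs_def])

lemma c_0: "pcov 0 \<omega> i x x' = k0 i x x'" by (simp add: pcov_def H_0 post_cov_Nil)
lemma m_0: "pmean 0 \<omega> i x = \<mu>0 i x" by (simp add: pmean_def H_0 post_mean_Nil)

lemma c_Suc:
  assumes \<omega>: "\<omega> \<in> space P" and i: "i \<in> {1..M}" and x: "x \<in> X" "x' \<in> X"
  shows "pcov (Suc n) \<omega> i x x' = (if a n \<omega> = i
    then cond_kernel (pcov n \<omega> i) (v n \<omega>) (lam i (v n \<omega>)) x x' else pcov n \<omega> i x x')"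
proof (cases "a n \<omega> = i")
  case True
  have "v n \<omega> \<in> X" using decision_range[OF \<omega>] by blast
  from post_cov_snoc[OF post_rules valid_H[OF \<omega>] i x this] True show ?thesis
    by (simp only: pcov_def[abs_def] H_Suc if_True simp_thms)
next
  case False
  then show ?thesis by (simp only: pcov_def H_Suc post_cov_snoc_other[OF False] if_False)
qed

lemma m_Suc:
  assumes \<omega>: "\<omega> \<in> space P" and i: "i \<in> {1..M}" and x: "x \<in> X"
  shows "pmean (Suc n) \<omega> i x = (if a n \<omega> = i
    then pmean n \<omega> i x + pcov n \<omega> i x (v n \<omega>) * (y (Suc n) \<omega> - pmean n \<omega> i (v n \<omega>)) /
      (pcov n \<omega> i (v n \<omega>) (v n \<omega>) + lam i (v n \<omega>)) else pmean n \<omega> i x)"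
proof (cases "a n \<omega> = i")
  case True
  have "v n \<omega> \<in> X" using decision_range[OF \<omega>] by blast
  from post_mean_snoc[OF post_rules valid_H[OF \<omega>] i x this] True show ?thesis
    by (simp only: pcov_def pmean_def H_Suc if_True simp_thms)
next
  case False
  then show ?thesis by (simp only: pmean_def H_Suc post_mean_snoc_other[OF False] if_False)
qed

lemma post_var_pos': "\<omega> \<in> space P \<Longrightarrow> i \<in> {1..M} \<Longrightarrow> x \<in> X \<Longrightarrow> 0 < pcov n \<omega> i x x + lam i x"
  using post_var_pos[OF post_rules valid_H] by (simp add: pcov_def)

text \<open>Along a fixed path each update subtracts a product of sections of the old kernel through
  the sampled point, which preserves continuity. This is what later permits replacing a fixed point
  by a random one.\<close>

lemma c_cont:
  assumes "\<omega> \<in> space P" "i \<in> {1..M}"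
  shows "continuous_on (X \<times> X) (\<lambda>(x, x'). pcov n \<omega> i x x')"
proof (induction n)
  case 0
  then show ?case using k0_cont[OF assms(2)] by (simp add: c_0)
next
  case (Suc n)
  have v: "v n \<omega> \<in> X" using decision_range[OF assms(1)] by auto
  have "continuous_on (X \<times> X) (\<lambda>p. case (fst p, v n \<omega>) of (x, x') \<Rightarrow> pcov n \<omega> i x x')"
    by (rule continuous_on_compose2[OF Suc]) (use v in \<open>auto intro!: continuous_intros\<close>)
  moreover have "continuous_on (X \<times> X) (\<lambda>p. case (v n \<omega>, snd p) of (x, x') \<Rightarrow> pcov n \<omega> i x x')"
    by (rule continuous_on_compose2[OF Suc]) (use v in \<open>auto intro!: continuous_intros\<close>)
  ultimately have "continuous_on (X \<times> X) (\<lambda>p. if a n \<omega> = i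
    then cond_kernel (pcov n \<omega> i) (v n \<omega>) (lam i (v n \<omega>)) (fst p) (snd p) else pcov n \<omega> i (fst p) (snd p))"
    using Suc post_var_pos'[OF assms v, of n]
    by (cases "a n \<omega> = i") (simp_all add: cond_kernel_def case_prod_beta, intro continuous_intros, auto)
  then show ?case
    by (rule continuous_on_eq) (use c_Suc[OF assms] in auto)
qed

lemma c_cont_compose:
  assumes "\<omega> \<in> space P" "i \<in> {1..M}" "continuous_on S f" "continuous_on S g" "f ` S \<subseteq> X" "g ` S \<subseteq> X"
  shows "continuous_on S (\<lambda>z. pcov n \<omega> i (f z) (g z))"
proof -
  have "continuous_on S (\<lambda>z. case (f z, g z) of (x, x') \<Rightarrow> pcov n \<omega> i x x')"
    by (rule continuous_on_compose2[OF c_cont[OF assms(1,2)]])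
      (use assms in \<open>auto intro!: continuous_intros\<close>)
  then show ?thesis by simp
qed

lemma m_cont:
  assumes "\<omega> \<in> space P" "i \<in> {1..M}"
  shows "continuous_on X (pmean n \<omega> i)"
proof (induction n)
  case 0
  then show ?case using mu0_cont[OF assms(2)] by (simp add: m_0[abs_def])
next
  case (Suc n)
  have v: "v n \<omega> \<in> X" using decision_range[OF assms(1)] by auto
  have "continuous_on X (\<lambda>x. if a n \<omega> = i
    then pmean n \<omega> i x + pcov n \<omega> i x (v n \<omega>) * (y (Suc n) \<omega> - pmean n \<omega> i (v n \<omega>)) /
      (pcov n \<omega> i (v n \<omega>) (v n \<omega>) + lam i (v n \<omega>)) else pmean n \<omega> i x)"
    using Suc post_var_pos'[OF assms v, of n] v assms(2)
    by (cases "a n \<omega> = i")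
      (simp_all del: One_nat_def, auto intro!: continuous_intros c_cont_compose[OF assms(1)] simp del:
        One_nat_def)
  then show ?case
    by (rule continuous_on_eq) (use m_Suc[OF assms] in auto)
qed

text \<open>The update evaluates the previous posterior at the random point \<open>v n\<close>, so
  the induction has to carry joint measurability in path and point. \<open>N\<close> is left open:
  it becomes \<open>F n\<close> for adaptedness and \<open>P\<close> for Fubini.\<close>

lemma measurable_posterior:
  assumes sp: "space N = space P"
    and [measurable]: "\<And>l. l < n \<Longrightarrow> a l \<in> N \<rightarrow>\<^sub>M count_space UNIV" "\<And>l. l < n \<Longrightarrow> v l \<in> N \<rightarrow>\<^sub>M borel"
      "\<And>l. l < n \<Longrightarrow> y (Suc l) \<in> borel_measurable N"
    and i: "i \<in> {1..M}"
  shows "(\<lambda>p. pmean n (fst p) i (snd p)) \<in> borel_measurable (N \<Otimes>\<^sub>M RX) \<and>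
    (\<lambda>p. pcov n (fst p) i (fst (snd p)) (snd (snd p))) \<in> borel_measurable (N \<Otimes>\<^sub>M (RX \<Otimes>\<^sub>M RX))"
  using assms(2-4)
proof (induction n)
  case 0
  have "\<mu>0 i \<in> borel_measurable RX"
    by (rule borel_measurable_continuous_on_restrict[OF mu0_cont[OF i]])
  moreover have "(\<lambda>p. k0 i (fst p) (snd p)) \<in> borel_measurable (RX \<Otimes>\<^sub>M RX)"
  proof -
    obtain \<tau> \<rho> where \<rho>: "correlation_function \<rho>" "\<forall>x\<in>X. \<forall>x'\<in>X. k0 i x x' = \<tau>\<^sup>2 * \<rho> (x - x')"
      using kernel[OF i] by blast
    have [measurable]: "\<rho> \<in> borel_measurable borel"
      using \<rho>(1) by (auto simp: correlation_function_def intro!: borel_measurable_continuous_onI)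
    have [measurable]: "(\<lambda>x. x) \<in> RX \<rightarrow>\<^sub>M borel" by (rule measurable_restrict_space1) simp
    have "(\<lambda>p. \<tau>\<^sup>2 * \<rho> (fst p - snd p)) \<in> borel_measurable (RX \<Otimes>\<^sub>M RX)" by measurable
    then show ?thesis
      by (rule measurable_cong[THEN iffD1, rotated])
        (use \<rho>(2) in \<open>auto simp: space_pair_measure space_restrict_space\<close>)
  qed
  ultimately show ?case by (simp add: m_0 c_0)
next
  case (Suc n)
  have [measurable]: "a n \<in> N \<rightarrow>\<^sub>M count_space UNIV" "y (Suc n) \<in> borel_measurable N"
    using Suc.prems by auto
  have [measurable]: "v n \<in> N \<rightarrow>\<^sub>M RX"
    using Suc.prems(2)[of n] decision_range sp by (intro measurable_restrict_space2) auto
  have IH: "(\<lambda>p. pmean n (fst p) i (snd p)) \<in> borel_measurable (N \<Otimes>\<^sub>M RX)"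
    "(\<lambda>p. pcov n (fst p) i (fst (snd p)) (snd (snd p))) \<in> borel_measurable (N \<Otimes>\<^sub>M (RX \<Otimes>\<^sub>M RX))"
    using Suc by auto
  have mm [measurable (raw)]: "(\<lambda>p. pmean n (f p) i (g p)) \<in> borel_measurable N'"
    if "f \<in> N' \<rightarrow>\<^sub>M N" "g \<in> N' \<rightarrow>\<^sub>M RX" for f g and N' :: "'b measure"
    using measurable_compose[OF measurable_Pair[OF that] IH(1)] by simp
  have cc [measurable (raw)]: "(\<lambda>p. pcov n (f p) i (g p) (g' p)) \<in> borel_measurable N'"
    if "f \<in> N' \<rightarrow>\<^sub>M N" "g \<in> N' \<rightarrow>\<^sub>M RX" "g' \<in> N' \<rightarrow>\<^sub>M RX" for f g g' and N' :: "'b measure"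
    using measurable_compose[OF measurable_Pair[OF that(1) measurable_Pair[OF that(2,3)]] IH(2)] by simp
  have l [measurable]: "lam i \<in> borel_measurable RX"
    by (rule borel_measurable_continuous_on_restrict[OF lam_cont[OF i]])
  have "(\<lambda>p. if a n (fst p) = i
    then pmean n (fst p) i (snd p) + pcov n (fst p) i (snd p) (v n (fst p)) * (y (Suc n) (fst p) - pmean
      n (fst p) i (v n (fst p))) /
      (pcov n (fst p) i (v n (fst p)) (v n (fst p)) + lam i (v n (fst p))) else pmean n (fst p) i (snd p))
    \<in> borel_measurable (N \<Otimes>\<^sub>M RX)"
    by measurable
  then have 1: "(\<lambda>p. pmean (Suc n) (fst p) i (snd p)) \<in> borel_measurable (N \<Otimes>\<^sub>M RX)"
    by (rule measurable_cong[THEN iffD1, rotated])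
      (simp add: m_Suc[OF _ i] sp space_pair_measure space_restrict_space mem_Times_iff)
  have "(\<lambda>p. if a n (fst p) = i
    then pcov n (fst p) i (fst (snd p)) (snd (snd p)) - pcov n (fst p) i (fst (snd p)) (v n (fst p)) *
      pcov n (fst p) i (v n (fst p)) (snd (snd p)) /
      (pcov n (fst p) i (v n (fst p)) (v n (fst p))
        + lam i (v n (fst p))) else pcov n (fst p) i (fst (snd p)) (snd (snd p)))
    \<in> borel_measurable (N \<Otimes>\<^sub>M (RX \<Otimes>\<^sub>M RX))"
    by measurable
  then have 2: "(\<lambda>p. pcov (Suc n) (fst p) i (fst (snd p)) (snd (snd p)))
    \<in> borel_measurable (N \<Otimes>\<^sub>M (RX \<Otimes>\<^sub>M RX))"
    by (rule measurable_cong[THEN iffD1, rotated])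
      (simp add: c_Suc[OF _ i] cond_kernel_def sp space_pair_measure space_restrict_space mem_Times_iff)
  show ?case using 1 2 by blast
qed

section \<open>The filtration and adaptedness of the posterior\<close>

abbreviation "F n \<equiv> filtration P a v y n"

lemma space_F [simp]: "space (F n) = space P"
  by (simp add: filtration_def)

lemma measurable_F:
  assumes "l < n"
  shows "a l \<in> F n \<rightarrow>\<^sub>M count_space UNIV" "v l \<in> F n \<rightarrow>\<^sub>M borel" "y (Suc l) \<in> borel_measurable (F n)"
proof -
  have "(\<lambda>\<omega>. \<lambda>l\<in>{..<n}. (a l \<omega>, v l \<omega>, y (Suc l) \<omega>))
      \<in> F n \<rightarrow>\<^sub>M (\<Pi>\<^sub>M l\<in>{..<n}. count_space UNIV \<Otimes>\<^sub>M borel \<Otimes>\<^sub>M borel)"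
    unfolding filtration_def
    by (rule measurable_vimage_algebra1) (auto simp: space_PiM space_pair_measure)
  from measurable_compose[OF this measurable_component_singleton, of l] assms
  have *: "(\<lambda>\<omega>. (a l \<omega>, v l \<omega>, y (Suc l) \<omega>)) \<in> F n \<rightarrow>\<^sub>M (count_space UNIV \<Otimes>\<^sub>M borel \<Otimes>\<^sub>M borel)"
    by simp
  show "a l \<in> F n \<rightarrow>\<^sub>M count_space UNIV"
    using measurable_compose[OF * measurable_fst] by simp
  show "v l \<in> F n \<rightarrow>\<^sub>M borel" "y (Suc l) \<in> borel_measurable (F n)"
    using measurable_compose[OF measurable_compose[OF * measurable_snd] measurable_fst]
      measurable_compose[OF measurable_compose[OF * measurable_snd] measurable_snd] by simp_all
qed

lemma F_le:
  assumes "space N = space P"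
    and "\<And>l. l < n \<Longrightarrow> a l \<in> N \<rightarrow>\<^sub>M count_space UNIV" "\<And>l. l < n \<Longrightarrow> v l \<in> N \<rightarrow>\<^sub>M borel"
      "\<And>l. l < n \<Longrightarrow> y (Suc l) \<in> borel_measurable N"
  shows "sets (F n) \<subseteq> sets N"
  unfolding filtration_def
  by (rule sets_image_in_sets[OF assms(1)]) (use assms in \<open>auto intro!: measurable_restrict
    measurable_Pair\<close>)

text \<open>Decisions are given as measurable for \<open>F n\<close> only, and \<open>F n\<close> is
  itself generated by earlier decisions; strong induction settles both facts together.\<close>

lemma measurable_P: "a n \<in> P \<rightarrow>\<^sub>M count_space UNIV" "v n \<in> P \<rightarrow>\<^sub>M borel"
  and sets_F: "sets (F n) \<subseteq> sets P"
proof -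
  have "a n \<in> P \<rightarrow>\<^sub>M count_space UNIV \<and> v n \<in> P \<rightarrow>\<^sub>M borel \<and> sets (F n) \<subseteq> sets P"
  proof (induction n rule: less_induct)
    case (less n)
    have s: "sets (F n) \<subseteq> sets P"
      by (rule F_le) (use less outcome_measurable in auto)
    then have sub: "subalgebra P (F n)" by (simp add: subalgebra_def)
    show ?case
      using s measurable_from_subalg[OF sub decision_a] measurable_from_subalg[OF sub decision_v] by simp
  qed
  then show "a n \<in> P \<rightarrow>\<^sub>M count_space UNIV" "v n \<in> P \<rightarrow>\<^sub>M borel" "sets (F n) \<subseteq> sets P" by auto
qed

lemma subalgebra_F: "subalgebra P (F n)"
  by (simp add: subalgebra_def sets_F)

lemma F_mono:
  assumes "m \<le> n"
  shows "sets (F m) \<subseteq> sets (F n)"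
  by (rule F_le) (simp_all add: measurable_F less_le_trans[OF _ assms])

lemma measurable_m: "i \<in> {1..M} \<Longrightarrow> x \<in> X \<Longrightarrow> (\<lambda>\<omega>. pmean n \<omega> i x) \<in> borel_measurable (F n)"
  and measurable_c: "i \<in> {1..M} \<Longrightarrow> x \<in> X \<Longrightarrow> x' \<in> X \<Longrightarrow> (\<lambda>\<omega>. pcov n \<omega> i x x') \<in> borel_measurable (F n)"
  and measurable_m_v: "i \<in> {1..M} \<Longrightarrow> (\<lambda>\<omega>. pmean n \<omega> i (v n \<omega>)) \<in> borel_measurable (F n)"
  and measurable_c_v: "i \<in> {1..M} \<Longrightarrow> x \<in> X \<Longrightarrow> (\<lambda>\<omega>. pcov n \<omega> i (v n \<omega>) x) \<in> borel_measurable (F n)"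
    "i \<in> {1..M} \<Longrightarrow> (\<lambda>\<omega>. pcov n \<omega> i (v n \<omega>) (v n \<omega>)) \<in> borel_measurable (F n)"
proof -
  assume i: "i \<in> {1..M}"
  note * = measurable_posterior[OF space_F[of n] measurable_F[of _ n] i]
  have x: "(\<lambda>\<omega>. x) \<in> F n \<rightarrow>\<^sub>M RX" if "x \<in> X" for x
    using that by (simp add: space_restrict_space)
  have v: "v n \<in> F n \<rightarrow>\<^sub>M RX"
    using decision_v decision_range by (intro measurable_restrict_space2) auto
  show "(\<lambda>\<omega>. pmean n \<omega> i x) \<in> borel_measurable (F n)" if "x \<in> X"
    using measurable_compose[OF measurable_Pair[OF measurable_ident x[OF that]] conjunct1[OF *]] by simp
  show "(\<lambda>\<omega>. pmean n \<omega> i (v n \<omega>)) \<in> borel_measurable (F n)"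
    using measurable_compose[OF measurable_Pair[OF measurable_ident v] conjunct1[OF *]] by simp
  show "(\<lambda>\<omega>. pcov n \<omega> i x x') \<in> borel_measurable (F n)" if "x \<in> X" "x' \<in> X"
    using measurable_compose[OF measurable_Pair[OF measurable_ident measurable_Pair[OF x[OF that(1)]
      x[OF that(2)]]] conjunct2[OF *]] by simp
  show "(\<lambda>\<omega>. pcov n \<omega> i (v n \<omega>) x) \<in> borel_measurable (F n)" if "x \<in> X"
    using measurable_compose[OF measurable_Pair[OF measurable_ident measurable_Pair[OF v x[OF that]]]
      conjunct2[OF *]] by simp
  show "(\<lambda>\<omega>. pcov n \<omega> i (v n \<omega>) (v n \<omega>)) \<in> borel_measurable (F n)"
    using measurable_compose[OF measurable_Pair[OF measurable_ident measurable_Pair[OF v v]]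
      conjunct2[OF *]] by simp
qed

end

subsection \<open>Conditional normality under adaptive sampling\<close>

lemma (in prob_space) indep_var_of_indep_set:
  assumes ind: "indep_set (sets N1) (sets N2)" and sp: "space N1 = space M" "space N2 = space M"
    and U: "U \<in> borel_measurable N1" and W: "W \<in> borel_measurable N2"
  shows "indep_var borel (U :: 'a \<Rightarrow> real) borel (W :: 'a \<Rightarrow> real)"
proof -
  have "subalgebra M N1" "subalgebra M N2"
    using indep_setD_ev1[OF ind] indep_setD_ev2[OF ind] sp by (auto simp: subalgebra_def)
  then have "U \<in> borel_measurable M" "W \<in> borel_measurable M"
    using U W by (auto intro: measurable_from_subalg)
  moreover have "sigma_sets (space M) {U -` A \<inter> space M |A. A \<in> sets borel} \<subseteq> sets N1"
    using sets.sigma_sets_subset[of "{U -` A \<inter> space M |A. A \<in> sets borel}" N1] measurable_sets[OF U] sp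
      by auto
  moreover have "sigma_sets (space M) {W -` A \<inter> space M |A. A \<in> sets borel} \<subseteq> sets N2"
    using sets.sigma_sets_subset[of "{W -` A \<inter> space M |A. A \<in> sets borel}" N2] measurable_sets[OF W] sp
      by auto
  ultimately show ?thesis
    unfolding indep_var_eq
    using ind unfolding indep_set_def
    by (auto elim!: indep_sets_mono_sets split: bool.splits)
qed

context gp_sampling
begin

definition dev :: "nat \<Rightarrow> (real \<times> nat \<times> (real ^ 'd)) list \<Rightarrow> 'w \<Rightarrow> real" where
  "dev n L \<omega> = lc L (\<lambda>p. \<theta> (fst p) (snd p) \<omega> - pmean n \<omega> (fst p) (snd p))"

definition Kb where "Kb n \<omega> = block_kernel (pcov n \<omega>)"

text \<open>That \<open>gap\<close> integrates to zero over \<open>F n\<close> says that, given \<open>F n\<close>, the deviations of \<open>\<theta>\<close>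
  from the posterior means and the noises up to time \<open>m\<close> not yet used are jointly normal with the
  posterior covariances. Carrying the future noises along makes their independence of \<open>F n\<close> part of
  the induction.\<close>

definition gap :: "nat \<Rightarrow> nat \<Rightarrow> (real \<times> nat \<times> (real ^ 'd)) list \<Rightarrow> (nat \<Rightarrow> real) \<Rightarrow> 'w \<Rightarrow> complex" where
  "gap n m L s \<omega> = iexp (dev n L \<omega> + (\<Sum>l\<in>{n<..m}. s l * \<xi> l \<omega>))
     - exp (- (qf (Kb n \<omega>) L + (\<Sum>l\<in>{n<..m}. (s l)\<^sup>2)) / 2)"

lemma measurable_\<theta> [measurable]: "i \<in> {1..M} \<Longrightarrow> x \<in> X \<Longrightarrow> \<theta> i x \<in> borel_measurable P"
  using prior by (auto simp: gaussian_process_def)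

lemma measurable_\<xi> [measurable]: "l \<ge> 1 \<Longrightarrow> \<xi> l \<in> borel_measurable P"
  using noise_indep by (auto simp: indep_vars_def)

lemma measurable_y [measurable]: "y (Suc n) \<in> borel_measurable P"
  by (rule outcome_measurable)

lemmas measurable_post_P =
  measurable_from_subalg[OF subalgebra_F measurable_m] measurable_from_subalg[OF subalgebra_F measurable_c]
  measurable_from_subalg[OF subalgebra_F measurable_m_v] measurable_from_subalg[OF subalgebra_F
    measurable_c_v(1)]
  measurable_from_subalg[OF subalgebra_F measurable_c_v(2)]

lemma psd_Kb: "\<omega> \<in> space P \<Longrightarrow> psd_on \<I> (Kb n \<omega>)"
  unfolding \<I>_def Kb_def by (rule psd_on_block_kernel[OF psd_c])

lemma Kb_Pair [simp]: "Kb n \<omega> (i, x) p = (if i = fst p then pcov n \<omega> i x (snd p) else 0)"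
  by (simp add: Kb_def block_kernel_def)

lemma measurable_Kb:
  assumes "p \<in> \<I>" "p' \<in> \<I>"
  shows "(\<lambda>\<omega>. Kb n \<omega> p p') \<in> borel_measurable (F n)"
  using assms measurable_c[of "fst p" "snd p" "snd p'" n]
  by (cases "fst p = fst p'") (auto simp: Kb_def block_kernel_def \<I>_def)

lemma measurable_qf: "snd ` set L \<subseteq> \<I> \<Longrightarrow> (\<lambda>\<omega>. qf (Kb n \<omega>) L) \<in> borel_measurable (F n)"
  unfolding qf_def by (intro borel_measurable_lc measurable_Kb) auto

lemma measurable_dev: "snd ` set L \<subseteq> \<I> \<Longrightarrow> dev n L \<in> borel_measurable P"
  unfolding dev_def
  by (intro borel_measurable_lc borel_measurable_diff measurable_\<theta> measurable_post_P) (auto simp: \<I>_def)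

lemma measurable_noise [measurable]: "(\<lambda>\<omega>. \<Sum>l\<in>{n<..m}. s l * \<xi> l \<omega>) \<in> borel_measurable P"
  by (intro borel_measurable_sum borel_measurable_times measurable_\<xi>) auto

lemma measurable_gap:
  assumes "snd ` set L \<subseteq> \<I>"
  shows "gap n m L s \<in> borel_measurable P"
proof -
  note [measurable] = measurable_dev[OF assms] measurable_from_subalg[OF subalgebra_F measurable_qf[OF
    assms]]
  show ?thesis unfolding gap_def by measurable
qed

lemma norm_gap_le:
  assumes "snd ` set L \<subseteq> \<I>" "\<omega> \<in> space P"
  shows "norm (gap n m L s \<omega>) \<le> 2"
proof -
  have "0 \<le> qf (Kb n \<omega>) L" by (rule psd_on_nonneg[OF psd_Kb[OF assms(2)] assms(1)])
  moreover have "0 \<le> (\<Sum>l\<in>{n<..m}. (s l)\<^sup>2)" by (intro sum_nonneg) auto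
  ultimately have "norm (complex_of_real (exp (- (qf (Kb n \<omega>) L + (\<Sum>l\<in>{n<..m}. (s l)\<^sup>2)) / 2))) \<le> 1"
    by (subst norm_of_real) (simp add: divide_nonpos_pos)
  then show ?thesis
    unfolding gap_def by (intro order_trans[OF norm_triangle_ineq4]) simp
qed

lemma integrable_gap: "snd ` set L \<subseteq> \<I> \<Longrightarrow> integrable P (gap n m L s)"
  by (intro integrable_const_bound[where B = 2] measurable_gap AE_I2 norm_gap_le)

text \<open>The combination splits into one part per alternative. These parts are independent, so
  the characteristic function is a product and the exponents add up to the block form.\<close>

lemma char_prior:
  assumes L: "snd ` set L \<subseteq> \<I>"
  shows "char (distr P borel (\<lambda>\<omega>. lc L (\<lambda>p. \<theta> (fst p) (snd p) \<omega>))) t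
    = iexp (t * lc L (\<lambda>p. \<mu>0 (fst p) (snd p))) * exp (- qf (block_kernel k0) L * t\<^sup>2 / 2)"
proof -
  have L': "snd ` set L \<subseteq> {1..M} \<times> X" using L by (simp add: \<I>_def)
  have s: "snd ` set (sel j L) \<subseteq> X" for j by (rule sel_subset[OF L'])
  have "indep_vars (\<lambda>_. borel) (\<lambda>j \<omega>. lc (sel j L) (\<lambda>x\<in>X. \<theta> j x \<omega>)) {1..M}"
    by (rule indep_vars_compose2[OF prior_indep])
      (use s in \<open>auto intro!: borel_measurable_lc measurable_component_singleton\<close>)
  moreover have "lc (sel j L) (\<lambda>x\<in>X. \<theta> j x \<omega>) = lc (sel j L) (\<lambda>x. \<theta> j x \<omega>)" for j \<omega>
    using s by (intro lc_cong) auto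
  ultimately have ind: "indep_vars (\<lambda>_. borel) (\<lambda>j \<omega>. lc (sel j L) (\<lambda>x. \<theta> j x \<omega>)) {1..M}"
    by simp
  have "char (distr P borel (\<lambda>\<omega>. lc L (\<lambda>p. \<theta> (fst p) (snd p) \<omega>))) t
      = (\<Prod>j\<in>{1..M}. char (distr P borel (\<lambda>\<omega>. lc (sel j L) (\<lambda>x. \<theta> j x \<omega>))) t)"
    unfolding lc_sel[OF L'] fst_conv snd_conv by (rule char_distr_sum[OF ind])
  also have "\<dots> = (\<Prod>j\<in>{1..M}. iexp (t * lc (sel j L) (\<mu>0 j)) * exp (- qf (k0 j) (sel j L) * t\<^sup>2 / 2))"
    by (intro prod.cong refl char_gaussian_process[OF prior psd_k0 s])
  also have "\<dots> = (\<Prod>j\<in>{1..M}. iexp (t * lc (sel j L) (\<mu>0 j))) * complex_of_real (\<Prod>j\<in>{1..M}. exp (- qf (k0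
    j) (sel j L) * t\<^sup>2 / 2))"
    by (simp add: prod.distrib)
  also have "(\<Prod>j\<in>{1..M}. iexp (t * lc (sel j L) (\<mu>0 j))) = iexp (\<Sum>j\<in>{1..M}. t * lc (sel j L) (\<mu>0 j))"
    by (simp add: exp_sum sum_distrib_left)
  also have "(\<Prod>j\<in>{1..M}. exp (- qf (k0 j) (sel j L) * t\<^sup>2 / 2))
    = exp (\<Sum>j\<in>{1..M}. - qf (k0 j) (sel j L) * t\<^sup>2 / 2)"
    by (simp add: exp_sum)
  finally show ?thesis
    by (simp add: lc_sel[OF L'] qf_block_kernel[OF L'] sum_distrib_left sum_distrib_right sum_negf
      sum_divide_distrib)
qed

lemma char_noise:
  assumes "N \<subseteq> {1..}" "finite N"
  shows "char (distr P borel (\<lambda>\<omega>. \<Sum>l\<in>N. s l * \<xi> l \<omega>)) t = exp (- (\<Sum>l\<in>N. (s l)\<^sup>2) * t\<^sup>2 / 2)"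
proof -
  have "indep_vars (\<lambda>_. borel) (\<lambda>l \<omega>. s l * \<xi> l \<omega>) {1..}"
    by (rule indep_vars_compose2[OF noise_indep]) auto
  then have ind: "indep_vars (\<lambda>_. borel) (\<lambda>l \<omega>. s l * \<xi> l \<omega>) N"
    using assms(1) by (rule indep_vars_subset)
  have 1: "char (distr P borel (\<lambda>\<omega>. s l * \<xi> l \<omega>)) t = exp (- (s l)\<^sup>2 * t\<^sup>2 / 2)" if "l \<in> N" for l
  proof -
    have l: "l \<ge> 1" using that assms by auto
    note [measurable] = measurable_\<xi>[OF l]
    have "char (distr P borel (\<lambda>\<omega>. s l * \<xi> l \<omega>)) t = char (distr P borel (\<xi> l)) (s l * t)"
      unfolding char_def by (subst (1 2) integral_distr) (auto simp: mult_ac)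
    also have "\<dots> = exp (- (s l)\<^sup>2 * t\<^sup>2 / 2)"
      unfolding noise_normal[OF l] by (subst char_normal_law) (auto simp: power_mult_distrib)
    finally show ?thesis .
  qed
  have "char (distr P borel (\<lambda>\<omega>. \<Sum>l\<in>N. s l * \<xi> l \<omega>)) t = (\<Prod>l\<in>N. char (distr P borel (\<lambda>\<omega>. s l * \<xi> l \<omega>)) t)"
    by (rule char_distr_sum[OF ind])
  also have "\<dots> = (\<Prod>l\<in>N. complex_of_real (exp (- (s l)\<^sup>2 * t\<^sup>2 / 2)))"
    by (intro prod.cong refl 1)
  also have "\<dots> = complex_of_real (exp (\<Sum>l\<in>N. - (s l)\<^sup>2 * t\<^sup>2 / 2))"
    using assms(2) by (simp add: exp_sum)
  finally show ?thesis by (simp add: sum_distrib_right sum_negf sum_divide_distrib)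
qed

text \<open>Before the first sample the deviations are the centred prior values. Independence of
  prior and noises factorises the joint characteristic function, and centring removes the phase
  \<open>iexp ?c\<close>.\<close>

lemma gap_0:
  assumes L: "snd ` set L \<subseteq> \<I>" and A: "A \<in> sets (F 0)"
  shows "(LINT \<omega>:A|P. gap 0 m L s \<omega>) = 0"
proof -
  let ?U = "\<lambda>\<omega>. lc L (\<lambda>p. \<theta> (fst p) (snd p) \<omega>)" and ?W = "\<lambda>\<omega>. \<Sum>l\<in>{0<..m}. s l * \<xi> l \<omega>"
  let ?N1 = "vimage_algebra (space P) (\<lambda>\<omega>. \<lambda>p\<in>{1..M} \<times> X. \<theta> (fst p) (snd p) \<omega>) (\<Pi>\<^sub>M p\<in>{1..M} \<times> X. borel)"
  let ?N2 = "vimage_algebra (space P) (\<lambda>\<omega>. \<lambda>n\<in>{1..}. \<xi> n \<omega>) (\<Pi>\<^sub>M n\<in>{1..}. borel)"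
  have "(\<lambda>\<omega>. \<lambda>p\<in>{1..M} \<times> X. \<theta> (fst p) (snd p) \<omega>) \<in> ?N1 \<rightarrow>\<^sub>M (\<Pi>\<^sub>M p\<in>{1..M} \<times> X. borel)"
    by (rule measurable_vimage_algebra1) (auto simp: space_PiM)
  note r1 = measurable_compose[OF this measurable_component_singleton]
  have U1: "?U \<in> borel_measurable ?N1"
  proof (rule borel_measurable_lc)
    fix p assume "p \<in> snd ` set L"
    then have "p \<in> {1..M} \<times> X" using L by (auto simp: \<I>_def)
    then show "(\<lambda>\<omega>. \<theta> (fst p) (snd p) \<omega>) \<in> borel_measurable ?N1"
      using r1[of p] by simp
  qed
  have "(\<lambda>\<omega>. \<lambda>n\<in>{1..}. \<xi> n \<omega>) \<in> ?N2 \<rightarrow>\<^sub>M (\<Pi>\<^sub>M n\<in>{1..}. borel)"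
    by (rule measurable_vimage_algebra1) (auto simp: space_PiM)
  note r2 = measurable_compose[OF this measurable_component_singleton]
  have W1: "?W \<in> borel_measurable ?N2"
  proof (intro borel_measurable_sum borel_measurable_times borel_measurable_const)
    fix l assume "l \<in> {0<..m}"
    then have "l \<in> {1..}" by auto
    then show "\<xi> l \<in> borel_measurable ?N2"
      using r2[of l] by simp
  qed
  have ind: "indep_var borel ?U borel ?W"
    by (rule indep_var_of_indep_set[OF noise_indep_prior _ _ U1 W1]) auto
  have [measurable]: "?U \<in> borel_measurable P" using ind by (rule indep_var_rv1)
  let ?c = "lc L (\<lambda>p. \<mu>0 (fst p) (snd p))"
  have q: "qf (Kb 0 \<omega>) L = qf (block_kernel k0) L" for \<omega>
    by (rule qf_cong) (simp add: Kb_def block_kernel_def c_0)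
  have "(CLINT \<omega>|P. iexp (?U \<omega> + ?W \<omega>)) = char (distr P borel (\<lambda>\<omega>. ?U \<omega> + ?W \<omega>)) 1"
    unfolding char_def by (subst integral_distr) auto
  also have "\<dots> = char (distr P borel ?U) 1 * char (distr P borel ?W) 1"
    by (rule char_distr_add[OF ind])
  also have "\<dots> = iexp ?c * exp (- (qf (block_kernel k0) L + (\<Sum>l\<in>{0<..m}. (s l)\<^sup>2)) / 2)"
  proof -
    have "exp (- (q + S) / 2) = exp (- q * 1\<^sup>2 / 2) * exp (- S * 1\<^sup>2 / 2)" for q S :: real
      by (simp add: add_divide_distrib diff_divide_distrib flip: exp_add)
    then show ?thesis
      by (subst char_prior[OF L], subst char_noise) (auto simp: mult.assoc)
  qed
  finally have e: "(CLINT \<omega>|P. iexp (?U \<omega> + ?W \<omega>))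
    = iexp ?c * exp (- (qf (block_kernel k0) L + (\<Sum>l\<in>{0<..m}. (s l)\<^sup>2)) / 2)" .
  have int: "integrable P (\<lambda>\<omega>. iexp (?U \<omega> + ?W \<omega>))"
    by (intro integrable_const_bound[where B = 1]) auto
  have g: "gap 0 m L s \<omega> = iexp (- ?c) * iexp (?U \<omega> + ?W \<omega>)
      - exp (- (qf (block_kernel k0) L + (\<Sum>l\<in>{0<..m}. (s l)\<^sup>2)) / 2)" for \<omega>
    by (simp add: gap_def q dev_def m_0 lc_diff algebra_simps flip: exp_add)
  have "(LINT \<omega>|P. gap 0 m L s \<omega>) = iexp (- ?c) * (CLINT \<omega>|P. iexp (?U \<omega> + ?W \<omega>))
      - exp (- (qf (block_kernel k0) L + (\<Sum>l\<in>{0<..m}. (s l)\<^sup>2)) / 2)"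
    unfolding g using int by (subst Bochner_Integration.integral_diff) (auto simp: prob_space)
  also have "\<dots> = 0" unfolding e mult.assoc[symmetric] by (simp flip: exp_add)
  finally have z: "(LINT \<omega>|P. gap 0 m L s \<omega>) = 0" .
  \<comment> \<open>\<open>F 0\<close> is generated by a map into a one-point space, so its only
    sets are the empty set and the whole space.\<close>
  let ?f = "\<lambda>\<omega>. \<lambda>l\<in>{..<0}. (a l \<omega>, v l \<omega>, y (Suc l) \<omega>)"
    and ?PM = "\<Pi>\<^sub>M l\<in>{..<0::nat}. (count_space UNIV \<Otimes>\<^sub>M borel \<Otimes>\<^sub>M borel) :: (nat \<times> (real ^ 'd) \<times> real)
      measure"
  have "?f \<in> space P \<rightarrow> space ?PM" by (auto simp: space_PiM space_pair_measure)
  then obtain B where B: "A = ?f -` B \<inter> space P" "B \<in> sets ?PM"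
    using A unfolding filtration_def by (subst (asm) sets_vimage_algebra2) auto
  then have "B = {} \<or> B = {\<lambda>_. undefined}" by (simp add: sets_PiM_empty)
  then have "A = {} \<or> A = space P" unfolding B(1) by (auto simp: fun_eq_iff restrict_def)
  then show ?thesis
  proof
    assume "A = space P"
    then show ?thesis using z by (simp add: set_integral_space[OF integrable_gap[OF L]])
  qed (simp add: set_lebesgue_integral_def)
qed

text \<open>The outcome \<open>y (Suc n)\<close> is itself one of the functionals that \<open>gap n\<close> speaks about.\<close>

lemma gap_observe:
  assumes \<omega>: "\<omega> \<in> space P" and a: "a n \<omega> = i" and L: "snd ` set L \<subseteq> \<I>" and m: "Suc n \<le> m"
  shows "gap n m ((t, i, v n \<omega>) # L) (s(Suc n := t * sqrt (lam i (v n \<omega>)))) \<omega>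
    = iexp (t * (y (Suc n) \<omega> - pmean n \<omega> i (v n \<omega>)) + dev n L \<omega> + (\<Sum>l\<in>{Suc n<..m}. s l * \<xi> l \<omega>))
     - exp (- (t\<^sup>2 * (pcov n \<omega> i (v n \<omega>) (v n \<omega>) + lam i (v n \<omega>)) + 2 * t * lc L (Kb n \<omega> (i, v n \<omega>))
        + qf (Kb n \<omega>) L + (\<Sum>l\<in>{Suc n<..m}. (s l)\<^sup>2)) / 2)"
proof -
  have iv: "i \<in> {1..M}" "v n \<omega> \<in> X" using decision_range[OF \<omega>, of n] a by auto
  have eq: "{n<..m} = insert (Suc n) {Suc n<..m}" using m by auto
  let ?s = "s(Suc n := t * sqrt (lam i (v n \<omega>)))"
  have s1: "(\<Sum>l\<in>{n<..m}. ?s l * \<xi> l \<omega>) = t * sqrt (lam i (v n \<omega>)) * \<xi> (Suc n) \<omega>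
    + (\<Sum>l\<in>{Suc n<..m}. s l * \<xi> l \<omega>)"
    unfolding eq by (subst sum.insert) (auto intro!: sum.cong)
  have s2: "(\<Sum>l\<in>{n<..m}. (?s l)\<^sup>2) = t\<^sup>2 * lam i (v n \<omega>) + (\<Sum>l\<in>{Suc n<..m}. (s l)\<^sup>2)"
    unfolding eq using lam_pos[OF iv(1)] iv(2)
    by (subst sum.insert) (auto intro!: sum.cong simp: power_mult_distrib less_imp_le)
  have q: "qf (Kb n \<omega>) ((t, i, v n \<omega>) # L) = t\<^sup>2 * pcov n \<omega> i (v n \<omega>) (v n \<omega>)
      + 2 * t * lc L (Kb n \<omega> (i, v n \<omega>)) + qf (Kb n \<omega>) L"
    using qf_Cons[OF psd_Kb[OF \<omega>] _ L, of "(i, v n \<omega>)" n t] iv by (simp add: \<I>_def)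
  \<comment> \<open>The noise with weight \<open>t * sqrt (lam i (v n \<omega>))\<close> completes
    the value of \<open>\<theta>\<close> at the sampled point to the outcome.\<close>
  have d: "dev n ((t, i, v n \<omega>) # L) \<omega> + (t * sqrt (lam i (v n \<omega>)) * \<xi> (Suc n) \<omega> + S)
      = t * (y (Suc n) \<omega> - pmean n \<omega> i (v n \<omega>)) + dev n L \<omega> + S" for S
    using outcome[OF \<omega>, of n] a by (simp add: dev_def algebra_simps)
  show ?thesis
    unfolding gap_def s1 s2 q d by (simp add: algebra_simps)
qed

text \<open>Every posterior mean moves by its covariance with the sampled value times the innovation
  over the predictive variance. For the other alternatives that covariance is the zero block of
  \<open>Kb\<close>, so they need no separate formula.\<close>

lemma dev_Suc:
  assumes \<omega>: "\<omega> \<in> space P" and a: "a n \<omega> = i" and L: "snd ` set L \<subseteq> \<I>"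
  shows "dev (Suc n) L \<omega> = dev n L \<omega> - lc L (Kb n \<omega> (i, v n \<omega>)) /
    (pcov n \<omega> i (v n \<omega>) (v n \<omega>) + lam i (v n \<omega>)) * (y (Suc n) \<omega> - pmean n \<omega> i (v n \<omega>))"
proof -
  let ?w = "v n \<omega>"
  let ?k = "pcov n \<omega> i ?w ?w + lam i ?w" and ?z = "y (Suc n) \<omega> - pmean n \<omega> i ?w"
  have iv: "(i, ?w) \<in> \<I>" using decision_range[OF \<omega>, of n] a by (auto simp: \<I>_def)
  have "dev (Suc n) L \<omega> = lc L (\<lambda>p. (\<theta> (fst p) (snd p) \<omega> - pmean n \<omega> (fst p) (snd p)) - ?z / ?k * Kb n \<omega>
    (i, ?w) p)"
    unfolding dev_def
  proof (rule lc_cong)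
    fix p assume "p \<in> snd ` set L"
    then have p: "p \<in> \<I>" using L by auto
    show "\<theta> (fst p) (snd p) \<omega> - pmean (Suc n) \<omega> (fst p) (snd p)
      = \<theta> (fst p) (snd p) \<omega> - pmean n \<omega> (fst p) (snd p) - ?z / ?k * Kb n \<omega> (i, ?w) p"
      using p iv a m_Suc[OF \<omega>, of "fst p" "snd p" n] psd_on_sym[OF psd_c[OF \<omega>, of i n], of ?w "snd p"]
      by (cases p) (auto simp: \<I>_def)
  qed
  then show ?thesis unfolding lc_diff lc_cmult dev_def by (simp add: mult.commute del: Kb_Pair)
qed

text \<open>On the joint index set a sample is one conditioning of the whole block kernel at the
  pair \<open>(i, v n \<omega>)\<close>; the zero blocks remain zero.\<close>

lemma qf_Suc:
  assumes \<omega>: "\<omega> \<in> space P" and a: "a n \<omega> = i" and L: "snd ` set L \<subseteq> \<I>"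
  shows "qf (Kb (Suc n) \<omega>) L = qf (Kb n \<omega>) L - (lc L (Kb n \<omega> (i, v n \<omega>)))\<^sup>2 /
    (pcov n \<omega> i (v n \<omega>) (v n \<omega>) + lam i (v n \<omega>))"
proof -
  let ?w = "v n \<omega>"
  have iv: "(i, ?w) \<in> \<I>" using decision_range[OF \<omega>, of n] a by (auto simp: \<I>_def)
  have "qf (Kb (Suc n) \<omega>) L = qf (cond_kernel (Kb n \<omega>) (i, ?w) (lam i ?w)) L"
  proof (rule qf_cong)
    fix p p' assume "p \<in> snd ` set L" "p' \<in> snd ` set L"
    then have p: "p \<in> \<I>" "p' \<in> \<I>" using L by auto
    obtain j x j' x' where pp: "p = (j, x)" "p' = (j', x')" by (cases p, cases p') auto
    show "Kb (Suc n) \<omega> p p' = cond_kernel (Kb n \<omega>) (i, ?w) (lam i ?w) p p'"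
      using p iv a c_Suc[OF \<omega>, of j x x' n] unfolding pp
      by (cases "j = j'"; cases "j = i") (auto simp: \<I>_def cond_kernel_def)
  qed
  then show ?thesis using qf_cond_kernel[OF psd_Kb[OF \<omega>] iv L] by simp
qed

lemma measurable_lc_Kb:
  assumes i: "i \<in> {1..M}" and L: "snd ` set L \<subseteq> \<I>"
  shows "(\<lambda>\<omega>. lc L (Kb n \<omega> (i, v n \<omega>))) \<in> borel_measurable (F n)"
proof (rule borel_measurable_lc)
  fix p assume "p \<in> snd ` set L"
  then have "snd p \<in> X" using L by (auto simp: \<I>_def)
  then show "(\<lambda>\<omega>. Kb n \<omega> (i, v n \<omega>) p) \<in> borel_measurable (F n)"
    using measurable_c_v(1)[OF i, of "snd p" n] by (cases "i = fst p") auto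
qed

lemma measurable_lam_v:
  assumes i: "i \<in> {1..M}"
  shows "(\<lambda>\<omega>. lam i (v n \<omega>)) \<in> borel_measurable (F n)"
proof -
  have "v n \<in> F n \<rightarrow>\<^sub>M RX"
    using decision_v decision_range by (intro measurable_restrict_space2) auto
  from measurable_compose[OF this borel_measurable_continuous_on_restrict[OF lam_cont[OF i]]]
  show ?thesis .
qed

text \<open>Passes from fixed data to data selected by the past. The factor \<open>U\<close>, the
  weight \<open>T\<close> and the point \<open>v n\<close> are all \<open>F n\<close>-measurable and
  together form the random parameter of \<open>set_integral_zero_substitute\<close>.\<close>

lemma gap_substitute:
  assumes IH: "\<And>L s A. snd ` set L \<subseteq> \<I> \<Longrightarrow> A \<in> sets (F n) \<Longrightarrow> (LINT \<omega>:A|P. gap n m L s \<omega>) = 0"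
    and m: "Suc n \<le> m" and L: "snd ` set L \<subseteq> \<I>" and i: "i \<in> {1..M}"
    and A: "A \<in> sets (F n)" "A \<subseteq> {\<omega> \<in> space P. a n \<omega> = i}"
    and U: "U \<in> borel_measurable (F n)" "\<And>\<omega>. \<omega> \<in> space P \<Longrightarrow> norm (U \<omega>) \<le> 1"
    and T: "T \<in> borel_measurable (F n)"
  shows "(LINT \<omega>:A|P. U \<omega> * gap n m ((T \<omega>, i, v n \<omega>) # L) (s(Suc n := T \<omega> * sqrt (lam i (v n \<omega>)))) \<omega>) = 0"
proof -
  \<comment> \<open>The first component is bounded to give a dominating constant. The weight may
    range over all reals since the norm of \<open>gap\<close> is at most 2 regardless of it.\<close>
  define S where "S = {z :: complex \<times> real \<times> (real ^ 'd). norm (fst z) \<le> 1 \<and> snd (snd z) \<in> X}"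
  define h where "h z \<omega> = fst z * gap n m ((fst (snd z), i, snd (snd z)) # L)
      (s(Suc n := fst (snd z) * sqrt (lam i (snd (snd z))))) \<omega>" for z :: "complex \<times> real \<times> (real ^ 'd)"
        and \<omega>
  have sub: "snd ` set ((fst (snd z), i, snd (snd z)) # L) \<subseteq> \<I>" if "z \<in> S" for z
    using L i that by (auto simp: S_def \<I>_def)
  have vF: "v n \<in> borel_measurable (F n)" using decision_v .
  have AP: "A \<in> sets P" using A(1) sets_F by blast
  have "(LINT \<omega>:A|P. h (U \<omega>, T \<omega>, v n \<omega>) \<omega>) = 0"
  proof (rule set_integral_zero_substitute[OF subalgebra_F[of n],
        where h = h and Z = "\<lambda>\<omega>. (U \<omega>, T \<omega>, v n \<omega>)" and S = S and B = 2])
    show "(\<lambda>\<omega>. (U \<omega>, T \<omega>, v n \<omega>)) \<in> borel_measurable (F n)"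
      using U(1) T vF by measurable
    show "(U \<omega>, T \<omega>, v n \<omega>) \<in> S" if "\<omega> \<in> space P" for \<omega>
      using U(2)[OF that] decision_range[OF that] by (auto simp: S_def)
    show "h z \<in> borel_measurable P" if "z \<in> S" for z
      unfolding h_def by (intro borel_measurable_times borel_measurable_const measurable_gap sub that)
    show "norm (h z \<omega>) \<le> 2" if "z \<in> S" "\<omega> \<in> space P" for z \<omega>
      using norm_gap_le[OF sub[OF that(1)] that(2)] that(1) mult_mono[of "norm (fst z)" 1 _ 2]
      unfolding h_def S_def by (force simp: norm_mult)
    show "(LINT \<omega>:B|P. h z \<omega>) = 0" if "z \<in> S" "B \<in> sets (F n)" for z B
      unfolding h_def using IH[OF sub[OF that(1)] that(2)] by simp
    show "AE \<omega> in P. continuous_on S (\<lambda>z. h z \<omega>)"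
      using prior_paths[OF i] AE_space
    proof eventually_elim
      case (elim \<omega>)
      let ?t = "\<lambda>z :: complex \<times> real \<times> (real ^ 'd). fst (snd z)" and ?x
        = "\<lambda>z :: complex \<times> real \<times> (real ^ 'd). snd (snd z)"
      have x: "continuous_on S ?x" "?x ` S \<subseteq> X" by (auto simp: S_def intro!: continuous_intros)
      have c1: "continuous_on S (\<lambda>z. \<theta> i (?x z) \<omega>)"
        using continuous_on_compose2[OF elim(1) x] by simp
      have c2: "continuous_on S (\<lambda>z. pmean n \<omega> i (?x z))"
        using continuous_on_compose2[OF m_cont[OF elim(2) i] x] by simp
      have c3: "continuous_on S (\<lambda>z. lam i (?x z))"
        using continuous_on_compose2[OF lam_cont[OF i] x] by simp
      have c4: "continuous_on S (\<lambda>z. pcov n \<omega> i (?x z) (?x z))"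
        by (rule c_cont_compose[OF elim(2) i x(1) x(1) x(2) x(2)])
      have c5: "continuous_on S (\<lambda>z. lc L (Kb n \<omega> (i, ?x z)))"
      proof (rule continuous_on_lc)
        fix p assume "p \<in> snd ` set L"
        then have "snd p \<in> X" using L by (auto simp: \<I>_def)
        then show "continuous_on S (\<lambda>z. Kb n \<omega> (i, ?x z) p)"
          using c_cont_compose[OF elim(2) i x(1) continuous_on_const x(2), of "snd p" n]
          by (cases "i = fst p") auto
      qed
      have eq: "{n<..m} = insert (Suc n) {Suc n<..m}" using m by auto
      have s1: "(\<Sum>l\<in>{n<..m}. (s(Suc n := r)) l * \<xi> l \<omega>)
        = r * \<xi> (Suc n) \<omega> + (\<Sum>l\<in>{Suc n<..m}. s l * \<xi> l \<omega>)" for r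
        unfolding eq by (subst sum.insert) (auto intro!: sum.cong)
      have s2: "(\<Sum>l\<in>{n<..m}. ((s(Suc n := r)) l)\<^sup>2) = r\<^sup>2 + (\<Sum>l\<in>{Suc n<..m}. (s l)\<^sup>2)" for r
        unfolding eq by (subst sum.insert) (auto intro!: sum.cong)
      have q: "qf (Kb n \<omega>) ((?t z, i, ?x z) # L) = (?t z)\<^sup>2 * pcov n \<omega> i (?x z) (?x z)
          + 2 * ?t z * lc L (Kb n \<omega> (i, ?x z)) + qf (Kb n \<omega>) L" if "z \<in> S" for z
        using qf_Cons[OF psd_Kb[OF elim(2)] _ L, of "(i, ?x z)" n "?t z"] i that by (simp add: \<I>_def S_def)
      have d: "dev n ((?t z, i, ?x z) # L) \<omega> = ?t z * (\<theta> i (?x z) \<omega> - pmean n \<omega> i (?x z)) + dev n L \<omega>" for z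
        by (simp add: dev_def)
      have "continuous_on S (\<lambda>z. fst z * (iexp (?t z * (\<theta> i (?x z) \<omega> - pmean n \<omega> i (?x z)) + dev n L \<omega>
           + (?t z * sqrt (lam i (?x z)) * \<xi> (Suc n) \<omega> + (\<Sum>l\<in>{Suc n<..m}. s l * \<xi> l \<omega>)))
         - exp (- ((?t z)\<^sup>2 * pcov n \<omega> i (?x z) (?x z) + 2 * ?t z * lc L (Kb n \<omega> (i, ?x z)) + qf (Kb n \<omega>) L
          + ((?t z * sqrt (lam i (?x z)))\<^sup>2 + (\<Sum>l\<in>{Suc n<..m}. (s l)\<^sup>2))) / 2)))"
        by (intro continuous_intros c1 c2 c3 c4 c5) auto
      then show ?case
        by (rule continuous_on_eq) (simp only: h_def gap_def s1 s2 q d)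
    qed
    \<comment> \<open>On \<open>A\<close> the substituted integrand can be written with the outcome
      \<open>y (Suc n)\<close> in place of \<open>\<theta>\<close> at a random point. Measurability
      is read off from this form.\<close>
    let ?g = "\<lambda>\<omega>. U \<omega> * (iexp (T \<omega> * (y (Suc n) \<omega> - pmean n \<omega> i (v n \<omega>)) + dev n L \<omega>
      + (\<Sum>l\<in>{Suc n<..m}. s l * \<xi> l \<omega>))
     - exp (- ((T \<omega>)\<^sup>2 * (pcov n \<omega> i (v n \<omega>) (v n \<omega>) + lam i (v n \<omega>)) + 2 * T \<omega> * lc L (Kb n \<omega> (i, v n \<omega>))
        + qf (Kb n \<omega>) L + (\<Sum>l\<in>{Suc n<..m}. (s l)\<^sup>2)) / 2))"
    note [measurable] = measurable_from_subalg[OF subalgebra_F U(1)] measurable_from_subalg[OF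
      subalgebra_F T]
      measurable_post_P(3)[OF i] measurable_post_P(5)[OF i] measurable_dev[OF L]
      measurable_from_subalg[OF subalgebra_F measurable_qf[OF L]]
      measurable_from_subalg[OF subalgebra_F measurable_lam_v[OF i]]
      measurable_from_subalg[OF subalgebra_F measurable_lc_Kb[OF i L]] AP
    have "(\<lambda>\<omega>. indicat_real A \<omega> *\<^sub>R ?g \<omega>) \<in> borel_measurable P"
      by measurable
    then show "(\<lambda>\<omega>. indicat_real A \<omega> *\<^sub>R h (U \<omega>, T \<omega>, v n \<omega>) \<omega>) \<in> borel_measurable P"
      by (rule measurable_cong[THEN iffD1, rotated])
        (use A(2) in \<open>auto simp: h_def indicator_def gap_observe[OF _ _ L m]\<close>)
  qed (rule A(1))
  then show ?thesis by (simp add: h_def)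
qed

text \<open>Multiplied by the exponential of the outcome, the gap at time \<open>Suc n\<close> is a
  substituted gap at time \<open>n\<close> minus a remainder \<open>R\<close>. The remainder is
  itself a substituted gap, with empty list, so both integrate to 0.\<close>

lemma gap_Suc_fourier:
  assumes IH: "\<And>L s A. snd ` set L \<subseteq> \<I> \<Longrightarrow> A \<in> sets (F n) \<Longrightarrow> (LINT \<omega>:A|P. gap n m L s \<omega>) = 0"
    and m: "Suc n \<le> m" and L: "snd ` set L \<subseteq> \<I>" and i: "i \<in> {1..M}"
    and A: "A \<in> sets (F n)" "A \<subseteq> {\<omega> \<in> space P. a n \<omega> = i}"
  shows "(LINT \<omega>:A|P. iexp (r * y (Suc n) \<omega>) * gap (Suc n) m L s \<omega>) = 0"
proof -
  define \<kappa> where "\<kappa> \<omega> = pcov n \<omega> i (v n \<omega>) (v n \<omega>) + lam i (v n \<omega>)" for \<omega>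
  define l where "l \<omega> = lc L (Kb n \<omega> (i, v n \<omega>))" for \<omega>
  define q where "q \<omega> = qf (Kb n \<omega>) L - (l \<omega>)\<^sup>2 / \<kappa> \<omega> + (\<Sum>l\<in>{Suc n<..m}. (s l)\<^sup>2)" for \<omega>
  \<comment> \<open>Total weight of the innovation: \<open>r\<close> from the exponential of the
    outcome, \<open>- l / \<kappa>\<close> from the move of the posterior means.\<close>
  define T where "T \<omega> = r - l \<omega> / \<kappa> \<omega>" for \<omega>
  define U1 where "U1 \<omega> = iexp (r * pmean n \<omega> i (v n \<omega>))" for \<omega>
  define U2 where "U2 \<omega> = U1 \<omega> * exp (- q \<omega> / 2)" for \<omega>
  note [measurable] = measurable_m_v[OF i, of n] measurable_c_v(2)[OF i, of n]
    measurable_lc_Kb[OF i L, of n] measurable_lam_v[OF i, of n] measurable_qf[OF L, of n]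
  have meas: "T \<in> borel_measurable (F n)" "U1 \<in> borel_measurable (F n)" "U2 \<in> borel_measurable (F n)"
    unfolding T_def U2_def q_def U1_def l_def \<kappa>_def by measurable
  have kpos: "0 < \<kappa> \<omega>" if "\<omega> \<in> space P" for \<omega>
    using post_var_pos'[OF that i] decision_range[OF that] unfolding \<kappa>_def by blast
  have q0: "0 \<le> q \<omega>" if w: "\<omega> \<in> space P" for \<omega>
  proof -
    have iv: "(i, v n \<omega>) \<in> \<I>" using i decision_range[OF w] by (auto simp: \<I>_def)
    have "(l \<omega>)\<^sup>2 \<le> qf (Kb n \<omega>) L * pcov n \<omega> i (v n \<omega>) (v n \<omega>)"
      using psd_on_cauchy_schwarz[OF psd_Kb[OF w] iv L, of n] unfolding l_def by simp
    also have "\<dots> \<le> qf (Kb n \<omega>) L * \<kappa> \<omega>"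
      using lam_pos[OF i] iv psd_on_nonneg[OF psd_Kb[OF w] L, of n]
      by (intro mult_left_mono) (auto simp: \<kappa>_def \<I>_def less_imp_le)
    finally have "(l \<omega>)\<^sup>2 / \<kappa> \<omega> \<le> qf (Kb n \<omega>) L" using kpos[OF w] by (simp add: field_simps)
    then show ?thesis unfolding q_def by (simp add: sum_nonneg)
  qed
  have bound: "norm (U1 \<omega>) \<le> 1" "norm (U2 \<omega>) \<le> 1" if "\<omega> \<in> space P" for \<omega>
    using q0[OF that] by (simp_all add: U1_def U2_def norm_mult)
  define R where "R \<omega> = U2 \<omega> * (iexp (r * (y (Suc n) \<omega> - pmean n \<omega> i (v n \<omega>))) - exp (- (r\<^sup>2 * \<kappa> \<omega>) /
    2))" for \<omega>
  have Rm: "R \<in> borel_measurable P"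
  proof -
    note [measurable] = measurable_from_subalg[OF subalgebra_F meas(3)] measurable_post_P(3)[OF i]
      measurable_post_P(5)[OF i]
      measurable_from_subalg[OF subalgebra_F measurable_lam_v[OF i]]
    show ?thesis unfolding R_def \<kappa>_def by measurable
  qed
  have Rb: "norm (R \<omega>) \<le> 2" if w: "\<omega> \<in> space P" for \<omega>
  proof -
    have "norm (complex_of_real (exp (- (r\<^sup>2 * \<kappa> \<omega>) / 2))) \<le> 1"
      using kpos[OF w] by (subst norm_of_real) (simp add: divide_nonpos_pos)
    then have "norm (iexp (r * (y (Suc n) \<omega> - pmean n \<omega> i (v n \<omega>))) - exp (- (r\<^sup>2 * \<kappa> \<omega>) / 2)) \<le> 2"
      by (intro order_trans[OF norm_triangle_ineq4]) simp
    then show ?thesis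
      unfolding R_def norm_mult using mult_mono[OF bound(2)[OF w]] by force
  qed
  have AP: "A \<in> sets P" using A(1) sets_F by blast
  have setint: "set_integrable P A f" if "f \<in> borel_measurable P" "\<And>\<omega>. \<omega> \<in> space P \<Longrightarrow> norm (f \<omega>) \<le> 2"
    for f :: "'w \<Rightarrow> complex"
    unfolding set_integrable_def
    by (intro integrable_mult_indicator AP integrable_const_bound[where B = 2] AE_I2 that)
  have Gm: "(\<lambda>\<omega>. iexp (r * y (Suc n) \<omega>) * gap (Suc n) m L s \<omega>) \<in> borel_measurable P"
    using measurable_gap[OF L, of "Suc n" m s] by measurable
  have "(LINT \<omega>:A|P. R \<omega>) = (LINT \<omega>:A|P. U2 \<omega> * gap n m ((r, i, v n \<omega>) # []) ((\<lambda>_. 0)(Suc n := r * sqrt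
    (lam i (v n \<omega>)))) \<omega>)"
    by (intro set_lebesgue_integral_cong[OF AP] allI impI)
      (use A(2) m in \<open>auto simp: R_def \<kappa>_def dev_def qf_def gap_observe[where L = "[]" and s = "\<lambda>_. 0"]\<close>)
  also have "\<dots> = 0"
    by (rule gap_substitute[OF IH m _ i A meas(3) bound(2)]) auto
  finally have R0: "(LINT \<omega>:A|P. R \<omega>) = 0" .
  have "(LINT \<omega>:A|P. iexp (r * y (Suc n) \<omega>) * gap (Suc n) m L s \<omega>) + (LINT \<omega>:A|P. R \<omega>)
    = (LINT \<omega>:A|P. iexp (r * y (Suc n) \<omega>) * gap (Suc n) m L s \<omega> + R \<omega>)"
    by (rule set_integral_add(2)[symmetric, OF setint[OF Gm] setint[OF Rm Rb]])
      (use norm_gap_le[OF L] in \<open>auto simp: norm_mult\<close>)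
  also have "\<dots> = (LINT \<omega>:A|P. U1 \<omega> * gap n m ((T \<omega>, i, v n \<omega>) # L) (s(Suc n := T \<omega> * sqrt (lam i (v n
    \<omega>)))) \<omega>)"
  proof (intro set_lebesgue_integral_cong[OF AP] allI impI)
    fix \<omega> assume "\<omega> \<in> A"
    then have w: "\<omega> \<in> space P" "a n \<omega> = i" using A(2) by auto
    define z where "z = y (Suc n) \<omega> - pmean n \<omega> i (v n \<omega>)"
    define N where "N = (\<Sum>l\<in>{Suc n<..m}. s l * \<xi> l \<omega>)"
    define Q where "Q = (\<Sum>l\<in>{Suc n<..m}. (s l)\<^sup>2)"
    have k: "\<kappa> \<omega> \<noteq> 0" using kpos[OF w(1)] by simp
    have e1: "iexp (r * y (Suc n) \<omega>) = U1 \<omega> * iexp (r * z)"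
      by (simp add: U1_def z_def algebra_simps flip: exp_add)
    have g: "gap (Suc n) m L s \<omega> = iexp (dev n L \<omega> - l \<omega> / \<kappa> \<omega> * z + N) - exp (- q \<omega> / 2)"
      unfolding gap_def dev_Suc[OF w L] qf_Suc[OF w L] q_def by (simp add: l_def \<kappa>_def z_def N_def)
    have e2: "iexp (r * z) * iexp (dev n L \<omega> - l \<omega> / \<kappa> \<omega> * z + N) = iexp (T \<omega> * z + dev n L \<omega> + N)"
      by (simp add: T_def algebra_simps flip: exp_add)
    \<comment> \<open>Completing the square. The terms mixed in \<open>r\<close> and
      \<open>l\<close> cancel, which reflects that the innovation is uncorrelated with the updated
      deviations.\<close>
    have "(T \<omega>)\<^sup>2 * \<kappa> \<omega> + 2 * T \<omega> * l \<omega> + qf (Kb n \<omega>) L + Q = r\<^sup>2 * \<kappa> \<omega> + q \<omega>"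
      unfolding T_def q_def Q_def using k by (simp add: field_simps power2_eq_square)
    then have e3: "exp (- ((T \<omega>)\<^sup>2 * \<kappa> \<omega> + 2 * T \<omega> * l \<omega> + qf (Kb n \<omega>) L + Q) / 2)
        = exp (- (r\<^sup>2 * \<kappa> \<omega>) / 2) * exp (- q \<omega> / 2)"
      by (simp add: add_divide_distrib diff_divide_distrib flip: exp_add)
    have "U1 \<omega> * gap n m ((T \<omega>, i, v n \<omega>) # L) (s(Suc n := T \<omega> * sqrt (lam i (v n \<omega>)))) \<omega>
      = U1 \<omega> * (iexp (T \<omega> * z + dev n L \<omega> + N)
        - exp (- ((T \<omega>)\<^sup>2 * \<kappa> \<omega> + 2 * T \<omega> * l \<omega> + qf (Kb n \<omega>) L + Q) / 2))"
      unfolding gap_observe[OF w L m] by (simp only: z_def N_def Q_def l_def \<kappa>_def)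
    also have "\<dots> = U1 \<omega> * iexp (r * z) * (iexp (dev n L \<omega> - l \<omega> / \<kappa> \<omega> * z + N) - exp (- q \<omega> / 2))
        + U1 \<omega> * exp (- q \<omega> / 2) * (iexp (r * z) - exp (- (r\<^sup>2 * \<kappa> \<omega>) / 2))"
      unfolding e3 e2[symmetric] by (simp add: algebra_simps)
    also have "\<dots> = iexp (r * y (Suc n) \<omega>) * gap (Suc n) m L s \<omega> + R \<omega>"
      unfolding e1 g R_def U2_def z_def by simp
    finally show "iexp (r * y (Suc n) \<omega>) * gap (Suc n) m L s \<omega> + R \<omega>
      = U1 \<omega> * gap n m ((T \<omega>, i, v n \<omega>) # L) (s(Suc n := T \<omega> * sqrt (lam i (v n \<omega>)))) \<omega>" ..
  qed
  also have "\<dots> = 0"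
    by (rule gap_substitute[OF IH m L i A meas(2) bound(1) meas(1)]) auto
  finally show ?thesis using R0 by simp
qed

text \<open>The decision of time \<open>n\<close> is already \<open>F n\<close>-measurable, so
  \<open>F (Suc n)\<close> adds only the outcome. It is contained in the sigma-algebra generated by
  the intersection-stable sets \<open>?E\<close>, and on these the claim follows from the Fourier
  identity, applied after splitting by the sampled alternative.\<close>

lemma gap_integral_zero:
  assumes "n \<le> m" "snd ` set L \<subseteq> \<I>" "A \<in> sets (F n)"
  shows "(LINT \<omega>:A|P. gap n m L s \<omega>) = 0"
  using assms
proof (induction n arbitrary: L s A)
  case 0
  then show ?case using gap_0 by blast
next
  case (Suc n)
  have IH: "(LINT \<omega>:A|P. gap n m L s \<omega>) = 0" if "snd ` set L \<subseteq> \<I>" "A \<in> sets (F n)" for L s A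
    using Suc that by auto
  note L = Suc.prems(2)
  let ?g = "gap (Suc n) m L s"
  have [measurable]: "?g \<in> borel_measurable P" by (rule measurable_gap[OF L])
  let ?E = "{A \<inter> {\<omega> \<in> space P. y (Suc n) \<omega> \<in> D} |A D. A \<in> sets (F n) \<and> D \<in> sets borel}"
  have "{\<omega> \<in> space P. y (Suc n) \<omega> \<in> D} \<in> sets P" if "D \<in> sets borel" for D
    using measurable_sets[OF measurable_y that] by (simp add: vimage_def Int_def conj_commute)
  then have EP: "?E \<subseteq> sets P"
    using sets_F[of n] by auto
  have stable: "Int_stable ?E"
  proof (rule Int_stableI)
    fix B C assume "B \<in> ?E" "C \<in> ?E"
    then obtain A D A' D' where
      "B = A \<inter> {\<omega> \<in> space P. y (Suc n) \<omega> \<in> D}" "A \<in> sets (F n)" "D \<in> sets borel"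
      "C = A' \<inter> {\<omega> \<in> space P. y (Suc n) \<omega> \<in> D'}" "A' \<in> sets (F n)" "D' \<in> sets borel" by auto
    then have "B \<inter> C = (A \<inter> A') \<inter> {\<omega> \<in> space P. y (Suc n) \<omega> \<in> D \<inter> D'}" "A \<inter> A' \<in> sets (F n)" "D \<inter> D'
      \<in> sets borel"
      by auto
    then show "B \<inter> C \<in> ?E" by blast
  qed
  have 0: "(LINT \<omega>:B|P. ?g \<omega>) = 0" if B: "B \<in> ?E" for B
  proof -
    obtain A D where B': "B = A \<inter> {\<omega> \<in> space P. y (Suc n) \<omega> \<in> D}" and A: "A \<in> sets (F n)" and D: "D
      \<in> sets borel"
      using B by auto
    have AP [measurable]: "A \<in> sets P" using A sets_F by blast
    have 1: "(LINT \<omega>:A|P. iexp (r * y (Suc n) \<omega>) * ?g \<omega>) = 0" for r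
    proof (rule set_integral_zero_split[OF subalgebra_F decision_a A])
      show "set_integrable P A (\<lambda>\<omega>. iexp (r * y (Suc n) \<omega>) * ?g \<omega>)"
        unfolding set_integrable_def
        by (intro integrable_mult_indicator integrable_const_bound[where B = 2] AE_I2)
          (use norm_gap_le[OF L] in \<open>auto simp: norm_mult\<close>)
      fix k
      show "(LINT \<omega>:A \<inter> {\<omega> \<in> space P. a n \<omega> = k}|P. iexp (r * y (Suc n) \<omega>) * ?g \<omega>) = 0"
      proof (cases "k \<in> {1..M}")
        case True
        have "{\<omega> \<in> space (F n). a n \<omega> = k} \<in> sets (F n)"
          using decision_a[of n] by measurable
        then show ?thesis
          using A by (intro gap_Suc_fourier[OF IH Suc.prems(1) L True]) auto
      next
        case False
        then have "A \<inter> {\<omega> \<in> space P. a n \<omega> = k} = {}" using decision_range by blast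
        then show ?thesis by (simp add: set_lebesgue_integral_def)
      qed
    qed
    have "(LINT \<omega>|P. indicat_real D (y (Suc n) \<omega>) *\<^sub>R (indicat_real A \<omega> *\<^sub>R ?g \<omega>)) = 0"
    proof (rule fourier_zero_imp_set_integral_zero[where B = 2])
      show "(CLINT \<omega>|P. iexp (r * y (Suc n) \<omega>) * (indicat_real A \<omega> *\<^sub>R ?g \<omega>)) = 0" for r
        using 1[of r] by (simp add: set_lebesgue_integral_def)
      show "norm (indicat_real A \<omega> *\<^sub>R ?g \<omega>) \<le> 2" if "\<omega> \<in> space P" for \<omega>
        using norm_gap_le[OF L that, of "Suc n" m s] by (auto simp: indicator_def)
    qed (use D in measurable)
    also have "(LINT \<omega>|P. indicat_real D (y (Suc n) \<omega>) *\<^sub>R (indicat_real A \<omega> *\<^sub>R ?g \<omega>))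
      = (LINT \<omega>:B|P. ?g \<omega>)"
      unfolding set_lebesgue_integral_def B'
      by (intro Bochner_Integration.integral_cong) (auto simp: indicator_def)
    finally show ?thesis .
  qed
  have sub: "sets (F (Suc n)) \<subseteq> sigma_sets (space P) ?E"
  proof -
    let ?N = "sigma (space P) ?E"
    have Epow: "?E \<subseteq> Pow (space P)" using EP sets.sets_into_space by blast
    have N: "space ?N = space P" "sets ?N = sigma_sets (space P) ?E"
      using Epow by (simp_all add: space_measure_of sets_measure_of)
    have E: "A \<inter> {\<omega> \<in> space P. y (Suc n) \<omega> \<in> D} \<in> sets ?N" if "A \<in> sets (F n)" "D \<in> sets borel" for A D
      unfolding N using that by (intro sigma_sets.Basic) blast
    have "A \<in> sets ?N" if "A \<in> sets (F n)" for A
      using E[OF that, of UNIV] sets.sets_into_space[OF that] by (simp add: Int_absorb2)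
    then have subN: "subalgebra ?N (F n)" using N by (auto simp: subalgebra_def)
    have yN: "y (Suc n) \<in> borel_measurable ?N"
    proof (rule measurableI)
      fix D :: "real set" assume "D \<in> sets borel"
      then show "y (Suc n) -` D \<inter> space ?N \<in> sets ?N"
        using E[of "space P" D] sets.top[of "F n"] N by (simp add: vimage_def Int_def conj_commute)
    qed simp
    have "sets (F (Suc n)) \<subseteq> sets ?N"
    proof (rule F_le[OF N(1)])
      fix l assume l: "l < Suc n"
      show "a l \<in> ?N \<rightarrow>\<^sub>M count_space UNIV"
        using l measurable_F(1)[of l n] decision_a[of n] measurable_from_subalg[OF subN]
          by (cases "l = n") auto
      show "v l \<in> ?N \<rightarrow>\<^sub>M borel"
        using l measurable_F(2)[of l n] decision_v[of n] measurable_from_subalg[OF subN]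
          by (cases "l = n") auto
      show "y (Suc l) \<in> borel_measurable ?N"
        using l measurable_F(3)[of l n] yN measurable_from_subalg[OF subN] by (cases "l = n") auto
    qed
    then show ?thesis using N by simp
  qed
  have "space P \<in> ?E"
    using sets.top[of "F n"] by (intro CollectI exI[of _ "space P"] exI[of _ UNIV]) auto
  then show ?case
    using set_integral_zero_generated[OF integrable_gap[OF L] stable EP 0 0] sub Suc.prems(3) by blast
qed

end

subsection \<open>Convergence of the posterior means\<close>

context prob_space
begin

text \<open>Under the law conditioned on \<open>A\<close>, the variables \<open>D\<close> and
  \<open>- D\<close> have the same characteristic function and hence the same distribution. The two
  closed half lines at 0 therefore carry equal mass, and they cover everything.\<close>

lemma symmetric_half:
  assumes D [measurable]: "D \<in> borel_measurable M" and A [measurable]: "A \<in> events"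
    and sym: "\<And>r. (LINT \<omega>:A|M. iexp (r * D \<omega>)) = (LINT \<omega>:A|M. iexp (- (r * D \<omega>)))"
  shows "prob A \<le> 2 * prob (A \<inter> {\<omega> \<in> space M. 0 \<le> D \<omega>})" "prob A \<le> 2 * prob (A \<inter> {\<omega> \<in> space M. D \<omega> \<le> 0})"
proof -
  have eq: "prob (A \<inter> {\<omega> \<in> space M. 0 \<le> D \<omega>}) = prob (A \<inter> {\<omega> \<in> space M. D \<omega> \<le> 0})"
  proof (cases "prob A = 0")
    case True
    have "prob (A \<inter> B) = 0" for B
      using True finite_measure_mono[of "A \<inter> B" A] measure_nonneg[of M "A \<inter> B"] by simp
    then show ?thesis by simp
  next
    case False
    then have pA: "prob A > 0" by (simp add: zero_less_measure_iff)
    let ?d = "density M (\<lambda>\<omega>. ennreal (indicat_real A \<omega> / prob A))"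
    have nn: "0 \<le> indicat_real A \<omega> / prob A" for \<omega> using pA by simp
    interpret d: prob_space ?d
    proof
      have "(\<integral>\<^sup>+ \<omega>. ennreal (indicat_real A \<omega> / prob A) \<partial>M) = ennreal (LINT \<omega>|M. indicat_real A \<omega> / prob A)"
        by (intro nn_integral_eq_integral integrable_const_bound[where B = "1 / prob A"])
          (auto simp: nn indicator_def)
      also have "\<dots> = 1" using pA by simp
      finally show "emeasure ?d (space ?d) = 1"
        by (simp add: emeasure_density cong: nn_integral_cong)
    qed
    have int: "(LINT x|distr ?d borel Y. g x) = (LINT \<omega>:A|M. g (Y \<omega>)) /\<^sub>R prob A"
      if [measurable]: "Y \<in> borel_measurable M" "g \<in> borel_measurable borel"
      for Y :: "'a \<Rightarrow> real" and g :: "real \<Rightarrow> 'b::{banach, second_countable_topology}"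
    proof -
      have "(LINT x|distr ?d borel Y. g x) = (LINT \<omega>|M. (indicat_real A \<omega> / prob A) *\<^sub>R g (Y \<omega>))"
        by (subst integral_distr, simp, simp, subst integral_density) (auto simp: nn)
      also have "\<dots> = (LINT \<omega>|M. inverse (prob A) *\<^sub>R (indicat_real A \<omega> *\<^sub>R g (Y \<omega>)))"
        by (intro Bochner_Integration.integral_cong) (simp_all add: divide_inverse mult.commute)
      finally show ?thesis by (simp only: set_lebesgue_integral_def integral_scaleR_right)
    qed
    have "char (distr ?d borel D) = char (distr ?d borel (\<lambda>\<omega>. - D \<omega>))"
      unfolding char_def by (intro ext, subst (1 2) int) (use sym in auto)
    then have "distr ?d borel D = distr ?d borel (\<lambda>\<omega>. - D \<omega>)"
      by (intro Levy_uniqueness d.real_distribution_distr) auto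
    then have "(LINT \<omega>:A|M. indicat_real {0..} (D \<omega>)) /\<^sub>R prob A
      = (LINT \<omega>:A|M. indicat_real {0..} (- D \<omega>)) /\<^sub>R prob A"
      using int[of D "indicat_real {0..}"] int[of "\<lambda>\<omega>. - D \<omega>" "indicat_real {0..}"] by simp
    then have "(LINT \<omega>:A|M. indicat_real {0..} (D \<omega>)) = (LINT \<omega>:A|M. indicat_real {0..} (- D \<omega>))"
      using pA by simp
    moreover have "(LINT \<omega>:A|M. indicat_real {0..} (D \<omega>))
      = (LINT \<omega>|M. indicat_real (A \<inter> {\<omega> \<in> space M. 0 \<le> D \<omega>}) \<omega>)"
      unfolding set_lebesgue_integral_def by (intro Bochner_Integration.integral_cong) (auto simp:
        indicator_def)
    moreover have "(LINT \<omega>:A|M. indicat_real {0..} (- D \<omega>))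
      = (LINT \<omega>|M. indicat_real (A \<inter> {\<omega> \<in> space M. D \<omega> \<le> 0}) \<omega>)"
      unfolding set_lebesgue_integral_def by (intro Bochner_Integration.integral_cong) (auto simp:
        indicator_def)
    ultimately show ?thesis by simp
  qed
  let ?U = "A \<inter> {\<omega> \<in> space M. 0 \<le> D \<omega>}" and ?V = "A \<inter> {\<omega> \<in> space M. D \<omega> \<le> 0}"
  have "prob A = prob (?U \<union> ?V)"
    using sets.sets_into_space[OF A] by (intro arg_cong[where f = prob]) auto
  also have "\<dots> \<le> prob ?U + prob ?V" by (rule measure_Un_le) measurable
  finally have "prob A \<le> prob ?U + prob ?V" .
  then show "prob A \<le> 2 * prob (A \<inter> {\<omega> \<in> space M. 0 \<le> D \<omega>})" "prob A \<le> 2 * prob (A \<inter> {\<omega> \<in> space M. D \<omega>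
    \<le> 0})"
    using eq by simp_all
qed

text \<open>Levy's maximal inequality: at the first time that \<open>S\<close> is far from \<open>c\<close>, the limit \<open>T\<close> is
  at least as far on the same side with conditional probability one half.\<close>

lemma first_passage_bound:
  fixes S :: "nat \<Rightarrow> 'a \<Rightarrow> real" and G :: "nat \<Rightarrow> 'a measure"
  assumes G: "\<And>n. subalgebra M (G n)" "\<And>m n. m \<le> n \<Longrightarrow> sets (G m) \<subseteq> sets (G n)"
    and S: "\<And>n. S n \<in> borel_measurable (G n)" and T [measurable]: "T \<in> borel_measurable M"
    and c: "c \<in> borel_measurable (G n0)"
    and sym: "\<And>n A r. A \<in> sets (G n) \<Longrightarrow>
      (LINT \<omega>:A|M. iexp (r * (T \<omega> - S n \<omega>))) = (LINT \<omega>:A|M. iexp (- (r * (T \<omega> - S n \<omega>))))"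
  shows "prob {\<omega> \<in> space M. \<exists>m\<ge>n0. \<epsilon> < \<bar>S m \<omega> - c \<omega>\<bar>} \<le> 2 * prob {\<omega> \<in> space M. \<epsilon> < \<bar>T \<omega> - c \<omega>\<bar>}"
proof -
  have SM [measurable]: "S n \<in> borel_measurable M" for n by (rule measurable_from_subalg[OF G(1) S])
  have cM [measurable]: "c \<in> borel_measurable M" by (rule measurable_from_subalg[OF G(1) c])
  have GM: "sets (G n) \<subseteq> sets M" "space (G n) = space M" for n using G(1)[of n]
    by (auto simp: subalgebra_def)
  have sub: "subalgebra (G n) (G m)" if "m \<le> n" for m n using G(2)[OF that] GM
    by (auto simp: subalgebra_def)
  \<comment> \<open>The first passage happens at time \<open>n0 + m\<close>. This event, together
    with the side of \<open>c\<close> on which \<open>S\<close> lies, belongs to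
    \<open>G (n0 + m)\<close>, so the symmetry of \<open>T - S (n0 + m)\<close> may be used on
    it.\<close>
  define A where "A m = {\<omega> \<in> space M. \<epsilon> < \<bar>S (n0 + m) \<omega> - c \<omega>\<bar> \<and> (\<forall>l\<in>{..<m}. \<not> \<epsilon> < \<bar>S (n0
    + l) \<omega> - c \<omega>\<bar>)}" for m
  let ?B = "{\<omega> \<in> space M. \<epsilon> < \<bar>T \<omega> - c \<omega>\<bar>}"
  have AG: "A m \<inter> {\<omega> \<in> space M. 0 < S (n0 + m) \<omega> - c \<omega>} \<in> sets (G (n0 + m))"
      "A m \<inter> {\<omega> \<in> space M. S (n0 + m) \<omega> - c \<omega> < 0} \<in> sets (G (n0 + m))"
      and AM [measurable]: "A m \<in> events" for m
  proof -
    have Sl: "S (n0 + l) \<in> borel_measurable (G (n0 + m))" if "l \<le> m" for l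
      using that by (intro measurable_from_subalg[OF sub S]) auto
    have [measurable]: "c \<in> borel_measurable (G (n0 + m))"
      by (rule measurable_from_subalg[OF sub c]) auto
    have far: "{\<omega> \<in> space M. \<epsilon> < \<bar>S (n0 + l) \<omega> - c \<omega>\<bar>} \<in> sets (G (n0 + m))" if "l \<le> m" for l
    proof -
      note [measurable] = Sl[OF that]
      have "{\<omega> \<in> space (G (n0 + m)). \<epsilon> < \<bar>S (n0 + l) \<omega> - c \<omega>\<bar>} \<in> sets (G (n0 + m))" by measurable
      then show ?thesis by (simp add: GM)
    qed
    have "A m = {\<omega> \<in> space M. \<epsilon> < \<bar>S (n0 + m) \<omega> - c \<omega>\<bar>} - (\<Union>l\<in>{..<m}. {\<omega> \<in> space M. \<epsilon> < \<bar>S (n0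
      + l) \<omega> - c \<omega>\<bar>})"
      by (auto simp: A_def)
    also have "\<dots> \<in> sets (G (n0 + m))"
      by (intro sets.Diff sets.finite_UN far) auto
    finally have 1: "A m \<in> sets (G (n0 + m))" .
    note [measurable] = Sl[OF order_refl]
    have 2: "{\<omega> \<in> space (G (n0 + m)). 0 < S (n0 + m) \<omega> - c \<omega>} \<in> sets (G (n0 + m))"
      "{\<omega> \<in> space (G (n0 + m)). S (n0 + m) \<omega> - c \<omega> < 0} \<in> sets (G (n0 + m))" by measurable
    show "A m \<inter> {\<omega> \<in> space M. 0 < S (n0 + m) \<omega> - c \<omega>} \<in> sets (G (n0 + m))"
      "A m \<inter> {\<omega> \<in> space M. S (n0 + m) \<omega> - c \<omega> < 0} \<in> sets (G (n0 + m))"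
      using 1 2 by (simp_all add: GM)
    show "A m \<in> events" using 1 GM by blast
  qed
  have half: "prob (A m) \<le> 2 * prob (A m \<inter> ?B)" for m
  proof -
    let ?P = "A m \<inter> {\<omega> \<in> space M. 0 < S (n0 + m) \<omega> - c \<omega>}" and ?N
      = "A m \<inter> {\<omega> \<in> space M. S (n0 + m) \<omega> - c \<omega> < 0}"
    let ?D = "\<lambda>\<omega>. T \<omega> - S (n0 + m) \<omega>"
    have "prob ?P \<le> 2 * prob (?P \<inter> {\<omega> \<in> space M. 0 \<le> ?D \<omega>})"
      by (rule symmetric_half(1)) (use sym[OF AG(1)] in auto)
    also have "\<dots> \<le> 2 * prob (?P \<inter> ?B)"
      by (intro mult_left_mono finite_measure_mono) (auto simp: A_def)
    finally have p: "prob ?P \<le> 2 * prob (?P \<inter> ?B)" .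
    have "prob ?N \<le> 2 * prob (?N \<inter> {\<omega> \<in> space M. ?D \<omega> \<le> 0})"
      by (rule symmetric_half(2)) (use sym[OF AG(2)] in auto)
    also have "\<dots> \<le> 2 * prob (?N \<inter> ?B)"
      by (intro mult_left_mono finite_measure_mono) (auto simp: A_def)
    finally have n: "prob ?N \<le> 2 * prob (?N \<inter> ?B)" .
    show ?thesis
    \<comment> \<open>For negative \<open>\<epsilon>\<close> a passage may occur with
      \<open>S = c\<close>, on neither side; but then \<open>?B\<close> is the whole space.\<close>
    proof (cases "\<epsilon> < 0")
      case True
      then have "A m \<inter> ?B = A m" by (auto simp: A_def)
      then show ?thesis by simp
    next
      case False
      then have e: "A m = ?P \<union> ?N" by (auto simp: A_def)
      have "prob (A m) = prob ?P + prob ?N"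
        by (subst e, rule finite_measure_Union) auto
      moreover have eB: "A m \<inter> ?B = (?P \<inter> ?B) \<union> (?N \<inter> ?B)" using e by blast
      have "prob (A m \<inter> ?B) = prob (?P \<inter> ?B) + prob (?N \<inter> ?B)"
        by (subst eB, rule finite_measure_Union) auto
      ultimately show ?thesis using p n by simp
    qed
  qed
  have disj: "disjoint_family A"
    unfolding disjoint_family_on_def
  proof safe
    fix m m' \<omega> assume "m \<noteq> m'" "\<omega> \<in> A m" "\<omega> \<in> A m'"
    then show "\<omega> \<in> {}" by (cases "m < m'") (auto simp: A_def)
  qed
  have un: "{\<omega> \<in> space M. \<exists>m\<ge>n0. \<epsilon> < \<bar>S m \<omega> - c \<omega>\<bar>} = (\<Union>m. A m)"
  proof safe
    fix \<omega> m assume w: "\<omega> \<in> space M" "n0 \<le> m" "\<epsilon> < \<bar>S m \<omega> - c \<omega>\<bar>"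
    let ?Q = "\<lambda>k. \<epsilon> < \<bar>S (n0 + k) \<omega> - c \<omega>\<bar>"
    have "?Q (m - n0)" using w by simp
    then have "?Q (LEAST k. ?Q k)" "\<forall>l<(LEAST k. ?Q k). \<not> ?Q l" by (rule LeastI, blast dest: not_less_Least)
    then show "\<omega> \<in> (\<Union>m. A m)" using w(1) by (auto simp: A_def)
  qed (auto simp: A_def intro: le_add1)
  have s: "(\<lambda>m. prob (A m)) sums prob (\<Union>m. A m)"
    by (rule finite_measure_UNION) (use disj in auto)
  have s': "(\<lambda>m. 2 * prob (A m \<inter> ?B)) sums (2 * prob (\<Union>m. A m \<inter> ?B))"
    by (intro sums_mult finite_measure_UNION) (use disj in \<open>auto simp: disjoint_family_on_def\<close>)
  have "prob (\<Union>m. A m) \<le> 2 * prob (\<Union>m. A m \<inter> ?B)"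
    by (rule sums_le[OF half s s'])
  also have "\<dots> \<le> 2 * prob ?B" by (intro mult_left_mono finite_measure_mono) auto
  finally show ?thesis unfolding un .
qed

lemma AE_eq_0_of_measure_le:
  fixes u :: "nat \<Rightarrow> real"
  assumes B: "B \<in> events" and u: "u \<longlonglongrightarrow> 0" and le: "\<And>k. prob B \<le> u k"
  shows "AE \<omega> in M. \<omega> \<notin> B"
proof -
  have "prob B \<le> 0" by (rule LIMSEQ_le_const[OF u]) (use le in auto)
  then have "prob B = 0" using measure_nonneg[of M B] by simp
  then show ?thesis using B by (simp add: prob_eq_0)
qed

lemma tail_tendsto_0:
  assumes [measurable]: "T \<in> borel_measurable M"
  shows "(\<lambda>k. prob {\<omega> \<in> space M. real k < \<bar>T \<omega>\<bar>}) \<longlonglongrightarrow> 0"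
proof -
  have "(\<lambda>k. prob {\<omega> \<in> space M. real k < \<bar>T \<omega>\<bar>}) \<longlonglongrightarrow> prob (\<Inter>k. {\<omega> \<in> space M. real k < \<bar>T \<omega>\<bar>})"
  proof (rule finite_Lim_measure_decseq)
    show "decseq (\<lambda>k. {\<omega> \<in> space M. real k < \<bar>T \<omega>\<bar>})"
      unfolding decseq_def by (intro allI impI Collect_mono conj_mono imp_refl) simp
  qed auto
  moreover have "(\<Inter>k. {\<omega> \<in> space M. real k < \<bar>T \<omega>\<bar>}) = {}"
  proof -
    have "\<not> (\<forall>k. real k < \<bar>T \<omega>\<bar>)" for \<omega>
      using real_arch_simple[of "\<bar>T \<omega>\<bar>"] by (simp add: not_less)
    then show ?thesis by auto
  qed
  ultimately show ?thesis by simp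
qed

text \<open>By Levy's continuity theorem the laws converge weakly to the point mass at 0, whose
  distribution function is continuous at \<open>\<epsilon>\<close> and at
  \<open>- \<epsilon>\<close>.\<close>

lemma prob_tendsto_0_of_char:
  fixes D :: "nat \<Rightarrow> 'a \<Rightarrow> real"
  assumes D [measurable]: "\<And>n. D n \<in> borel_measurable M"
    and char: "\<And>r. (\<lambda>n. CLINT \<omega>|M. iexp (r * D n \<omega>)) \<longlonglongrightarrow> 1" and \<epsilon>: "\<epsilon> > 0"
  shows "(\<lambda>n. prob {\<omega> \<in> space M. \<epsilon> < \<bar>D n \<omega>\<bar>}) \<longlonglongrightarrow> 0"
proof -
  let ?M = "\<lambda>n. distr M borel (D n)" and ?R = "return borel (0::real)"
  interpret R: prob_space ?R by (rule prob_space_return) simp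
  have R: "real_distribution ?R" by (simp add: real_distribution_def real_distribution_axioms_def
    R.prob_space_axioms)
  have "weak_conv_m ?M ?R"
  proof (rule levy_continuity)
    show "real_distribution (?M n)" for n by (rule real_distribution_distr) simp
    show "(\<lambda>n. char (?M n) t) \<longlonglongrightarrow> char ?R t" for t
      using char[of t] by (simp add: char_def integral_distr integral_return)
  qed (rule R)
  then have conv: "(\<lambda>n. cdf (?M n) x) \<longlonglongrightarrow> cdf ?R x" if "isCont (cdf ?R) x" for x
    using that by (simp add: weak_conv_m_def weak_conv_def)
  have cdfR: "cdf ?R x = (if 0 \<le> x then 1 else 0)" for x
    by (simp add: cdf_def measure_return)
  have 1: "isCont (cdf ?R) \<epsilon>"
    by (rule isCont_cong[THEN iffD1, where f1 = "\<lambda>_. 1"])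
      (use \<epsilon> eventually_nhds_in_open[of "{0<..}" \<epsilon>] in \<open>auto simp: cdfR elim!: eventually_mono\<close>)
  have 2: "isCont (cdf ?R) (- \<epsilon>)"
    by (rule isCont_cong[THEN iffD1, where f1 = "\<lambda>_. 0"])
      (use \<epsilon> eventually_nhds_in_open[of "{..<0}" "- \<epsilon>"] in \<open>auto simp: cdfR elim!: eventually_mono\<close>)
  have lim: "(\<lambda>n. 1 - cdf (?M n) \<epsilon> + cdf (?M n) (- \<epsilon>)) \<longlonglongrightarrow> 1 - 1 + 0"
    using conv[OF 1] conv[OF 2] \<epsilon> by (intro tendsto_intros) (simp_all add: cdfR)
  have cdf: "cdf (?M n) x = prob {\<omega> \<in> space M. D n \<omega> \<le> x}" for n x
    by (simp add: cdf_def measure_distr vimage_def Int_def conj_commute)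
  have le: "prob {\<omega> \<in> space M. \<epsilon> < \<bar>D n \<omega>\<bar>} \<le> 1 - cdf (?M n) \<epsilon> + cdf (?M n) (- \<epsilon>)" for n
  proof -
    have "prob {\<omega> \<in> space M. \<epsilon> < \<bar>D n \<omega>\<bar>} \<le> prob ({\<omega> \<in> space M. \<not> D n \<omega> \<le> \<epsilon>} \<union> {\<omega> \<in> space M. D n \<omega> \<le> - \<epsilon>})"
      by (intro finite_measure_mono) auto
    also have "\<dots> \<le> prob {\<omega> \<in> space M. \<not> D n \<omega> \<le> \<epsilon>} + prob {\<omega> \<in> space M. D n \<omega> \<le> - \<epsilon>}"
      by (intro measure_Un_le) auto
    also have "prob {\<omega> \<in> space M. \<not> D n \<omega> \<le> \<epsilon>} = 1 - prob {\<omega> \<in> space M. D n \<omega> \<le> \<epsilon>}"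
      by (rule prob_neg) simp
    finally show ?thesis by (simp add: cdf)
  qed
  show ?thesis
    by (rule tendsto_sandwich[OF _ _ tendsto_const, where h = "\<lambda>n. 1 - cdf (?M n) \<epsilon> + cdf (?M n) (- \<epsilon>)"])
      (use lim le in auto)
qed

end

section \<open>Posterior means: boundedness, almost sure convergence, absence of ties\<close>

context gp_sampling
begin

text \<open>The case of a one-point list without future noise. The right-hand side is even in
  \<open>r\<close>, which is the conditional symmetry that the maximal inequality asks for.\<close>

lemma char_deviation:
  assumes i: "i \<in> {1..M}" and x: "x \<in> X" and A: "A \<in> sets (F n)"
  shows "(LINT \<omega>:A|P. iexp (r * (\<theta> i x \<omega> - pmean n \<omega> i x)))
    = (LINT \<omega>:A|P. complex_of_real (exp (- (r\<^sup>2 * pcov n \<omega> i x x) / 2)))"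
proof -
  have L: "snd ` set [(r, i, x)] \<subseteq> \<I>" using i x by (simp add: \<I>_def)
  have AP: "A \<in> sets P" using A sets_F by blast
  note [measurable] = measurable_post_P(1)[OF i x] measurable_post_P(2)[OF i x x] measurable_\<theta>[OF i x]
  have g: "gap n n [(r, i, x)] s \<omega> = iexp (r * (\<theta> i x \<omega> - pmean n \<omega> i x)) - exp (- (r\<^sup>2 * pcov n \<omega> i x
    x) / 2)" for s \<omega>
    by (simp add: gap_def dev_def qf_def power2_eq_square mult.assoc)
  have e: "exp (- (r\<^sup>2 * pcov n \<omega> i x x) / 2) \<le> 1" if "\<omega> \<in> space P" for \<omega>
    using psd_on_diag[OF psd_c[OF that i] x, of n] by simp
  have "set_integrable P A (\<lambda>\<omega>. iexp (r * (\<theta> i x \<omega> - pmean n \<omega> i x)))"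
    unfolding set_integrable_def
    by (intro integrable_mult_indicator AP integrable_const_bound[where B = 1]) auto
  moreover have "set_integrable P A (\<lambda>\<omega>. complex_of_real (exp (- (r\<^sup>2 * pcov n \<omega> i x x) / 2)))"
    unfolding set_integrable_def
    by (intro integrable_mult_indicator AP integrable_const_bound[where B = 1] AE_I2)
      (use e in \<open>auto simp del: of_real_exp\<close>)
  ultimately have "(LINT \<omega>:A|P. gap n n [(r, i, x)] (\<lambda>_. 0) \<omega>) =
    (LINT \<omega>:A|P. iexp (r * (\<theta> i x \<omega> - pmean n \<omega> i x))) - (LINT \<omega>:A|P. complex_of_real (exp (- (r\<^sup>2 *
      pcov n \<omega> i x x) / 2)))"
    unfolding g by (rule set_integral_diff(2))
  then show ?thesis using gap_integral_zero[OF order_refl L A, of "\<lambda>_. 0"] by simp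
qed

text \<open>The true value \<open>\<theta> i x\<close> plays the part of the limit. With
  \<open>c = 0\<close> this bounds the posterior means over all times; with \<open>c\<close> the
  mean at time \<open>n0\<close> it controls all later fluctuations.\<close>

lemma posterior_passage_bound:
  assumes i: "i \<in> {1..M}" and x: "x \<in> X" and c: "c \<in> borel_measurable (F n0)"
  shows "prob {\<omega> \<in> space P. \<exists>m\<ge>n0. \<epsilon> < \<bar>pmean m \<omega> i x - c \<omega>\<bar>} \<le> 2 * prob {\<omega> \<in> space P. \<epsilon> < \<bar>\<theta> i x \<omega> - c \<omega>\<bar>}"
proof (rule first_passage_bound[where G = F])
  show "(LINT \<omega>:A|P. iexp (r * (\<theta> i x \<omega> - pmean n \<omega> i x)))
    = (LINT \<omega>:A|P. iexp (- (r * (\<theta> i x \<omega> - pmean n \<omega> i x))))"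
    if "A \<in> sets (F n)" for n A r
    using char_deviation[OF i x that, of r] char_deviation[OF i x that, of "- r"] by simp
qed (use i x c in \<open>auto intro: subalgebra_F F_mono[THEN subsetD] measurable_m measurable_\<theta>\<close>)

lemma posterior_mean_bounded:
  assumes i: "i \<in> {1..M}" and x: "x \<in> X"
  shows "AE \<omega> in P. \<exists>k::nat. \<forall>m. \<bar>pmean m \<omega> i x\<bar> \<le> real k"
proof -
  note [measurable] = measurable_post_P(1)[OF i x] measurable_\<theta>[OF i x]
  let ?B = "{\<omega> \<in> space P. \<forall>k::nat. \<exists>m. real k < \<bar>pmean m \<omega> i x\<bar>}"
  have "AE \<omega> in P. \<omega> \<notin> ?B"
  proof (rule AE_eq_0_of_measure_le)
    show "(\<lambda>k. 2 * prob {\<omega> \<in> space P. real k < \<bar>\<theta> i x \<omega>\<bar>}) \<longlonglongrightarrow> 0"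
      by (rule tendsto_eq_intros tail_tendsto_0 | simp)+
    fix k :: nat
    have "prob ?B \<le> prob {\<omega> \<in> space P. \<exists>m\<ge>0. real k < \<bar>pmean m \<omega> i x - 0\<bar>}"
      by (intro finite_measure_mono) auto
    also have "\<dots> \<le> 2 * prob {\<omega> \<in> space P. real k < \<bar>\<theta> i x \<omega> - 0\<bar>}"
      by (rule posterior_passage_bound[OF i x]) simp
    finally show "prob ?B \<le> 2 * prob {\<omega> \<in> space P. real k < \<bar>\<theta> i x \<omega>\<bar>}" by simp
  qed measurable
  then show ?thesis using AE_space by eventually_elim (auto simp: not_less)
qed

text \<open>Vanishing variances send the characteristic functions of the deviations to 1, which
  gives convergence in probability. The passage bound restarted at time \<open>n\<close> upgrades it
  to almost sure convergence.\<close>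

lemma posterior_mean_tendsto:
  assumes i: "i \<in> {1..M}" and x: "x \<in> X" and var: "AE \<omega> in P. (\<lambda>n. pcov n \<omega> i x x) \<longlonglongrightarrow> 0"
  shows "AE \<omega> in P. (\<lambda>n. pmean n \<omega> i x) \<longlonglongrightarrow> \<theta> i x \<omega>"
proof -
  note [measurable] = measurable_post_P(1)[OF i x] measurable_\<theta>[OF i x] measurable_post_P(2)[OF i x x]
  have e: "exp (- (r\<^sup>2 * pcov n \<omega> i x x) / 2) \<le> 1" if "\<omega> \<in> space P" for \<omega> r n
    using psd_on_diag[OF psd_c[OF that i] x, of n] by simp
  have p0: "(\<lambda>n. prob {\<omega> \<in> space P. \<epsilon> < \<bar>\<theta> i x \<omega> - pmean n \<omega> i x\<bar>}) \<longlonglongrightarrow> 0" if \<epsilon>: "\<epsilon> > 0" for \<epsilon>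
  proof (rule prob_tendsto_0_of_char[OF _ _ \<epsilon>])
    fix r
    have eq: "(CLINT \<omega>|P. iexp (r * (\<theta> i x \<omega> - pmean n \<omega> i x)))
      = (CLINT \<omega>|P. complex_of_real (exp (- (r\<^sup>2 * pcov n \<omega> i x x) / 2)))" for n
    proof -
      have sp: "(LINT \<omega>:space P|P. f \<omega>) = (LINT \<omega>|P. f \<omega>)" for f :: "'w \<Rightarrow> complex"
        unfolding set_lebesgue_integral_def by (intro Bochner_Integration.integral_cong) auto
      have "space P \<in> sets (F n)" using sets.top[of "F n"] by simp
      from char_deviation[OF i x this, of r] show ?thesis unfolding sp .
    qed
    have "(\<lambda>n. CLINT \<omega>|P. complex_of_real (exp (- (r\<^sup>2 * pcov n \<omega> i x x) / 2)))
      \<longlonglongrightarrow> (CLINT \<omega>|P. complex_of_real (exp (- (r\<^sup>2 * 0) / 2)))"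
    proof (rule integral_dominated_convergence[where w = "\<lambda>_. 1"])
      show "AE \<omega> in P. (\<lambda>n. complex_of_real (exp (- (r\<^sup>2 * pcov n \<omega> i x x) / 2)))
        \<longlonglongrightarrow> complex_of_real (exp (- (r\<^sup>2 * 0) / 2))"
        using var by eventually_elim (intro tendsto_intros, auto)
      show "AE \<omega> in P. norm (complex_of_real (exp (- (r\<^sup>2 * pcov n \<omega> i x x) / 2))) \<le> 1" for n
        using AE_space by eventually_elim (use e in \<open>auto simp del: of_real_exp\<close>)
    qed auto
    then show "(\<lambda>n. CLINT \<omega>|P. iexp (r * (\<theta> i x \<omega> - pmean n \<omega> i x))) \<longlonglongrightarrow> 1"
      unfolding eq by (simp add: prob_space)
  qed measurable
  have bad: "AE \<omega> in P. \<omega> \<notin> {\<omega> \<in> space P. \<forall>n. \<exists>m\<ge>n. 2 * \<epsilon> < \<bar>pmean m \<omega> i x - \<theta> i x \<omega>\<bar>}" (is "AE \<omega> in P.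
    \<omega> \<notin> ?B") if \<epsilon>: "\<epsilon> > 0" for \<epsilon>
  proof (rule AE_eq_0_of_measure_le)
    \<comment> \<open>Two parts come from the passage bound for the fluctuations after time
      \<open>n\<close>, one from the deviation at time \<open>n\<close> itself.\<close>
    show "(\<lambda>n. 3 * prob {\<omega> \<in> space P. \<epsilon> < \<bar>\<theta> i x \<omega> - pmean n \<omega> i x\<bar>}) \<longlonglongrightarrow> 0"
      by (rule tendsto_eq_intros p0[OF \<epsilon>] | simp)+
    fix n
    let ?C = "{\<omega> \<in> space P. \<exists>m\<ge>n. \<epsilon> < \<bar>pmean m \<omega> i x - pmean n \<omega> i x\<bar>}" and ?D
      = "{\<omega> \<in> space P. \<epsilon> < \<bar>\<theta> i x \<omega> - pmean n \<omega> i x\<bar>}"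
    have "?B \<subseteq> ?C \<union> ?D"
    proof
      fix \<omega> assume "\<omega> \<in> ?B"
      then obtain m where "\<omega> \<in> space P" "m \<ge> n" "2 * \<epsilon> < \<bar>pmean m \<omega> i x - \<theta> i x \<omega>\<bar>" by auto
      then have "\<epsilon> < \<bar>pmean m \<omega> i x - pmean n \<omega> i x\<bar> \<or> \<epsilon> < \<bar>\<theta> i x \<omega> - pmean n \<omega> i x\<bar>" by linarith
      then show "\<omega> \<in> ?C \<union> ?D" using \<open>\<omega> \<in> space P\<close> \<open>m \<ge> n\<close> by auto
    qed
    then have "prob ?B \<le> prob (?C \<union> ?D)" by (intro finite_measure_mono) auto
    also have "\<dots> \<le> prob ?C + prob ?D" by (intro measure_Un_le) auto
    also have "prob ?C \<le> 2 * prob ?D"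
      by (rule posterior_passage_bound[OF i x measurable_m[OF i x]])
    finally show "prob ?B \<le> 3 * prob ?D" by simp
  qed measurable
  have "AE \<omega> in P. \<forall>k::nat. \<omega> \<notin> {\<omega> \<in> space P. \<forall>n. \<exists>m\<ge>n. 2 * (1 / real (Suc k)) < \<bar>pmean m \<omega> i x - \<theta> i x \<omega>\<bar>}"
    unfolding AE_all_countable by (intro allI bad) simp
  then show ?thesis using AE_space
  proof eventually_elim
    case (elim \<omega>)
    show ?case
    proof (rule LIMSEQ_I)
      fix e :: real assume "e > 0"
      then obtain k where "inverse (real (Suc k)) < e / 2" using reals_Archimedean[of "e / 2"] by auto
      then have k: "2 * (1 / real (Suc k)) < e" by (simp add: inverse_eq_divide)
      obtain n where "\<forall>m\<ge>n. \<not> 2 * (1 / real (Suc k)) < \<bar>pmean m \<omega> i x - \<theta> i x \<omega>\<bar>"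
        using elim by blast
      then have "\<forall>m\<ge>n. norm (pmean m \<omega> i x - \<theta> i x \<omega>) < e" using k by (auto simp: not_less)
      then show "\<exists>no. \<forall>m\<ge>no. norm (pmean m \<omega> i x - \<theta> i x \<omega>) < e" by blast
    qed
  qed
qed

text \<open>The two values are independent, so their difference is normal with variance
  \<open>k0 i x x + k0 j x x > 0\<close> and has a density. This makes the limiting argmax a single
  index.\<close>

lemma prior_no_ties:
  assumes i: "i \<in> {1..M}" "j \<in> {1..M}" "i \<noteq> j" and x: "x \<in> X"
  shows "AE \<omega> in P. \<theta> i x \<omega> \<noteq> \<theta> j x \<omega>"
proof -
  let ?L = "[(1::real, i, x), (-1, j, x)]"
  have L: "snd ` set ?L \<subseteq> \<I>" using i x by (simp add: \<I>_def)
  note [measurable] = measurable_\<theta>[OF i(1) x] measurable_\<theta>[OF i(2) x]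
  let ?U = "\<lambda>\<omega>. lc ?L (\<lambda>p. \<theta> (fst p) (snd p) \<omega>)"
  let ?m = "lc ?L (\<lambda>p. \<mu>0 (fst p) (snd p))" and ?q = "qf (block_kernel k0) ?L"
  have U: "?U = (\<lambda>\<omega>. \<theta> i x \<omega> - \<theta> j x \<omega>)" by simp
  have q: "?q = k0 i x x + k0 j x x" using i(3) by (simp add: qf_def block_kernel_def)
  then have qpos: "0 < ?q" using k0_pos[OF i(1) x x] k0_pos[OF i(2) x x] by simp
  have law: "normal_law ?m ?q = density lborel (normal_density ?m (sqrt ?q))"
    using qpos by (simp add: normal_law_def)
  have "prob_space (normal_law ?m ?q)"
    unfolding law by (rule prob_space_normal_density) (use qpos in simp)
  then have "real_distribution (normal_law ?m ?q)"
    by (simp add: real_distribution_def real_distribution_axioms_def normal_law_def)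
  then have "distr P borel ?U = normal_law ?m ?q"
    by (intro Levy_uniqueness real_distribution_distr ext) (simp_all only: char_prior[OF L]
      char_normal_law[OF less_imp_le[OF qpos]], auto simp: U)
  then have d: "distr P borel (\<lambda>\<omega>. \<theta> i x \<omega> - \<theta> j x \<omega>) = density lborel (normal_density ?m (sqrt ?q))"
    using U law by simp
  have "AE z in density lborel (normal_density ?m (sqrt ?q)). z \<noteq> 0"
    by (subst AE_density) (use AE_lborel_singleton[of "0::real"] in \<open>auto elim!: eventually_mono\<close>)
  then have "AE z in distr P borel (\<lambda>\<omega>. \<theta> i x \<omega> - \<theta> j x \<omega>). z \<noteq> 0" unfolding d .
  then have "AE \<omega> in P. \<theta> i x \<omega> - \<theta> j x \<omega> \<noteq> 0" by (subst (asm) AE_distr_iff) auto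
  then show ?thesis by simp
qed

text \<open>The exceptional null set of paths depends on the point, and there are uncountably many
  points. Fubini exchanges the two quantifiers at the price of a Lebesgue null set of
  points.\<close>

lemma posterior_mean_bounded_ae_point:
  assumes i: "i \<in> {1..M}" and X: "X \<in> sets borel"
  shows "AE \<omega> in P. AE x in restrict_space lborel X. \<exists>k::nat. \<forall>m. \<bar>pmean m \<omega> i x\<bar> \<le> real k"
proof -
  let ?R = "restrict_space lborel X"
  have Xl: "X \<in> sets lborel" using X by simp
  interpret R: sigma_finite_measure ?R
    by (rule sigma_finite_measure_restrict_space[OF lborel.sigma_finite_measure_axioms Xl])
  interpret pair_sigma_finite P ?R ..
  have R: "sets ?R = sets RX" by (rule sets_restrict_space_cong) simp
  have [measurable]: "(\<lambda>p. pmean m (fst p) i (snd p)) \<in> borel_measurable (P \<Otimes>\<^sub>M ?R)" for m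
    using measurable_posterior[OF refl measurable_P measurable_y i, of m]
    by (simp cong: measurable_cong_sets sets_pair_measure_cong add: R measurable_cong_sets[OF
      sets_pair_measure_cong[OF refl R] refl])
  have "AE x in ?R. AE \<omega> in P. \<exists>k::nat. \<forall>m. \<bar>pmean m \<omega> i x\<bar> \<le> real k"
    using AE_space by eventually_elim (rule posterior_mean_bounded[OF i], simp add: space_restrict_space)
  then show ?thesis
    by (subst AE_commute) measurable
qed

end

subsection \<open>The integrated knowledge gradient of the chosen decisions\<close>

text \<open>Expected improvement of the maximum when two means are \<open>\<delta>\<close> apart and
  one of them moves by \<open>s\<close> times a standard normal variable. The symmetrised form, with
  absolute value and factor 1/2, is the same whichever of the two is ahead.\<close>

definition gain :: "real \<Rightarrow> real \<Rightarrow> real" where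
  "gain \<delta> s = (LINT z|std_normal_distribution. max 0 (\<bar>s * z\<bar> - \<delta>)) / 2"

definition abs_moment :: real where
  "abs_moment = (LINT z|std_normal_distribution. \<bar>z\<bar>)"

lemma integrable_std_normal_abs: "integrable std_normal_distribution (\<lambda>z. \<bar>z\<bar>)"
  using integrable_std_normal_moment_abs[of 1] by (subst integrable_density) auto

lemma integrable_std_normal_linear:
  assumes [measurable]: "f \<in> borel_measurable borel" and "\<And>z. \<bar>f z\<bar> \<le> b + \<bar>s\<bar> * \<bar>z\<bar>"
  shows "integrable std_normal_distribution (f :: real \<Rightarrow> real)"
proof -
  interpret N: prob_space std_normal_distribution by (rule prob_space_normal_density) simp
  show ?thesis
    by (rule Bochner_Integration.integrable_bound[where f = "\<lambda>z. b + \<bar>s\<bar> * \<bar>z\<bar>"])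
      (use integrable_std_normal_abs order_trans[OF assms(2) abs_ge_self] in auto)
qed

lemma integrable_gain: "0 \<le> \<delta> \<Longrightarrow> integrable std_normal_distribution (\<lambda>z. max 0 (\<bar>s * z\<bar> - \<delta>))"
  by (rule integrable_std_normal_linear[where b = 0 and s = s]) (auto simp: abs_mult max_def)

lemma integral_std_normal_uminus:
  fixes f :: "real \<Rightarrow> real"
  assumes [measurable]: "f \<in> borel_measurable borel"
  shows "(LINT z|std_normal_distribution. f (- z)) = (LINT z|std_normal_distribution. f z)"
proof -
  have "(LINT z|std_normal_distribution. f z) = (LINT z|lborel. std_normal_density z * f z)"
    by (subst integral_density) auto
  also have "\<dots> = (LINT z|lborel. std_normal_density (- z) * f (- z))"
    using lborel_integral_real_affine[of "-1" "\<lambda>z. std_normal_density z * f z" 0] by simp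
  also have "\<dots> = (LINT z|lborel. std_normal_density z * f (- z))"
    by (simp add: std_normal_density_def)
  also have "\<dots> = (LINT z|std_normal_distribution. f (- z))"
    by (subst integral_density) auto
  finally show ?thesis by simp
qed

lemma normal_law_std: "normal_law 0 1 = std_normal_distribution"
  by (simp add: normal_law_def)

text \<open>Average the integrand over \<open>z\<close> and \<open>- z\<close>. The two maxima add
  up to twice the current maximum plus the amount by which the move exceeds the distance of the
  means.\<close>

lemma expected_max_eq_gain:
  "(LINT z|std_normal_distribution. max (\<mu> + s * z) m) = max \<mu> m + gain \<bar>\<mu> - m\<bar> s"
proof -
  interpret N: prob_space std_normal_distribution by (rule prob_space_normal_density) simp
  have lin: "integrable std_normal_distribution (\<lambda>z. max (\<mu> + t * z) m)" for t
  proof (rule integrable_std_normal_linear[where b = "\<bar>\<mu>\<bar> + \<bar>m\<bar>" and s = t])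
    show "\<bar>max (\<mu> + t * z) m\<bar> \<le> \<bar>\<mu>\<bar> + \<bar>m\<bar> + \<bar>t\<bar> * \<bar>z\<bar>" for z
      unfolding abs_mult[symmetric] by (auto simp: max_def)
  qed simp
  have i: "integrable std_normal_distribution (\<lambda>z. max (\<mu> + s * z) m)"
    "integrable std_normal_distribution (\<lambda>z. max (\<mu> + s * - z) m)"
    using lin[of s] lin[of "- s"] by simp_all
  have e: "max (\<mu> + t) m + max (\<mu> - t) m = 2 * max \<mu> m + max 0 (\<bar>t\<bar> - \<bar>\<mu> - m\<bar>)" for t
    by (auto simp: max_def abs_if)
  have "2 * (LINT z|std_normal_distribution. max (\<mu> + s * z) m)
      = (LINT z|std_normal_distribution. max (\<mu> + s * z) m) + (LINT z|std_normal_distribution. max (\<mu>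
        + s * - z) m)"
    by (subst integral_std_normal_uminus[of "\<lambda>z. max (\<mu> + s * z) m"]) auto
  also have "\<dots> = (LINT z|std_normal_distribution. max (\<mu> + s * z) m + max (\<mu> + s * - z) m)"
    by (rule Bochner_Integration.integral_add[symmetric, OF i])
  also have "\<dots> = (LINT z|std_normal_distribution. 2 * max \<mu> m + max 0 (\<bar>s * z\<bar> - \<bar>\<mu> - m\<bar>))"
    using e by (intro Bochner_Integration.integral_cong) auto
  also have "\<dots> = 2 * max \<mu> m + 2 * gain \<bar>\<mu> - m\<bar> s"
    unfolding gain_def
    by (subst Bochner_Integration.integral_add) (auto intro: integrable_gain simp: N.prob_space[simplified])
  finally show ?thesis by simp
qed

lemma gain_nonneg: "0 \<le> gain \<delta> s"
  unfolding gain_def by (intro divide_nonneg_pos Bochner_Integration.integral_nonneg) auto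

lemma gain_le: "0 \<le> \<delta> \<Longrightarrow> gain \<delta> s \<le> abs_moment * \<bar>s\<bar>"
proof -
  assume \<delta>: "0 \<le> \<delta>"
  have "(LINT z|std_normal_distribution. max 0 (\<bar>s * z\<bar> - \<delta>)) \<le> (LINT z|std_normal_distribution. \<bar>s\<bar> * \<bar>z\<bar>)"
    using \<delta> integrable_std_normal_abs by (intro integral_mono integrable_gain) (auto simp: abs_mult)
  then have "(LINT z|std_normal_distribution. max 0 (\<bar>s * z\<bar> - \<delta>)) \<le> abs_moment * \<bar>s\<bar>"
    by (simp add: abs_moment_def mult.commute)
  moreover have "0 \<le> abs_moment * \<bar>s\<bar>" unfolding abs_moment_def
    by (intro mult_nonneg_nonneg Bochner_Integration.integral_nonneg) auto
  ultimately show ?thesis unfolding gain_def by linarith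
qed

lemma gain_mono:
  assumes "0 \<le> \<delta>" "\<delta> \<le> \<delta>'" "\<bar>s'\<bar> \<le> \<bar>s\<bar>"
  shows "gain \<delta>' s' \<le> gain \<delta> s"
  unfolding gain_def
proof (intro divide_right_mono integral_mono integrable_gain)
  fix z
  have "\<bar>s' * z\<bar> \<le> \<bar>s * z\<bar>" unfolding abs_mult using assms(3) by (intro mult_right_mono) auto
  then show "max 0 (\<bar>s' * z\<bar> - \<delta>') \<le> max 0 (\<bar>s * z\<bar> - \<delta>)" using assms(2) by (auto simp: max_def)
qed (use assms in auto)

text \<open>The integrand is positive right of \<open>\<delta> / s\<close>, in particular on an
  interval of length 1, which the normal law charges.\<close>

lemma gain_pos:
  assumes s: "s > 0" and \<delta>: "0 \<le> \<delta>"
  shows "0 < gain \<delta> s"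
proof (rule ccontr)
  assume "\<not> ?thesis"
  then have "gain \<delta> s = 0" using gain_nonneg[of \<delta> s] by simp
  then have "(LINT z|std_normal_distribution. max 0 (\<bar>s * z\<bar> - \<delta>)) = 0" by (simp add: gain_def)
  then have "AE z in std_normal_distribution. max 0 (\<bar>s * z\<bar> - \<delta>) = 0"
    by (subst (asm) integral_nonneg_eq_0_iff_AE) (auto intro: integrable_gain[OF \<delta>])
  then have "AE z in lborel. \<bar>s * z\<bar> \<le> \<delta>"
    by (subst (asm) AE_density) (auto simp: normal_density_pos max_def split: if_splits elim!:
      eventually_mono)
  then have "AE z in lborel. z \<notin> {\<delta> / s<..<\<delta> / s + 1}"
  proof eventually_elim
    case (elim z)
    then show ?case using s by (auto simp: field_simps abs_if split: if_splits)
  qed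
  then have "{\<delta> / s<..<\<delta> / s + 1} \<in> null_sets lborel"
    by (subst (asm) AE_iff_null_sets[symmetric]) auto
  then have "emeasure lborel {\<delta> / s<..<\<delta> / s + 1} = 0" by (rule null_setsD1)
  then show False by simp
qed

lemma measurable_gain [measurable]:
  assumes [measurable]: "f \<in> borel_measurable N" "g \<in> borel_measurable N"
  shows "(\<lambda>x. gain (f x) (g x)) \<in> borel_measurable N"
proof -
  interpret N: prob_space std_normal_distribution by (rule prob_space_normal_density) simp
  show ?thesis unfolding gain_def by measurable
qed

lemma compact_family_bounds:
  fixes f :: "nat \<Rightarrow> 'x::topological_space \<Rightarrow> real"
  assumes "compact X" "X \<noteq> {}" "M \<ge> (1::nat)"
    and cont: "\<And>i. i \<in> {1..M} \<Longrightarrow> continuous_on X (f i)"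
    and pos: "\<And>i x. i \<in> {1..M} \<Longrightarrow> x \<in> X \<Longrightarrow> 0 < f i x"
  shows "\<exists>lo>0. \<exists>hi. \<forall>i\<in>{1..M}. \<forall>x\<in>X. lo \<le> f i x \<and> f i x \<le> hi"
proof -
  let ?S = "\<Union>i\<in>{1..M}. f i ` X"
  have "compact ?S" using assms by (intro compact_UN compact_continuous_image) auto
  moreover have "?S \<noteq> {}" using assms by auto
  ultimately obtain lo hi where "lo \<in> ?S" "\<forall>t\<in>?S. lo \<le> t" "\<forall>t\<in>?S. t \<le> hi"
    using compact_attains_inf[of ?S] compact_attains_sup[of ?S] by meson
  then show ?thesis using pos by (intro exI[of _ lo] exI[of _ hi] conjI) auto
qed

text \<open>Distinct limits have a unique largest one, and its index eventually beats each of the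
  finitely many others strictly.\<close>

lemma arg_max_eventually_eq:
  fixes f :: "nat \<Rightarrow> nat \<Rightarrow> real"
  assumes lim: "\<And>i. i \<in> {1..M} \<Longrightarrow> (\<lambda>n. f n i) \<longlonglongrightarrow> g i"
    and inj: "\<And>i j. i \<in> {1..M} \<Longrightarrow> j \<in> {1..M} \<Longrightarrow> i \<noteq> j \<Longrightarrow> g i \<noteq> g j" and M: "M \<ge> 1"
  shows "\<forall>\<^sub>F n in sequentially. {i. is_arg_max (f n) (\<lambda>i. i \<in> {1..M}) i}
    = {i. is_arg_max g (\<lambda>i. i \<in> {1..M}) i}"
proof -
  have "Max (g ` {1..M}) \<in> g ` {1..M}" using M by (intro Max_in) auto
  then obtain k where k: "k \<in> {1..M}" "g k = Max (g ` {1..M})" by force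
  have gk: "g i < g k" if "i \<in> {1..M}" "i \<noteq> k" for i
  proof -
    have "g i \<le> g k" unfolding k(2) using that by (intro Max_ge) auto
    then show ?thesis using inj[OF that(1) k(1) that(2)] by simp
  qed
  have one: "{i. is_arg_max u (\<lambda>i. i \<in> {1..M}) i} = {k}" if u: "\<And>i. i \<in> {1..M} \<Longrightarrow> i \<noteq> k
    \<Longrightarrow> u i < u k" for u :: "nat \<Rightarrow> real"
  proof -
    have "is_arg_max u (\<lambda>i. i \<in> {1..M}) i \<longleftrightarrow> i = k" for i
      unfolding is_arg_max_def using u k(1) by (metis less_asym less_irrefl)
    then show ?thesis by blast
  qed
  have "\<forall>\<^sub>F n in sequentially. f n i < f n k" if i: "i \<in> {1..M} - {k}" for i
  proof -
    have "(\<lambda>n. f n k - f n i) \<longlonglongrightarrow> g k - g i" using i k by (intro tendsto_diff lim) auto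
    then have "\<forall>\<^sub>F n in sequentially. 0 < f n k - f n i"
      using gk[of i] i by (intro order_tendstoD(1)) auto
    then show ?thesis by eventually_elim simp
  qed
  then have "\<forall>\<^sub>F n in sequentially. \<forall>i\<in>{1..M} - {k}. f n i < f n k"
    by (intro eventually_ball_finite) auto
  then show ?thesis
  proof eventually_elim
    case (elim n)
    then show ?case using one[of "f n"] one[of g] gk by auto
  qed
qed

section \<open>Bounds on the IKG and consistency of the policy\<close>

locale ikg_policy = gp_sampling P M X \<mu>0 k0 lam \<theta> \<xi> a v y
  for P :: "'w measure" and M and X :: "(real ^ 'd) set" and \<mu>0 k0 lam \<theta> \<xi> a v y +
  fixes c :: "nat \<Rightarrow> real ^ 'd \<Rightarrow> real" and \<gamma> :: "real ^ 'd \<Rightarrow> real" and \<epsilon> :: "nat \<Rightarrow> real"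
  assumes M2: "2 \<le> M"
    and compact_X: "compact X"
    and c_cont': "i \<in> {1..M} \<Longrightarrow> continuous_on X (c i)"
    and c_pos: "i \<in> {1..M} \<Longrightarrow> \<forall>x\<in>X. 0 < c i x"
    and density: "positive_density_on X \<gamma>"
    and eps: "\<epsilon> \<longlonglongrightarrow> 0"
    and policy: "AE \<omega> in P. \<forall>n.
           IKG M X \<gamma> \<mu>0 k0 lam c (history a v y n \<omega>) (a n \<omega>) (v n \<omega>) \<ge>
           (SUP (i, x)\<in>{1..M} \<times> X. IKG M X \<gamma> \<mu>0 k0 lam c (history a v y n \<omega>) i x) - \<epsilon> n"
begin

definition ikg where "ikg n \<omega> i x = IKG M X \<gamma> \<mu>0 k0 lam c (H n \<omega>) i x"

text \<open>The posterior means enter the IKG only through this distance to the best competitor.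
  With \<open>2 \<le> M\<close> the maximum is over a nonempty set.\<close>

definition margin where
  "margin n \<omega> i x = \<bar>pmean n \<omega> i x - (MAX j\<in>{1..M} - {i}. pmean n \<omega> j x)\<bar>"

definition \<sigma> where "\<sigma> n \<omega> i x w = pcov n \<omega> i x w / sqrt (pcov n \<omega> i w w + lam i w)"

lemma X_ne: "X \<noteq> {}"
proof -
  obtain \<omega> where "\<omega> \<in> space P" using not_empty by blast
  then show ?thesis using decision_range[of \<omega> 0] by blast
qed

lemma X_borel [measurable]: "X \<in> sets borel"
  using compact_imp_closed[OF compact_X] by (rule borel_closed)

lemma \<gamma>_int: "set_integrable lborel X \<gamma>" and \<gamma>_1: "(LINT v:X|lborel. \<gamma> v) = 1"
  and \<gamma>_pos: "x \<in> X \<Longrightarrow> 0 < \<gamma> x"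
  and \<gamma>_ball: "x \<in> X \<Longrightarrow> r > 0 \<Longrightarrow> 0 < (LINT v:X \<inter> ball x r|lborel. \<gamma> v)"
  using density by (auto simp: positive_density_on_def)

lemma Max_insert_other:
  assumes "i \<in> {1..M}"
  shows "(MAX j\<in>{1..M}. f j) = max (f i) (MAX j\<in>{1..M} - {i}. f j :: real)"
proof -
  have ne: "{1..M} - {i} \<noteq> {}"
  proof -
    have "(if i = 1 then 2 else 1) \<in> {1..M} - {i}" using M2 by auto
    then show ?thesis by blast
  qed
  have "f ` {1..M} = insert (f i) (f ` ({1..M} - {i}))" using assms by auto
  then show ?thesis using ne by simp
qed

text \<open>Only the mean of alternative \<open>i\<close> moves, so the maximum compares one normal
  variable with one constant, the best of the other means.\<close>

lemma ikg_eq: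
  assumes i: "i \<in> {1..M}"
  shows "ikg n \<omega> i x = 1 / c i x * (LINT w:X|lborel. gain (margin n \<omega> i w) (\<sigma> n \<omega> i w x) * \<gamma> w)"
proof -
  have st: "sigma_tilde k0 lam (H n \<omega>) i w x = \<sigma> n \<omega> i w x" for w
    by (simp add: sigma_tilde_def \<sigma>_def pcov_def)
  have "expected_next_max M \<mu>0 k0 lam (H n \<omega>) i x w - (MAX j\<in>{1..M}. pmean n \<omega> j w)
    = gain (margin n \<omega> i w) (\<sigma> n \<omega> i w x)" for w
  proof -
    have "(MAX j\<in>{1..M}. pmean n \<omega> j w + (if j = i then \<sigma> n \<omega> i w x * z else 0))
      = max (pmean n \<omega> i w + \<sigma> n \<omega> i w x * z) (MAX j\<in>{1..M} - {i}. pmean n \<omega> j w)" for z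
      by (subst Max_insert_other[OF i]) (auto intro!: arg_cong[where f = "max _"] arg_cong[where f
        = Max] image_cong)
    then have "expected_next_max M \<mu>0 k0 lam (H n \<omega>) i x w
      = (LINT z|std_normal_distribution. max (pmean n \<omega> i w
        + \<sigma> n \<omega> i w x * z) (MAX j\<in>{1..M} - {i}. pmean n \<omega> j w))"
      unfolding expected_next_max_def normal_law_std pmean_def[symmetric] st by simp
    then show ?thesis
      unfolding expected_max_eq_gain Max_insert_other[OF i, of "\<lambda>j. pmean n \<omega> j w"] margin_def
      by (simp only: add_diff_cancel_left')
  qed
  then show ?thesis by (simp add: ikg_def IKG_def pmean_def)
qed

lemma \<sigma>_cont:
  assumes \<omega>: "\<omega> \<in> space P" and i: "i \<in> {1..M}" and x: "x \<in> X"
  shows "continuous_on X (\<lambda>w. \<sigma> n \<omega> i w x)"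
  unfolding \<sigma>_def using x post_var_pos'[OF \<omega> i x, of n]
  by (intro continuous_intros c_cont_compose[OF \<omega> i]) auto

lemma measurable_margin:
  assumes \<omega>: "\<omega> \<in> space P" and i: "i \<in> {1..M}"
  shows "margin n \<omega> i \<in> borel_measurable RX"
proof -
  have [measurable]: "pmean n \<omega> j \<in> borel_measurable RX" if "j \<in> {1..M}" for j
    by (rule borel_measurable_continuous_on_restrict[OF m_cont[OF \<omega> that]])
  have [measurable]: "(\<lambda>w. MAX j\<in>{1..M} - {i}. pmean n \<omega> j w) \<in> borel_measurable RX"
    by (rule borel_measurable_Max) auto
  have [measurable]: "pmean n \<omega> i \<in> borel_measurable RX"
    by (rule borel_measurable_continuous_on_restrict[OF m_cont[OF \<omega> i]])
  show ?thesis unfolding margin_def by measurable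
qed

lemma integrable_ikg:
  assumes \<omega>: "\<omega> \<in> space P" and i: "i \<in> {1..M}" and x: "x \<in> X"
    and S: "\<And>w. w \<in> X \<Longrightarrow> \<bar>\<sigma> n \<omega> i w x\<bar> \<le> S"
  shows "set_integrable lborel X (\<lambda>w. gain (margin n \<omega> i w) (\<sigma> n \<omega> i w x) * \<gamma> w)"
    "w \<in> X \<Longrightarrow> gain (margin n \<omega> i w) (\<sigma> n \<omega> i w x) \<le> abs_moment * S"
proof -
  have am: "0 \<le> abs_moment" unfolding abs_moment_def by (intro Bochner_Integration.integral_nonneg) auto
  show le: "gain (margin n \<omega> i w) (\<sigma> n \<omega> i w x) \<le> abs_moment * S" if "w \<in> X" for w
    using gain_le[of "margin n \<omega> i w" "\<sigma> n \<omega> i w x"] mult_left_mono[OF S[OF that] am]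
    by (simp add: margin_def)
  have \<sigma>m: "(\<lambda>w. \<sigma> n \<omega> i w x) \<in> borel_measurable RX"
    by (rule borel_measurable_continuous_on_restrict[OF \<sigma>_cont[OF \<omega> i x]])
  have "(\<lambda>w. gain (margin n \<omega> i w) (\<sigma> n \<omega> i w x)) \<in> borel_measurable RX"
    by (rule measurable_gain[OF measurable_margin[OF \<omega> i] \<sigma>m])
  then have gm: "(\<lambda>w. indicat_real X w * gain (margin n \<omega> i w) (\<sigma> n \<omega> i w x)) \<in> borel_measurable borel"
    using borel_measurable_restrict_space_iff[of X borel "\<lambda>w. gain (margin n \<omega> i w) (\<sigma> n \<omega> i w x)"]
      by (simp add: mult.commute)
  have \<gamma>m: "(\<lambda>w. indicat_real X w * \<gamma> w) \<in> borel_measurable borel"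
    using \<gamma>_int unfolding set_integrable_def by (auto dest: borel_measurable_integrable)
  show "set_integrable lborel X (\<lambda>w. gain (margin n \<omega> i w) (\<sigma> n \<omega> i w x) * \<gamma> w)"
    unfolding set_integrable_def
  proof (rule Bochner_Integration.integrable_bound[where f
    = "\<lambda>w. (abs_moment * S) * (indicat_real X w *\<^sub>R \<gamma> w)"])
    show "integrable lborel (\<lambda>w. (abs_moment * S) * (indicat_real X w *\<^sub>R \<gamma> w))"
      using \<gamma>_int unfolding set_integrable_def by (rule integrable_mult_right)
    have "(\<lambda>w. (indicat_real X w * gain (margin n \<omega> i w) (\<sigma> n \<omega> i w x)) * (indicat_real X w * \<gamma> w))
      \<in> borel_measurable borel"
      by (rule borel_measurable_times[OF gm \<gamma>m])
    moreover have "(indicat_real X w * gain (margin n \<omega> i w) (\<sigma> n \<omega> i w x)) * (indicat_real X w * \<gamma> w)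
      = indicat_real X w *\<^sub>R (gain (margin n \<omega> i w) (\<sigma> n \<omega> i w x) * \<gamma> w)" for w
      by (simp add: indicator_def)
    ultimately show "(\<lambda>w. indicat_real X w *\<^sub>R (gain (margin n \<omega> i w) (\<sigma> n \<omega> i w x) * \<gamma> w))
      \<in> borel_measurable lborel"
      by simp
    have "norm (indicat_real X w *\<^sub>R (gain (margin n \<omega> i w) (\<sigma> n \<omega> i w x) * \<gamma> w))
        \<le> norm ((abs_moment * S) * (indicat_real X w *\<^sub>R \<gamma> w))" for w
    proof (cases "w \<in> X")
      case True
      then have "gain (margin n \<omega> i w) (\<sigma> n \<omega> i w x) * \<gamma> w \<le> (abs_moment * S) * \<gamma> w"
        using \<gamma>_pos[OF True] by (intro mult_right_mono le) auto
      then show ?thesis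
        using True \<gamma>_pos[OF True] gain_nonneg[of "margin n \<omega> i w" "\<sigma> n \<omega> i w x"]
          order_trans[OF le[OF True] abs_ge_self]
        by (simp add: abs_mult)
    qed simp
    then show "AE w in lborel. norm (indicat_real X w *\<^sub>R (gain (margin n \<omega> i w) (\<sigma> n \<omega> i w x) * \<gamma> w))
        \<le> norm ((abs_moment * S) * (indicat_real X w *\<^sub>R \<gamma> w))" by simp
  qed
qed

lemma ikg_le:
  assumes \<omega>: "\<omega> \<in> space P" and i: "i \<in> {1..M}" and x: "x \<in> X"
    and S: "\<And>w. w \<in> X \<Longrightarrow> \<bar>\<sigma> n \<omega> i w x\<bar> \<le> S"
  shows "ikg n \<omega> i x \<le> abs_moment * S / c i x"
proof -
  have "(LINT w:X|lborel. gain (margin n \<omega> i w) (\<sigma> n \<omega> i w x) * \<gamma> w)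
    \<le> (LINT w:X|lborel. (abs_moment * S) * \<gamma> w)"
    using integrable_ikg[OF assms] \<gamma>_int \<gamma>_pos
    by (intro set_integral_mono mult_right_mono) (auto intro: less_imp_le)
  then have "(LINT w:X|lborel. gain (margin n \<omega> i w) (\<sigma> n \<omega> i w x) * \<gamma> w) \<le> abs_moment * S"
    using \<gamma>_1 by simp
  moreover have "0 < c i x" using c_pos[OF i] x by blast
  ultimately show ?thesis unfolding ikg_eq[OF i] by (simp add: divide_right_mono)
qed

text \<open>\<open>gain\<close> falls with the distance of the means and grows with the size of the
  move, so on \<open>E\<close> it is at least \<open>gain \<delta> s\<close>; outside
  \<open>E\<close> the integrand is nonnegative.\<close>

lemma ikg_ge:
  assumes \<omega>: "\<omega> \<in> space P" and i: "i \<in> {1..M}" and x: "x \<in> X"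
    and S: "\<And>w. w \<in> X \<Longrightarrow> \<bar>\<sigma> n \<omega> i w x\<bar> \<le> S"
    and E: "E \<in> sets borel" "E \<subseteq> X"
    and low: "\<And>w. w \<in> E \<Longrightarrow> margin n \<omega> i w \<le> \<delta>" "\<And>w. w \<in> E \<Longrightarrow> s \<le> \<bar>\<sigma> n \<omega> i w x\<bar>" and s: "0 \<le> s"
  shows "gain \<delta> s * (LINT w:E|lborel. \<gamma> w) / c i x \<le> ikg n \<omega> i x"
proof -
  let ?f = "\<lambda>w. gain (margin n \<omega> i w) (\<sigma> n \<omega> i w x) * \<gamma> w"
  have "gain \<delta> s * (LINT w:E|lborel. \<gamma> w) = (LINT w:E|lborel. gain \<delta> s * \<gamma> w)" by simp
  also have "\<dots> \<le> (LINT w:E|lborel. ?f w)"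
  proof (rule set_integral_mono)
    show "set_integrable lborel E (\<lambda>w. gain \<delta> s * \<gamma> w)"
      using set_integrable_subset[OF \<gamma>_int _ E(2)] E(1) by auto
    show "set_integrable lborel E ?f"
      using set_integrable_subset[OF integrable_ikg(1)[OF \<omega> i x S] _ E(2)] E(1) by auto
    show "gain \<delta> s * \<gamma> w \<le> ?f w" if "w \<in> E" for w
      using that E(2) \<gamma>_pos[of w] low[OF that] s
      by (intro mult_right_mono gain_mono) (auto simp: margin_def less_imp_le)
  qed
  also have "\<dots> \<le> (LINT w:X|lborel. ?f w)"
  proof -
    have "(LINT w:E|lborel. ?f w) \<le> (LINT w:E|lborel. ?f w) + (LINT w:X - E|lborel. ?f w)"
      using \<gamma>_pos by (auto simp: set_lebesgue_integral_def indicator_def gain_nonneg less_imp_le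
          intro!: Bochner_Integration.integral_nonneg)
    also have "\<dots> = (LINT w:E \<union> (X - E)|lborel. ?f w)"
      using set_integrable_subset[OF integrable_ikg(1)[OF \<omega> i x S] _ E(2)]
        set_integrable_subset[OF integrable_ikg(1)[OF \<omega> i x S], of "X - E"] E(1)
      by (intro set_integral_Un[symmetric]) auto
    also have "E \<union> (X - E) = X" using E(2) by blast
    finally show ?thesis .
  qed
  finally show ?thesis unfolding ikg_eq[OF i] using c_pos[OF i] x
    by (simp add: divide_right_mono less_imp_le)
qed

lemma kernel_sequence_pcov:
  assumes \<omega>: "\<omega> \<in> space P" and i: "i \<in> {1..M}"
  shows "kernel_sequence X (\<lambda>n. pcov n \<omega> i) (lam i) (\<lambda>n. v n \<omega>) {n. a n \<omega> = i}"
  by unfold_locales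
    (use psd_c[OF \<omega> i] lam_pos[OF i] decision_range[OF \<omega>] c_Suc[OF \<omega> i] in auto)

lemma bounds: "\<exists>B l\<^sub>1 l\<^sub>2 c\<^sub>1 c\<^sub>2. 0 < l\<^sub>1 \<and> 0 < c\<^sub>1 \<and> (\<forall>i\<in>{1..M}. \<forall>x\<in>X.
    k0 i x x \<le> B \<and> l\<^sub>1 \<le> lam i x \<and> lam i x \<le> l\<^sub>2 \<and> c\<^sub>1 \<le> c i x \<and> c i x \<le> c\<^sub>2)"
proof -
  have M1: "1 \<le> M" using M2 by simp
  obtain \<omega> where \<omega>: "\<omega> \<in> space P" using not_empty by blast
  have kc: "continuous_on X (\<lambda>x. k0 i x x)" if "i \<in> {1..M}" for i
  proof -
    have "continuous_on X (\<lambda>x. pcov 0 \<omega> i x x)" by (rule c_cont_compose[OF \<omega> that]) auto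
    then show ?thesis by (simp add: c_0)
  qed
  have eB: "\<exists>lo>0. \<exists>hi. \<forall>i\<in>{1..M}. \<forall>x\<in>X. lo \<le> k0 i x x \<and> k0 i x x \<le> hi"
    by (rule compact_family_bounds[OF compact_X X_ne M1 kc k0_pos])
  have el: "\<exists>lo>0. \<exists>hi. \<forall>i\<in>{1..M}. \<forall>x\<in>X. lo \<le> lam i x \<and> lam i x \<le> hi"
    by (rule compact_family_bounds[OF compact_X X_ne M1 lam_cont bspec[OF lam_pos]])
  have ec: "\<exists>lo>0. \<exists>hi. \<forall>i\<in>{1..M}. \<forall>x\<in>X. lo \<le> c i x \<and> c i x \<le> hi"
    by (rule compact_family_bounds[OF compact_X X_ne M1 c_cont' bspec[OF c_pos]])
  obtain B where B: "\<forall>i\<in>{1..M}. \<forall>x\<in>X. k0 i x x \<le> B" using eB by blast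
  obtain l\<^sub>1 l\<^sub>2 where l: "0 < l\<^sub>1" "\<forall>i\<in>{1..M}. \<forall>x\<in>X. l\<^sub>1 \<le> lam i x \<and> lam i x \<le> l\<^sub>2"
    using el by (elim exE conjE)
  obtain c\<^sub>1 c\<^sub>2 where c: "0 < c\<^sub>1" "\<forall>i\<in>{1..M}. \<forall>x\<in>X. c\<^sub>1 \<le> c i x \<and> c i x \<le> c\<^sub>2"
    using ec by (elim exE conjE)
  have "0 < l\<^sub>1 \<and> 0 < c\<^sub>1 \<and> (\<forall>i\<in>{1..M}. \<forall>x\<in>X.
    k0 i x x \<le> B \<and> l\<^sub>1 \<le> lam i x \<and> lam i x \<le> l\<^sub>2 \<and> c\<^sub>1 \<le> c i x \<and> c i x \<le> c\<^sub>2)"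
  proof (intro conjI ballI l(1) c(1))
    fix i x assume i: "i \<in> {1..M}" and x: "x \<in> X"
    show "k0 i x x \<le> B" by (rule bspec[OF bspec[OF B i] x])
    show "l\<^sub>1 \<le> lam i x" "lam i x \<le> l\<^sub>2" using bspec[OF bspec[OF l(2) i] x] by simp_all
    show "c\<^sub>1 \<le> c i x" "c i x \<le> c\<^sub>2" using bspec[OF bspec[OF c(2) i] x] by simp_all
  qed
  then show ?thesis by (intro exI)
qed

lemma pcov_le_k0:
  assumes "\<omega> \<in> space P" "i \<in> {1..M}" "x \<in> X"
  shows "pcov n \<omega> i x x \<le> k0 i x x" "0 \<le> pcov n \<omega> i x x"
  using kernel_sequence.var_antimono[OF kernel_sequence_pcov[OF assms(1,2)] assms(3), of 0 n]
    psd_on_diag[OF psd_c[OF assms(1,2)] assms(3)] by (auto simp: c_0)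

text \<open>By Cauchy-Schwarz the effect of a sample at \<open>x\<close> on any point
  \<open>w\<close> is governed by the variance at \<open>x\<close> alone, uniformly in
  \<open>w\<close>.\<close>

lemma abs_\<sigma>_le:
  assumes \<omega>: "\<omega> \<in> space P" and i: "i \<in> {1..M}" and x: "x \<in> X" and w: "w \<in> X"
    and B: "k0 i w w \<le> B" and l: "0 < l" "l \<le> lam i x"
  shows "\<bar>\<sigma> n \<omega> i w x\<bar> \<le> sqrt (B * pcov n \<omega> i x x / l)"
proof (rule real_le_rsqrt)
  note nn = pcov_le_k0[OF \<omega> i x, of n]
  have "(pcov n \<omega> i w x)\<^sup>2 \<le> pcov n \<omega> i w w * pcov n \<omega> i x x"
    by (rule psd_on_cauchy_schwarz2[OF psd_c[OF \<omega> i] w x])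
  also have "\<dots> \<le> B * pcov n \<omega> i x x"
    using pcov_le_k0[OF \<omega> i w, of n] B nn by (intro mult_right_mono) auto
  finally have "(pcov n \<omega> i w x)\<^sup>2 / (pcov n \<omega> i x x + lam i x) \<le> B * pcov n \<omega> i x x / l"
    using nn l order_trans[OF zero_le_power2, of "pcov n \<omega> i w x" "B * pcov n \<omega> i x x"]
      by (intro frac_le) auto
  moreover have "\<bar>\<sigma> n \<omega> i w x\<bar>\<^sup>2 = (pcov n \<omega> i w x)\<^sup>2 / (pcov n \<omega> i x x + lam i x)"
    using nn l by (simp add: \<sigma>_def power_divide)
  ultimately show "\<bar>\<sigma> n \<omega> i w x\<bar>\<^sup>2 \<le> B * pcov n \<omega> i x x / l" by simp
qed

lemma ikg_nonneg:
  assumes i: "i \<in> {1..M}" and x: "x \<in> X"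
  shows "0 \<le> ikg n \<omega> i x"
  unfolding ikg_eq[OF i] using c_pos[OF i] x \<gamma>_pos
  by (auto simp: set_lebesgue_integral_def indicator_def gain_nonneg less_imp_le
      intro!: mult_nonneg_nonneg Bochner_Integration.integral_nonneg)

text \<open>An arbitrary decision is compared with the chosen one through the supremum, up to
  \<open>\<epsilon> n\<close>. The IKG of the chosen one is bounded by a function of its own
  posterior variance, which tends to 0.\<close>

lemma ikg_tendsto_0:
  assumes \<omega>: "\<omega> \<in> space P" and i: "i \<in> {1..M}" and x: "x \<in> X"
    and pol: "\<And>n. (SUP (i, x)\<in>{1..M} \<times> X. ikg n \<omega> i x) - \<epsilon> n \<le> ikg n \<omega> (a n \<omega>) (v n \<omega>)"
  shows "(\<lambda>n. ikg n \<omega> i x) \<longlonglongrightarrow> 0"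
proof -
  obtain B l\<^sub>1 l\<^sub>2 c\<^sub>1 c\<^sub>2 where l: "0 < l\<^sub>1" "0 < c\<^sub>1" and all: "\<forall>i\<in>{1..M}. \<forall>x\<in>X.
    k0 i x x \<le> B \<and> l\<^sub>1 \<le> lam i x \<and> lam i x \<le> l\<^sub>2 \<and> c\<^sub>1 \<le> c i x \<and> c i x \<le> c\<^sub>2"
    using bounds by (elim exE conjE)
  have b: "0 < l\<^sub>1" "0 < c\<^sub>1"
    "\<And>i x. i \<in> {1..M} \<Longrightarrow> x \<in> X \<Longrightarrow> k0 i x x \<le> B"
    "\<And>i x. i \<in> {1..M} \<Longrightarrow> x \<in> X \<Longrightarrow> l\<^sub>1 \<le> lam i x \<and> lam i x \<le> l\<^sub>2"
    "\<And>i x. i \<in> {1..M} \<Longrightarrow> x \<in> X \<Longrightarrow> c\<^sub>1 \<le> c i x \<and> c i x \<le> c\<^sub>2"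
    using l all by blast+
  have B0: "0 \<le> B" using b(3)[OF i x] k0_pos[OF i x x] by simp
  have am: "0 \<le> abs_moment" unfolding abs_moment_def by (intro Bochner_Integration.integral_nonneg) auto
  \<comment> \<open>Combines the first absolute moment as a bound for the gain, Cauchy-Schwarz for
    \<open>\<sigma>\<close>, and the lower bounds on noise variance and cost.\<close>
  define G where "G t = abs_moment * sqrt (B * t / l\<^sub>1) / c\<^sub>1" for t
  have up: "ikg n \<omega> j w \<le> G (pcov n \<omega> j w w)" if j: "j \<in> {1..M}" and w: "w \<in> X" for n j w
  proof -
    have "ikg n \<omega> j w \<le> abs_moment * sqrt (B * pcov n \<omega> j w w / l\<^sub>1) / c j w"
      by (rule ikg_le[OF \<omega> j w]) (rule abs_\<sigma>_le[OF \<omega> j w _ b(3)[OF j] b(1)], use b(4)[OF j w] in auto)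
    also have "\<dots> \<le> G (pcov n \<omega> j w w)"
      unfolding G_def using b(1,2) b(5)[OF j w] am B0 pcov_le_k0(2)[OF \<omega> j w, of n]
      by (intro divide_left_mono mult_nonneg_nonneg) auto
    finally show ?thesis .
  qed
  \<comment> \<open>The real \<open>SUP\<close> is known to dominate the members of the family only
    once the family is bounded above.\<close>
  have bdd: "bdd_above ((\<lambda>(i, x). ikg n \<omega> i x) ` ({1..M} \<times> X))" for n
  proof (rule bdd_aboveI[where M = "G B"])
    fix t assume "t \<in> (\<lambda>(i, x). ikg n \<omega> i x) ` ({1..M} \<times> X)"
    then obtain j w where t: "j \<in> {1..M}" "w \<in> X" "t = ikg n \<omega> j w" by auto
    have "G (pcov n \<omega> j w w) \<le> G B"
      unfolding G_def using b(1,2) am B0 pcov_le_k0[OF \<omega> t(1,2), of n] b(3)[OF t(1,2)]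
      by (intro divide_right_mono mult_left_mono real_sqrt_le_mono) auto
    then show "t \<le> G B" using up[OF t(1,2), of n] t(3) by simp
  qed
  have dr: "a n \<omega> \<in> {1..M}" "v n \<omega> \<in> X" for n using decision_range[OF \<omega>] by auto
  have le: "ikg n \<omega> i x \<le> G (pcov n \<omega> (a n \<omega>) (v n \<omega>) (v n \<omega>)) + \<epsilon> n" for n
  proof -
    have "ikg n \<omega> i x \<le> (SUP (i, x)\<in>{1..M} \<times> X. ikg n \<omega> i x)"
      using cSUP_upper[OF _ bdd, of "(i, x)" n] i x by simp
    also have "\<dots> \<le> ikg n \<omega> (a n \<omega>) (v n \<omega>) + \<epsilon> n" using pol[of n] by simp
    also have "\<dots> \<le> G (pcov n \<omega> (a n \<omega>) (v n \<omega>) (v n \<omega>)) + \<epsilon> n" using up[OF dr, of n n n] by simp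
    finally show ?thesis .
  qed
  have "(\<lambda>n. pcov n \<omega> (a n \<omega>) (v n \<omega>) (v n \<omega>)) \<longlonglongrightarrow> 0"
  proof (rule order_tendstoI)
    fix t :: real assume "t < 0"
    then show "\<forall>\<^sub>F n in sequentially. t < pcov n \<omega> (a n \<omega>) (v n \<omega>) (v n \<omega>)"
      using pcov_le_k0(2)[OF \<omega> dr] by (intro always_eventually allI) (auto intro: less_le_trans)
  next
    fix t :: real assume t: "0 < t"
    have "\<forall>\<^sub>F n in sequentially. a n \<omega> = j \<longrightarrow> pcov n \<omega> j (v n \<omega>) (v n \<omega>) < t" if j: "j \<in> {1..M}" for j
    proof -
      interpret kernel_sequence X "\<lambda>n. pcov n \<omega> j" "lam j" "\<lambda>n. v n \<omega>" "{n. a n \<omega> = j}"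
        by (rule kernel_sequence_pcov[OF \<omega> j])
      have "\<forall>\<^sub>F n in sequentially. n \<in> {n. a n \<omega> = j} \<longrightarrow> pcov n \<omega> j (v n \<omega>) (v n \<omega>) < t"
      proof (rule sampled_variance_eventually_less[OF compact_X _ _ _ t])
        show "lam j x \<le> l\<^sub>2" if "x \<in> X" for x using b(4)[OF j that] by blast
        show "pcov 0 \<omega> j x x \<le> B" if "x \<in> X" for x using b(3)[OF j that] by (simp add: c_0)
        show "continuous_on X (\<lambda>x'. qf (pcov 0 \<omega> j) [(1, x'), (- 1, x)])" if "x \<in> X" for x
          unfolding qf_def using that
          by (simp del: c_0) (intro continuous_intros c_cont_compose[OF \<omega> j], auto)
      qed
      then show ?thesis by simp
    qed
    then have "\<forall>\<^sub>F n in sequentially. \<forall>j\<in>{1..M}. a n \<omega> = j \<longrightarrow> pcov n \<omega> j (v n \<omega>) (v n \<omega>) < t"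
      by (intro eventually_ball_finite) auto
    then show "\<forall>\<^sub>F n in sequentially. pcov n \<omega> (a n \<omega>) (v n \<omega>) (v n \<omega>) < t"
      by eventually_elim (use dr in auto)
  qed
  then have "(\<lambda>n. G (pcov n \<omega> (a n \<omega>) (v n \<omega>) (v n \<omega>)) + \<epsilon> n) \<longlonglongrightarrow> G 0 + 0"
    unfolding G_def using b(1,2) eps by (intro tendsto_intros) auto
  then have z: "(\<lambda>n. G (pcov n \<omega> (a n \<omega>) (v n \<omega>) (v n \<omega>)) + \<epsilon> n) \<longlonglongrightarrow> 0" by (simp add: G_def)
  show ?thesis
  proof (rule tendsto_sandwich[OF _ _ tendsto_const z])
    show "\<forall>\<^sub>F n in sequentially. 0 \<le> ikg n \<omega> i x"
      by (intro always_eventually allI ikg_nonneg[OF i x])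
    show "\<forall>\<^sub>F n in sequentially. ikg n \<omega> i x \<le> G (pcov n \<omega> (a n \<omega>) (v n \<omega>) (v n \<omega>)) + \<epsilon> n"
      by (intro always_eventually allI le)
  qed
qed

text \<open>If the variance at \<open>x\<close> stayed above \<open>L > 0\<close>, then on a non-null set of points near \<open>x\<close>, where the
  posterior means stay bounded, the one-step gain and hence the IKG at \<open>x\<close> would stay away from 0.\<close>

lemma posterior_variance_tendsto_0:
  assumes \<omega>: "\<omega> \<in> space P" and i: "i \<in> {1..M}" and x: "x \<in> X"
    and pol: "\<And>n. (SUP (i, x)\<in>{1..M} \<times> X. ikg n \<omega> i x) - \<epsilon> n \<le> ikg n \<omega> (a n \<omega>) (v n \<omega>)"
    and bnd: "AE w in restrict_space lborel X. \<forall>j\<in>{1..M}. \<exists>k::nat. \<forall>m. \<bar>pmean m \<omega> j w\<bar> \<le> real k"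
  shows "(\<lambda>n. pcov n \<omega> i x x) \<longlonglongrightarrow> 0"
proof -
  interpret kernel_sequence X "\<lambda>n. pcov n \<omega> i" "lam i" "\<lambda>n. v n \<omega>" "{n. a n \<omega> = i}"
    by (rule kernel_sequence_pcov[OF \<omega> i])
  have dec: "decseq (\<lambda>n. pcov n \<omega> i x x)" using var_antimono[OF x] by (simp add: decseq_def)
  have nn: "0 \<le> pcov n \<omega> i x x" for n by (rule pcov_le_k0(2)[OF \<omega> i x])
  obtain L where L: "(\<lambda>n. pcov n \<omega> i x x) \<longlonglongrightarrow> L"
    using decseq_convergent[OF dec, of 0] nn by blast
  have "L = 0"
  proof (rule ccontr)
    assume "L \<noteq> 0"
    moreover have "0 \<le> L" by (rule LIMSEQ_le_const[OF L]) (use nn in auto)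
    ultimately have L0: "0 < L" by simp
    have ge: "L \<le> pcov n \<omega> i x x" for n by (rule decseq_ge[OF dec L])
    obtain B l\<^sub>1 l\<^sub>2 c\<^sub>1 c\<^sub>2 where l: "0 < l\<^sub>1" "0 < c\<^sub>1" and all: "\<forall>i\<in>{1..M}. \<forall>x\<in>X.
      k0 i x x \<le> B \<and> l\<^sub>1 \<le> lam i x \<and> lam i x \<le> l\<^sub>2 \<and> c\<^sub>1 \<le> c i x \<and> c i x \<le> c\<^sub>2"
      using bounds by (elim exE conjE)
    \<comment> \<open>The bound from \<open>cov_diff_le\<close>, formed with the prior kernel, so
      that the radius \<open>r\<close> obtained from it serves for all times at once.\<close>
    let ?f = "\<lambda>w. pcov 0 \<omega> i x x * qf (pcov 0 \<omega> i) [(1, w), (-1, x)]"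
    have "continuous_on X ?f"
      unfolding qf_def using x
      by simp (intro continuous_intros c_cont_compose[OF \<omega> i], auto)
    moreover have fx: "?f x = 0" by (simp add: qf_def)
    ultimately obtain r where r: "r > 0" "\<forall>w\<in>X. dist w x < r \<longrightarrow> dist (?f w) (?f x) < (L/2)\<^sup>2"
      using x L0 unfolding continuous_on_iff by (metis half_gt_zero zero_less_power)
    have K_near: "L / 2 \<le> pcov n \<omega> i w x" if w: "w \<in> X" "dist w x < r" for n w
    proof -
      have "(pcov n \<omega> i x w - pcov n \<omega> i x x)\<^sup>2 \<le> ?f w" by (rule cov_diff_le[OF x w(1) x])
      also have "\<dots> < (L/2)\<^sup>2" using r(2) w unfolding fx by (auto simp: dist_real_def)
      finally have "\<bar>pcov n \<omega> i x w - pcov n \<omega> i x x\<bar>\<^sup>2 < (L/2)\<^sup>2" by simp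
      then have "\<bar>pcov n \<omega> i x w - pcov n \<omega> i x x\<bar> < L/2"
        by (rule power2_less_imp_less) (use L0 in simp)
      then have "L / 2 \<le> pcov n \<omega> i x w" using ge[of n] by linarith
      then show ?thesis using psd_on_sym[OF psd_c[OF \<omega> i] x w(1), of n] by simp
    qed
    \<comment> \<open>Within distance \<open>r\<close> the covariance with \<open>x\<close> is at
      least \<open>L / 2\<close>, and the predictive variance at \<open>x\<close> is at most
      \<open>B + l\<^sub>2\<close>.\<close>
    define s where "s = (L / 2) / sqrt (B + l\<^sub>2)"
    have "l\<^sub>1 \<le> lam i x" "lam i x \<le> l\<^sub>2" "k0 i x x \<le> B" using all i x by blast+
    then have lx: "l\<^sub>1 \<le> lam i x" "lam i x \<le> l\<^sub>2" "k0 i x x \<le> B" "0 < B + l\<^sub>2"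
      using k0_pos[OF i x x] l by linarith+
    then have s: "0 < s" using L0 by (simp add: s_def)
    have \<sigma>_near: "s \<le> \<bar>\<sigma> n \<omega> i w x\<bar>" if w: "w \<in> X" "dist w x < r" for n w
    proof -
      have p: "0 < pcov n \<omega> i x x + lam i x" "pcov n \<omega> i x x + lam i x \<le> B + l\<^sub>2"
        using nn[of n] pcov_le_k0(1)[OF \<omega> i x, of n] lx l by linarith+
      have "s \<le> pcov n \<omega> i w x / sqrt (pcov n \<omega> i x x + lam i x)"
        unfolding s_def using K_near[OF w, of n] L0 p by (intro frac_le) auto
      also have "\<dots> \<le> \<bar>\<sigma> n \<omega> i w x\<bar>" unfolding \<sigma>_def by (rule abs_ge_self)
      finally show ?thesis .
    qed
    \<comment> \<open>Points near \<open>x\<close> at which all posterior means stay within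
      \<open>K\<close> for all times. Over all \<open>K\<close> these sets cover almost every point
      of \<open>X\<close> in the ball, which has positive mass under \<open>\<gamma>\<close>, so one
      of them is charged by \<open>\<gamma>\<close>.\<close>
    define E where "E K = (X \<inter> ball x r) \<inter> {w \<in> space RX. \<forall>m. \<forall>j\<in>{1..M}. \<bar>pmean m \<omega> j w\<bar>
      \<le> real K}" for K :: nat
    have EX: "E K \<subseteq> X" for K by (auto simp: E_def)
    have E [measurable]: "E K \<in> sets borel" for K
    proof -
      have [measurable]: "pmean m \<omega> j \<in> borel_measurable RX" if "j \<in> {1..M}" for j m
        by (rule borel_measurable_continuous_on_restrict[OF m_cont[OF \<omega> that]])
      have "{w \<in> space RX. \<forall>m. \<forall>j\<in>{1..M}. \<bar>pmean m \<omega> j w\<bar> \<le> real K} \<in> sets RX" by measurable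
      then have "{w \<in> space RX. \<forall>m. \<forall>j\<in>{1..M}. \<bar>pmean m \<omega> j w\<bar> \<le> real K} \<in> sets borel"
        by (subst (asm) sets_restrict_space_iff) auto
      then show ?thesis unfolding E_def by simp
    qed
    have intE: "set_integrable lborel (E K) \<gamma>" for K
      using set_integrable_subset[OF \<gamma>_int _ EX] E by simp
    have "\<exists>K. 0 < (LINT w:E K|lborel. \<gamma> w)"
    proof (rule ccontr)
      assume neg: "\<not> ?thesis"
      have nE: "AE w in lborel. w \<notin> E K" for K
      proof -
        have g0: "0 \<le> indicat_real (E K) w *\<^sub>R \<gamma> w" for w
          using EX[of K] \<gamma>_pos[of w] by (auto simp: indicator_def less_imp_le)
        then have "0 \<le> (LINT w:E K|lborel. \<gamma> w)"
          unfolding set_lebesgue_integral_def by (intro Bochner_Integration.integral_nonneg)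
        then have "(LINT w:E K|lborel. \<gamma> w) = 0" using neg by (auto simp: not_less intro: antisym)
        then have "AE w in lborel. indicat_real (E K) w *\<^sub>R \<gamma> w = 0"
          using intE[of K] g0 unfolding set_lebesgue_integral_def set_integrable_def
          by (subst integral_nonneg_eq_0_iff_AE[symmetric]) auto
        then show ?thesis
        proof eventually_elim
          case (elim w)
          then show ?case using EX[of K] \<gamma>_pos[of w] by (auto simp: indicator_def)
        qed
      qed
      have "AE w in lborel. w \<in> X \<longrightarrow> (\<forall>j\<in>{1..M}. \<exists>k::nat. \<forall>m. \<bar>pmean m \<omega> j w\<bar> \<le> real k)"
        using bnd by (subst (asm) AE_restrict_space_iff) auto
      moreover have "AE w in lborel. \<forall>K. w \<notin> E K" using nE by (simp add: AE_all_countable)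
      ultimately have "AE w in lborel. w \<notin> X \<inter> ball x r"
      proof eventually_elim
        case (elim w)
        show ?case
        proof
          assume w: "w \<in> X \<inter> ball x r"
          then obtain k :: "nat \<Rightarrow> nat" where k: "\<forall>j\<in>{1..M}. \<forall>m. \<bar>pmean m \<omega> j w\<bar> \<le> real (k j)"
            using elim(1) by (metis IntD1)
          have "w \<in> E (\<Sum>j\<in>{1..M}. k j)"
          proof -
            have "\<bar>pmean m \<omega> j w\<bar> \<le> real (\<Sum>j\<in>{1..M}. k j)" if j: "j \<in> {1..M}" for m j
            proof -
              have "k j \<le> (\<Sum>j\<in>{1..M}. k j)" using j by (intro member_le_sum) auto
              then show ?thesis using k j by (meson of_nat_le_iff order_trans)
            qed
            then show ?thesis using w by (simp add: E_def space_restrict_space)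
          qed
          then show False using elim(2) by blast
        qed
      qed
      then have "AE w in lborel. indicat_real (X \<inter> ball x r) w *\<^sub>R \<gamma> w = 0"
        by eventually_elim (simp add: indicator_def)
      then have "(LINT w:X \<inter> ball x r|lborel. \<gamma> w) = 0"
        unfolding set_lebesgue_integral_def by (rule integral_eq_zero_AE)
      then show False using \<gamma>_ball[OF x r(1)] by simp
    qed
    then obtain K where K: "0 < (LINT w:E K|lborel. \<gamma> w)" by blast
    have others: "margin n \<omega> i w \<le> 2 * real K" if w: "w \<in> E K" for n w
    proof -
      have b: "\<bar>pmean n \<omega> j w\<bar> \<le> real K" if "j \<in> {1..M}" for j using w that by (auto simp: E_def)
      have "(if i = 1 then 2 else 1) \<in> {1..M} - {i}" using M2 by auto
      then have "(MAX j\<in>{1..M} - {i}. pmean n \<omega> j w) \<in> (\<lambda>j. pmean n \<omega> j w) ` ({1..M} - {i})"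
        by (intro Max_in) auto
      then obtain j where "j \<in> {1..M}" "(MAX j\<in>{1..M} - {i}. pmean n \<omega> j w) = pmean n \<omega> j w" by blast
      then show ?thesis unfolding margin_def using b[OF i] b[of j] by linarith
    qed
    have S: "\<bar>\<sigma> n \<omega> i w x\<bar> \<le> sqrt (B * pcov n \<omega> i x x / l\<^sub>1)" if w: "w \<in> X" for n w
      by (rule abs_\<sigma>_le[OF \<omega> i x w _ l(1) lx(1)]) (use all i w in blast)
    let ?d = "gain (2 * real K) s * (LINT w:E K|lborel. \<gamma> w) / c i x"
    have "?d \<le> ikg n \<omega> i x" for n
      by (rule ikg_ge[OF \<omega> i x S E EX others])
        (use \<sigma>_near s in \<open>auto simp: E_def dist_commute\<close>)
    then have "?d \<le> 0"
      by (intro LIMSEQ_le_const[OF ikg_tendsto_0[OF \<omega> i x pol]]) auto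
    moreover have "0 < ?d" using K gain_pos[OF s, of "2 * real K"] c_pos[OF i] x by simp
    ultimately show False by simp
  qed
  then show ?thesis using L by simp
qed

text \<open>Costs are bounded below by a positive constant, so every budget is eventually exceeded
  and the \<open>LEAST\<close> is attained. A budget of at least \<open>?C Z\<close> cannot be
  exceeded before time \<open>Z\<close>.\<close>

lemma budget_stop_at_top:
  assumes \<omega>: "\<omega> \<in> space P"
  shows "filterlim (\<lambda>B. budget_stop c a v B \<omega>) at_top at_top"
proof -
  obtain B l\<^sub>1 l\<^sub>2 c\<^sub>1 c\<^sub>2 where l: "0 < l\<^sub>1" "0 < c\<^sub>1" and all: "\<forall>i\<in>{1..M}. \<forall>x\<in>X.
    k0 i x x \<le> B \<and> l\<^sub>1 \<le> lam i x \<and> lam i x \<le> l\<^sub>2 \<and> c\<^sub>1 \<le> c i x \<and> c i x \<le> c\<^sub>2"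
    using bounds by (elim exE conjE)
  let ?C = "\<lambda>N. \<Sum>n\<le>N. c (a n \<omega>) (v n \<omega>)"
  have c1: "c\<^sub>1 \<le> c (a n \<omega>) (v n \<omega>)" for n using all decision_range[OF \<omega>, of n] by blast
  have mono: "?C N \<le> ?C N'" if "N \<le> N'" for N N'
    using that order_trans[OF less_imp_le[OF l(2)] c1] by (intro sum_mono2) auto
  have ex: "\<exists>N. b < ?C N" for b
  proof -
    obtain N :: nat where N: "b / c\<^sub>1 < real N" using reals_Archimedean2 by blast
    have "b < real N * c\<^sub>1" using N l by (simp add: field_simps)
    also have "\<dots> \<le> real (card {..N}) * c\<^sub>1" using l by simp
    also have "\<dots> \<le> ?C N" by (rule sum_bounded_below) (rule c1)
    finally show ?thesis by blast
  qed
  show ?thesis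
    unfolding filterlim_at_top
  proof
    fix Z
    show "\<forall>\<^sub>F b in at_top. Z \<le> budget_stop c a v b \<omega>"
      using eventually_ge_at_top[of "?C Z"]
    proof eventually_elim
      case (elim b)
      have "b < ?C (budget_stop c a v b \<omega>)"
        unfolding budget_stop_def by (rule LeastI_ex[OF ex])
      then show ?case using mono[of "budget_stop c a v b \<omega>" Z] elim
        by (meson le_cases less_le_not_le order_trans)
    qed
  qed
qed

lemma consistent:
  assumes x: "x \<in> X"
  shows "AE \<omega> in P. \<forall>\<^sub>F B in at_top.
           {i. is_arg_max
                 (\<lambda>i. post_mean \<mu>0 k0 lam (history a v y (budget_stop c a v B \<omega>) \<omega>) i x)
                 (\<lambda>i. i \<in> {1..M}) i} =
           {i. is_arg_max (\<lambda>i. \<theta> i x \<omega>) (\<lambda>i. i \<in> {1..M}) i}"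
proof -
  have cM: "countable {1..M}" by simp
  have "AE \<omega> in P. \<forall>j\<in>{1..M}. AE w in restrict_space lborel X. \<exists>k::nat. \<forall>m. \<bar>pmean m \<omega> j w\<bar> \<le> real k"
    unfolding AE_ball_countable[OF cM] using posterior_mean_bounded_ae_point X_borel by blast
  then have bnd: "AE \<omega> in P. AE w in restrict_space lborel X. \<forall>j\<in>{1..M}. \<exists>k::nat. \<forall>m. \<bar>pmean m \<omega> j w\<bar>
    \<le> real k"
    unfolding AE_ball_countable[OF cM] .
  have var: "AE \<omega> in P. (\<lambda>n. pcov n \<omega> i x x) \<longlonglongrightarrow> 0" if i: "i \<in> {1..M}" for i
    using policy bnd AE_space
  proof eventually_elim
    case (elim \<omega>)
    show ?case
    proof (rule posterior_variance_tendsto_0[OF elim(3) i x _ elim(2)])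
      show "(SUP (i, x)\<in>{1..M} \<times> X. ikg n \<omega> i x) - \<epsilon> n \<le> ikg n \<omega> (a n \<omega>) (v n \<omega>)" for n
        using elim(1) unfolding ikg_def H_def by blast
    qed
  qed
  have lim: "AE \<omega> in P. \<forall>i\<in>{1..M}. (\<lambda>n. pmean n \<omega> i x) \<longlonglongrightarrow> \<theta> i x \<omega>"
    unfolding AE_ball_countable[OF cM] using posterior_mean_tendsto[OF _ x var] by blast
  have ties: "AE \<omega> in P. \<forall>i\<in>{1..M}. \<forall>j\<in>{1..M}. i \<noteq> j \<longrightarrow> \<theta> i x \<omega> \<noteq> \<theta> j x \<omega>"
    unfolding AE_ball_countable[OF cM] using prior_no_ties[OF _ _ _ x] by (auto simp: AE_impI)
  show ?thesis
    using lim ties AE_space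
  proof eventually_elim
    case (elim \<omega>)
    have "\<forall>\<^sub>F n in sequentially. {i. is_arg_max (\<lambda>i. pmean n \<omega> i x) (\<lambda>i. i \<in> {1..M}) i}
        = {i. is_arg_max (\<lambda>i. \<theta> i x \<omega>) (\<lambda>i. i \<in> {1..M}) i}"
      by (rule arg_max_eventually_eq) (use elim M2 in auto)
    \<comment> \<open>Agreement for all late sample counts is evaluated at the path-dependent
      stopping index, which tends to infinity on every path.\<close>
    from eventually_compose_filterlim[OF this budget_stop_at_top[OF elim(3)]]
    show ?case by (simp add: pmean_def H_def)
  qed
qed

end

theorem theorem3:
  fixes P :: "'w measure"
    and M :: nat
    and X :: "(real ^ 'd) set"
    and \<gamma> :: "real ^ 'd \<Rightarrow> real"
    and \<mu>0 :: "nat \<Rightarrow> real ^ 'd \<Rightarrow> real"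
    and k0 :: "nat \<Rightarrow> real ^ 'd \<Rightarrow> real ^ 'd \<Rightarrow> real"
    and lam c :: "nat \<Rightarrow> real ^ 'd \<Rightarrow> real"
    and \<theta> :: "nat \<Rightarrow> real ^ 'd \<Rightarrow> 'w \<Rightarrow> real"
    and \<xi> y :: "nat \<Rightarrow> 'w \<Rightarrow> real"
    and a :: "nat \<Rightarrow> 'w \<Rightarrow> nat"
    and v :: "nat \<Rightarrow> 'w \<Rightarrow> real ^ 'd"
    and \<epsilon> :: "nat \<Rightarrow> real"
  assumes "M \<ge> 2"
    and "sampling_model P M X \<mu>0 k0 lam \<theta> \<xi> a v y"
    and "\<forall>i\<in>{1..M}. \<exists>\<tau> \<rho>. \<tau> > 0 \<and> correlation_function \<rho> \<and>
           (\<forall>x\<in>X. \<forall>x'\<in>X. k0 i x x' = \<tau>\<^sup>2 * \<rho> (x - x'))"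
    and "compact X" and "interior X \<noteq> {}"
    and "\<forall>i\<in>{1..M}. continuous_on X (\<mu>0 i)"
    and "\<forall>i\<in>{1..M}. continuous_on X (lam i) \<and> (\<forall>x\<in>X. lam i x > 0)"
    and "\<forall>i\<in>{1..M}. continuous_on X (c i) \<and> (\<forall>x\<in>X. c i x > 0)"
    and "positive_density_on X \<gamma>"
    and "\<forall>n. \<epsilon> n \<ge> 0" and "\<epsilon> \<longlonglongrightarrow> 0"
    and "AE \<omega> in P. \<forall>n.
           IKG M X \<gamma> \<mu>0 k0 lam c (history a v y n \<omega>) (a n \<omega>) (v n \<omega>) \<ge>
           (SUP (i, x)\<in>{1..M} \<times> X. IKG M X \<gamma> \<mu>0 k0 lam c (history a v y n \<omega>) i x) - \<epsilon> n"
  shows "\<forall>x\<in>X. AE \<omega> in P. \<forall>\<^sub>F B in at_top.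
           {i. is_arg_max
                 (\<lambda>i. post_mean \<mu>0 k0 lam (history a v y (budget_stop c a v B \<omega>) \<omega>) i x)
                 (\<lambda>i. i \<in> {1..M}) i} =
           {i. is_arg_max (\<lambda>i. \<theta> i x \<omega>) (\<lambda>i. i \<in> {1..M}) i}"
proof
  fix x assume x: "x \<in> X"
  interpret ikg_policy P M X \<mu>0 k0 lam \<theta> \<xi> a v y c \<gamma> \<epsilon>
  proof (intro ikg_policy.intro gp_sampling.intro gp_sampling_axioms.intro ikg_policy_axioms.intro)
    show "sampling_model P M X \<mu>0 k0 lam \<theta> \<xi> a v y" by fact
  qed (use assms in blast)+
  show "AE \<omega> in P. \<forall>\<^sub>F B in at_top.
           {i. is_arg_max
                 (\<lambda>i. post_mean \<mu>0 k0 lam (history a v y (budget_stop c a v B \<omega>) \<omega>) i x)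
                 (\<lambda>i. i \<in> {1..M}) i} =
           {i. is_arg_max (\<lambda>i. \<theta> i x \<omega>) (\<lambda>i. i \<in> {1..M}) i}"
    by (rule consistent[OF x])
qed

end
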